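(* Let $n\ge2$ and use the notation of the context. Every facet of $\overline{C(I,I^m(\mathcal M))}$ either contains $\overline{C(I,I^h(\mathcal M))}$ or intersects $\overline{C(I,I^h(\mathcal M))}$ in a facet of the latter cone.
   Context: $R$ is the polynomial ring over $\mathbb{C}$ in the Plücker variables $X_{i_1,\ldots,i_k}$, $1\le k\le n-1$, $1\le i_1<\dots<i_k\le n$, and $I$ is the ideal of Plücker relations (kernel of $X_{i_1,\ldots,i_k}\mapsto\det(z_{r,i_s})_{1\le r,s\le k}$). $\mathcal M$ is the lattice of symbols $a_{i_1,\ldots,i_k}$, one per Plücker variable, with $a_{i_1..i_k}\le a_{j_1..j_l}$ iff $k\ge l$ and $i_r\le j_r$ for $r\le l$ (for $k\ge l$: meet $a_{\min(i_1,j_1),..,\min(i_l,j_l),i_{l+1},..,i_k}$, join $a_{\max(i_1,j_1),..,\max(i_l,j_l)}$); $X_a$ denotes the corresponding variable. $I^m(\mathcal M)$ is generated by $X_aX_b$ over incomparable $a,b$; $I^h(\mathcal M)$ is generated by $X_aX_b-X_{a\vee b}X_{a\wedge b}$ over all $a,b$. For $w\in\mathbb{R}^{\mathcal M}$, $\mathrm{in}_wp$ is the part of $p$ of minimal $w$-weight, $\mathrm{in}_wI$ the span of $\mathrm{in}_wp$, $p\in I$, and $C(I,J)=\{w:\mathrm{in}_wI=J\}$; both cones are nonempty. *)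

theory Defs
  imports
    "Jordan_Normal_Form.Determinant"
    "HOL-Analysis.Analysis"
    "HOL-Library.Poly_Mapping"
    "HOL-Library.Cardinality"
begin

no_notation Matrix.vec_index (infixl "$" 100)

section \<open>Indices of the Pluecker variables\<close>

text \<open>
  The number \<open>n\<close> is \<open>CARD('n)\<close> for a type \<open>'n\<close> of class \<^class>\<open>card2\<close>, the class of finite types
  with at least two elements; every \<open>n \<ge> 2\<close> arises in this way and only \<open>CARD('n)\<close> is ever used.
  An element of \<open>'n plucker\<close> is a sequence \<open>1 \<le> i\<^sub>1 < \<dots> < i\<^sub>k \<le> n\<close> with \<open>1 \<le> k \<le> n - 1\<close>. It is
  used both as the element \<open>a\<close> of the lattice and as the name of the variable \<open>X\<^sub>a\<close>. In
  \<^term>\<open>idx a\<close> the entries are numbered from 0, so \<open>i\<^sub>r\<close> is \<^term>\<open>idx a ! (r - 1)\<close>.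
\<close>

typedef (overloaded) ('n::card2) plucker =
  "{xs :: nat list. sorted_wrt (<) xs \<and> set xs \<subseteq> {1..CARD('n)} \<and>
                    1 \<le> length xs \<and> length xs \<le> CARD('n) - 1}"
  morphisms idx plucker_of
proof
  show "[1] \<in> {xs :: nat list. sorted_wrt (<) xs \<and> set xs \<subseteq> {1..CARD('n)} \<and>
                    1 \<le> length xs \<and> length xs \<le> CARD('n) - 1}"
    using one_less_card[where 'a='n] by simp
qed

setup_lifting type_definition_plucker

instance plucker :: (card2) finite
proof
  have "{xs :: nat list. sorted_wrt (<) xs \<and> set xs \<subseteq> {1..CARD('a)} \<and>
                    1 \<le> length xs \<and> length xs \<le> CARD('a) - 1}
        \<subseteq> {xs. set xs \<subseteq> {1..CARD('a)} \<and> length xs \<le> CARD('a) - 1}"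
    by auto
  then have "finite {xs :: nat list. sorted_wrt (<) xs \<and> set xs \<subseteq> {1..CARD('a)} \<and>
                    1 \<le> length xs \<and> length xs \<le> CARD('a) - 1}"
    by (rule finite_subset) (rule finite_lists_length_le, simp)
  then show "finite (UNIV :: 'a plucker set)"
    unfolding type_definition.univ[OF type_definition_plucker] by simp
qed

definition meet_list :: "nat list \<Rightarrow> nat list \<Rightarrow> nat list" where
  "meet_list xs ys = map2 min xs ys @ drop (length ys) xs @ drop (length xs) ys"

definition join_list :: "nat list \<Rightarrow> nat list \<Rightarrow> nat list" where
  "join_list xs ys = map2 max xs ys"

lemma length_meet_list: "length (meet_list xs ys) = max (length xs) (length ys)"
  by (simp add: meet_list_def)

lemma length_join_list: "length (join_list xs ys) = min (length xs) (length ys)"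
  by (simp add: join_list_def)

lemma nth_meet_list:
  "i < max (length xs) (length ys) \<Longrightarrow> meet_list xs ys ! i =
     (if i < length xs then if i < length ys then min (xs ! i) (ys ! i) else xs ! i else ys ! i)"
  by (auto simp: meet_list_def nth_append)

lemma nth_join_list:
  "i < min (length xs) (length ys) \<Longrightarrow> join_list xs ys ! i = max (xs ! i) (ys ! i)"
  by (simp add: join_list_def)

instantiation plucker :: (card2) lattice
begin

lift_definition less_eq_plucker :: "'a plucker \<Rightarrow> 'a plucker \<Rightarrow> bool" is
  "\<lambda>xs ys. length ys \<le> length xs \<and> (\<forall>r<length ys. xs ! r \<le> ys ! r)" .

definition less_plucker :: "'a plucker \<Rightarrow> 'a plucker \<Rightarrow> bool" where
  "less_plucker a b \<longleftrightarrow> a \<le> b \<and> \<not> b \<le> a"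

lift_definition inf_plucker :: "'a plucker \<Rightarrow> 'a plucker \<Rightarrow> 'a plucker" is meet_list
proof -
  fix xs ys :: "nat list"
  assume x: "sorted_wrt (<) xs \<and> set xs \<subseteq> {1..CARD('a)} \<and> 1 \<le> length xs \<and> length xs \<le> CARD('a) - 1"
    and y: "sorted_wrt (<) ys \<and> set ys \<subseteq> {1..CARD('a)} \<and> 1 \<le> length ys \<and> length ys \<le> CARD('a) - 1"
  have sx: "\<And>i j. i < j \<Longrightarrow> j < length xs \<Longrightarrow> xs ! i < xs ! j"
    and sy: "\<And>i j. i < j \<Longrightarrow> j < length ys \<Longrightarrow> ys ! i < ys ! j"
    using x y by (auto simp: sorted_wrt_iff_nth_less)
  have rx: "\<And>i. i < length xs \<Longrightarrow> xs ! i \<in> {1..CARD('a)}"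
    and ry: "\<And>i. i < length ys \<Longrightarrow> ys ! i \<in> {1..CARD('a)}"
    using x y by (meson nth_mem subsetD)+
  have "sorted_wrt (<) (meet_list xs ys)"
    unfolding sorted_wrt_iff_nth_less length_meet_list
  proof (intro allI impI)
    fix i j assume "i < j" "j < max (length xs) (length ys)"
    then show "meet_list xs ys ! i < meet_list xs ys ! j"
      using sx[of i j] sy[of i j] by (auto simp: nth_meet_list min_def)
  qed
  moreover have "set (meet_list xs ys) \<subseteq> {1..CARD('a)}"
  proof
    fix z assume "z \<in> set (meet_list xs ys)"
    then obtain i where "i < max (length xs) (length ys)" "z = meet_list xs ys ! i"
      by (auto simp: in_set_conv_nth length_meet_list)
    then show "z \<in> {1..CARD('a)}"
      using rx[of i] ry[of i] by (auto simp: nth_meet_list min_def)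
  qed
  ultimately show "sorted_wrt (<) (meet_list xs ys) \<and> set (meet_list xs ys) \<subseteq> {1..CARD('a)} \<and>
      1 \<le> length (meet_list xs ys) \<and> length (meet_list xs ys) \<le> CARD('a) - 1"
    using x y by (auto simp: length_meet_list)
qed

lift_definition sup_plucker :: "'a plucker \<Rightarrow> 'a plucker \<Rightarrow> 'a plucker" is join_list
proof -
  fix xs ys :: "nat list"
  assume x: "sorted_wrt (<) xs \<and> set xs \<subseteq> {1..CARD('a)} \<and> 1 \<le> length xs \<and> length xs \<le> CARD('a) - 1"
    and y: "sorted_wrt (<) ys \<and> set ys \<subseteq> {1..CARD('a)} \<and> 1 \<le> length ys \<and> length ys \<le> CARD('a) - 1"
  have sx: "\<And>i j. i < j \<Longrightarrow> j < length xs \<Longrightarrow> xs ! i < xs ! j"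
    and sy: "\<And>i j. i < j \<Longrightarrow> j < length ys \<Longrightarrow> ys ! i < ys ! j"
    using x y by (auto simp: sorted_wrt_iff_nth_less)
  have rx: "\<And>i. i < length xs \<Longrightarrow> xs ! i \<in> {1..CARD('a)}"
    and ry: "\<And>i. i < length ys \<Longrightarrow> ys ! i \<in> {1..CARD('a)}"
    using x y by (meson nth_mem subsetD)+
  have "sorted_wrt (<) (join_list xs ys)"
    unfolding sorted_wrt_iff_nth_less length_join_list
  proof (intro allI impI)
    fix i j assume "i < j" "j < min (length xs) (length ys)"
    then show "join_list xs ys ! i < join_list xs ys ! j"
      using sx[of i j] sy[of i j] by (auto simp: nth_join_list max_def)
  qed
  moreover have "set (join_list xs ys) \<subseteq> {1..CARD('a)}"
  proof
    fix z assume "z \<in> set (join_list xs ys)"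
    then obtain i where "i < min (length xs) (length ys)" "z = join_list xs ys ! i"
      by (auto simp: in_set_conv_nth length_join_list)
    then show "z \<in> {1..CARD('a)}"
      using rx[of i] ry[of i] by (auto simp: nth_join_list max_def)
  qed
  ultimately show "sorted_wrt (<) (join_list xs ys) \<and> set (join_list xs ys) \<subseteq> {1..CARD('a)} \<and>
      1 \<le> length (join_list xs ys) \<and> length (join_list xs ys) \<le> CARD('a) - 1"
    using x y by (auto simp: length_join_list)
qed

instance
proof
  fix a b c :: "'a plucker"
  show "(a < b) = (a \<le> b \<and> \<not> b \<le> a)" by (simp add: less_plucker_def)
  show "a \<le> a" by transfer simp
  show "a \<le> c" if "a \<le> b" "b \<le> c"
    using that by transfer (meson le_trans less_le_trans)
  show "a = b" if "a \<le> b" "b \<le> a"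
    using that by transfer (auto intro: nth_equalityI simp: antisym)
  show "inf a b \<le> a" "inf a b \<le> b"
    by (transfer, simp add: length_meet_list nth_meet_list)+
  show "a \<le> inf b c" if "a \<le> b" "a \<le> c"
    using that by transfer (simp add: length_meet_list nth_meet_list)
  show "a \<le> sup a b" "b \<le> sup a b"
    by (transfer, simp add: length_join_list nth_join_list)+
  show "sup b c \<le> a" if "b \<le> a" "c \<le> a"
    using that by transfer (simp add: length_join_list nth_join_list)
qed

end

section \<open>Polynomials and ideals\<close>

text \<open>
  Monomials are exponent vectors and polynomials are finitely supported families of coefficients.
\<close>

type_synonym 'v cpoly = "('v \<Rightarrow>\<^sub>0 nat) \<Rightarrow>\<^sub>0 complex"

definition Const :: "complex \<Rightarrow> 'v cpoly" where
  "Const c = Poly_Mapping.single 0 c"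

definition Var :: "'v \<Rightarrow> 'v cpoly" where
  "Var v = Poly_Mapping.single (Poly_Mapping.single v 1) 1"

text \<open>The homomorphism of \<open>\<complex>\<close>-algebras sending the variable \<open>v\<close> to \<open>f v\<close>.\<close>

definition subst_poly :: "('v \<Rightarrow> 'u cpoly) \<Rightarrow> 'v cpoly \<Rightarrow> 'u cpoly" where
  "subst_poly f p =
     (\<Sum>m\<in>Poly_Mapping.keys p. Const (poly_mapping.lookup p m) * (\<Prod>v\<in>Poly_Mapping.keys m. f v ^ poly_mapping.lookup m v))"

definition ideal_generated :: "'v cpoly set \<Rightarrow> 'v cpoly set" where
  "ideal_generated S = module.span (*) S"

definition complex_span :: "'v cpoly set \<Rightarrow> 'v cpoly set" where
  "complex_span S = module.span (\<lambda>c p. Const c * p) S"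

section \<open>The ideals of the flag variety\<close>

text \<open>
  The variable \<open>(r, s)\<close> is the matrix entry \<open>z\<^sub>r\<^sub>,\<^sub>s\<close>; only \<open>r, s \<in> {1..CARD('n)}\<close> occur, the other
  pairs are idle. The indices of \<^term>\<open>Matrix.mat\<close> start from 0, hence the shift.
\<close>

definition plucker_minor :: "'n::card2 plucker \<Rightarrow> (nat \<times> nat) cpoly" where
  "plucker_minor a =
     Determinant.det (Matrix.mat (length (idx a)) (length (idx a))
       (\<lambda>(r, s). Var (r + 1, idx a ! s)))"

definition plucker_ideal :: "'n::card2 plucker cpoly set" where
  "plucker_ideal = {p. subst_poly plucker_minor p = 0}"

definition monomial_ideal :: "'n::card2 plucker cpoly set" where
  "monomial_ideal =
     ideal_generated {Var a * Var b | a b. \<not> a \<le> b \<and> \<not> b \<le> a}"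

definition hibi_ideal :: "'n::card2 plucker cpoly set" where
  "hibi_ideal =
     ideal_generated {Var a * Var b - Var (sup a b) * Var (inf a b) | a b. True}"

section \<open>Initial ideals and Groebner cones\<close>

text \<open>
  \<open>in\<^sub>w p\<close> keeps the terms of minimal weight, and \<open>in\<^sub>w I\<close> is the \<open>\<complex>\<close>-linear span of these forms.
\<close>

definition weight :: "real ^ 'v \<Rightarrow> ('v::finite \<Rightarrow>\<^sub>0 nat) \<Rightarrow> real" where
  "weight w m = (\<Sum>v\<in>UNIV. w $ v * real (poly_mapping.lookup m v))"

definition initial_form :: "real ^ 'v \<Rightarrow> 'v::finite cpoly \<Rightarrow> 'v cpoly" where
  "initial_form w p =
     (\<Sum>m | m \<in> Poly_Mapping.keys p \<and> (\<forall>m'\<in>Poly_Mapping.keys p. weight w m \<le> weight w m').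
        Poly_Mapping.single m (poly_mapping.lookup p m))"

definition initial_ideal :: "real ^ 'v \<Rightarrow> 'v::finite cpoly set \<Rightarrow> 'v cpoly set" where
  "initial_ideal w I = complex_span (initial_form w ` I)"

definition groebner_cone :: "'v::finite cpoly set \<Rightarrow> 'v cpoly set \<Rightarrow> (real ^ 'v) set" where
  "groebner_cone I J = {w. initial_ideal w I = J}"

end

theory Submission
  imports Defs
begin

text \<open>
  Fix \<open>w\<^sub>0\<close> with initial ideal \<open>I\<^sup>m\<close>. The standard monomials (those supported on chains) are a basis
  modulo \<open>I\<close>, and writing \<open>nf a b\<close> for the normal form of \<open>X\<^sub>a X\<^sub>b\<close> with \<open>a, b\<close> incomparable, both
  closed cones are cut out by the inequalities \<open>w\<^sub>a + w\<^sub>b \<le> w(m)\<close> for the monomials \<open>m\<close> of \<open>nf a b\<close>,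
  where on the toric cone those for \<open>m = X\<^bsub>inf a b\<^esub> X\<^bsub>sup a b\<^esub>\<close> are equations. So a facet \<open>F\<close> is given
  by some \<open>a, b\<close> and \<open>m = X\<^sub>c X\<^sub>d\<close> with \<open>c \<le> d\<close>, and only the case \<open>{c, d} \<noteq> {inf a b, sup a b}\<close> is left.

  At a relative interior point of \<open>F\<close> the initial ideal contains one binomial
  \<open>X\<^sub>a X\<^sub>b - \<lambda> X\<^sub>c X\<^sub>d\<close> and the other incomparable products, but no standard polynomial. Multiplying
  the binomial by \<open>X\<^sub>e\<close> shows that every other \<open>e\<close> in \<open>[c, d]\<close> is comparable to \<open>a\<close> and \<open>b\<close>. Encoding \<open>a\<close> by
  its profile \<open>x \<mapsto> #{i in a. i \<le> x}\<close> turns the order into the pointwise one and forces the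
  profiles of \<open>c\<close> and \<open>d\<close> to differ from those of \<open>inf a b\<close> and \<open>sup a b\<close> by one at a single place \<open>z\<close>.

  The weights in the toric cone are modular, hence of the form \<open>\<Sum>\<^sub>y \<Sum>\<^sub>s \<psi> y s\<close> over the cells
  \<open>s \<le> cnt a y\<close> below the profile, and every \<open>\<psi>\<close> that is increasing in \<open>s\<close> occurs because for strictly
  increasing \<open>\<psi>\<close> the minors degenerate to their diagonal terms. The steps \<open>\<psi> = [y = x][s > t]\<close> span all
  modular weights, and all of them but the one at \<open>z\<close> lie on \<open>F\<close>.
\<close>

no_notation Matrix.scalar_prod (infix "\<bullet>" 70)

section \<open>Profiles of Pluecker indices\<close>

text \<open>The lattice path of \<open>a\<close>, rising by one at every entry. Large elements have
  low profiles, so \<open>inf\<close> becomes the pointwise maximum and \<open>sup\<close> the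
  pointwise minimum.\<close>

definition cnt :: "'n::card2 plucker \<Rightarrow> nat \<Rightarrow> nat" where
  "cnt a x = card {i \<in> set (idx a). i \<le> x}"

lemma idx_props:
  fixes a :: "'n::card2 plucker"
  shows "sorted_wrt (<) (idx a)" "set (idx a) \<subseteq> {1..CARD('n)}"
    "1 \<le> length (idx a)" "length (idx a) \<le> CARD('n) - 1"
  using idx[of a] by auto

lemma idx_nth_less: "i < j \<Longrightarrow> j < length (idx a) \<Longrightarrow> idx a ! i < idx a ! j"
  using idx_props(1)[of a] by (auto simp: sorted_wrt_iff_nth_less)

lemma distinct_idx: "distinct (idx a)"
  using idx_props(1) strict_sorted_iff by blast

lemma idx_nth_range:
  fixes a :: "'n::card2 plucker"
  shows "r < length (idx a) \<Longrightarrow> idx a ! r \<in> {1..CARD('n)}"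
  using idx_props(2)[of a] nth_mem by blast

lemma cnt_positions: "cnt a x = card {r. r < length (idx a) \<and> idx a ! r \<le> x}"
proof -
  have "{i \<in> set (idx a). i \<le> x} = (!) (idx a) ` {r. r < length (idx a) \<and> idx a ! r \<le> x}"
    by (auto simp: in_set_conv_nth)
  moreover have "inj_on ((!) (idx a)) {r. r < length (idx a) \<and> idx a ! r \<le> x}"
    using distinct_idx by (intro inj_onI) (simp add: nth_eq_iff_index_eq[OF distinct_idx])
  ultimately show ?thesis by (simp add: cnt_def card_image)
qed

text \<open>The entries increase, so the positions counted by \<open>cnt a x\<close> are closed
  downwards, and a downward closed set of \<open>c\<close> natural numbers is
  \<open>{..<c}\<close>.\<close>

lemma positions_le: "{r. r < length (idx a) \<and> idx a ! r \<le> x} = {..<cnt a x}"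
proof -
  let ?S = "{r. r < length (idx a) \<and> idx a ! r \<le> x}"
  have fin: "finite ?S" by simp
  have down: "r' \<in> ?S" if "r \<in> ?S" "r' < r" for r r'
    using that idx_nth_less[of r' r a] by auto
  have "?S = {..<card ?S}"
  proof (rule card_subset_eq[symmetric, OF fin])
    show "{..<card ?S} \<subseteq> ?S"
    proof
      fix r assume r: "r \<in> {..<card ?S}"
      show "r \<in> ?S"
      proof (rule ccontr)
        assume "r \<notin> ?S"
        then have "r' < r" if "r' \<in> ?S" for r' using that down[of r' r] by (cases r' r rule: linorder_cases) auto
        then have "?S \<subseteq> {..<r}" by blast
        then have "card ?S \<le> r" using card_mono[of "{..<r}" ?S] by simp
        then show False using r by simp
      qed
    qed
  qed simp
  then show ?thesis by (simp add: cnt_positions)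
qed

text \<open>The dictionary between entries and heights: the profile reaches height
  \<open>r + 1\<close> exactly when it has passed the entry at position \<open>r\<close>.\<close>

lemma less_cnt_iff: "r < cnt a x \<longleftrightarrow> r < length (idx a) \<and> idx a ! r \<le> x"
  using positions_le[of a x] by blast

lemma cnt_0 [simp]: "cnt a 0 = 0"
proof -
  have "{i \<in> set (idx a). i \<le> 0} = {}" using idx_props(2)[of a] by auto
  then show ?thesis by (simp add: cnt_def)
qed

lemma cnt_card: "cnt (a :: 'n::card2 plucker) CARD('n) = length (idx a)"
proof -
  have "{i \<in> set (idx a). i \<le> CARD('n)} = set (idx a)" using idx_props(2)[of a] by auto
  then show ?thesis by (simp add: cnt_def distinct_card[OF distinct_idx])
qed

lemma cnt_Suc: "cnt a (Suc x) = cnt a x + (if Suc x \<in> set (idx a) then 1 else 0)"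
proof -
  have "{i \<in> set (idx a). i \<le> Suc x} = {i \<in> set (idx a). i \<le> x} \<union> {i \<in> set (idx a). i = Suc x}"
    by auto
  moreover have "{i \<in> set (idx a). i = Suc x} = (if Suc x \<in> set (idx a) then {Suc x} else {})" by auto
  ultimately show ?thesis by (simp add: cnt_def card_Un_disjoint)
qed

lemma cnt_step: "cnt a x \<le> cnt a (Suc x)" "cnt a (Suc x) \<le> Suc (cnt a x)"
  unfolding cnt_Suc by simp_all

lemma cnt_mono: "x \<le> y \<Longrightarrow> cnt a x \<le> cnt a y"
  using lift_Suc_mono_le[of "cnt a", OF cnt_step(1)] .

lemma cnt_lipschitz: "x \<le> y \<Longrightarrow> cnt a y \<le> cnt a x + (y - x)"
proof (induction y rule: dec_induct)
  case (step y)
  then show ?case using cnt_step(2)[of a y] by linarith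
qed simp

lemma cnt_card_bounds:
  "1 \<le> cnt (a :: 'n::card2 plucker) CARD('n)" "cnt a CARD('n) \<le> CARD('n) - 1"
  unfolding cnt_card by (rule idx_props)+

text \<open>Smaller entries are passed earlier, so by \<open>less_cnt_iff\<close> they give a higher
  profile. The place \<open>x = CARD('n)\<close> carries the comparison of the lengths.\<close>

lemma less_eq_iff_cnt: 
  fixes a b :: "'n::card2 plucker"
  shows "a \<le> b \<longleftrightarrow> (\<forall>x\<le>CARD('n). cnt b x \<le> cnt a x)"
proof -
  have ab: "a \<le> b \<longleftrightarrow> length (idx b) \<le> length (idx a) \<and> (\<forall>r<length (idx b). idx a ! r \<le> idx b ! r)"
    by transfer simp
  show ?thesis
  proof
    assume L: "a \<le> b"
    show "\<forall>x\<le>CARD('n). cnt b x \<le> cnt a x"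
    proof (intro allI impI)
      fix x
      show "cnt b x \<le> cnt a x"
      proof (rule ccontr)
        assume "\<not> cnt b x \<le> cnt a x"
        then have "cnt a x < cnt b x" by simp
        then have "cnt a x < length (idx b)" "idx b ! cnt a x \<le> x" by (simp_all add: less_cnt_iff)
        moreover from this have "idx a ! cnt a x \<le> idx b ! cnt a x" "cnt a x < length (idx a)"
          using L unfolding ab by auto
        ultimately have "cnt a x < cnt a x" unfolding less_cnt_iff by linarith
        then show False by simp
      qed
    qed
  next
    assume R: "\<forall>x\<le>CARD('n). cnt b x \<le> cnt a x"
    have "idx a ! r \<le> idx b ! r" if "r < length (idx b)" for r
    proof -
      have "r < cnt b (idx b ! r)" using that by (simp add: less_cnt_iff)
      also have "\<dots> \<le> cnt a (idx b ! r)" using R idx_nth_range[OF that] by simp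
      finally show ?thesis by (simp add: less_cnt_iff)
    qed
    then show "a \<le> b" using R[rule_format, of "CARD('n)"] by (simp add: ab cnt_card)
  qed
qed

lemma plucker_eqI_cnt:
  fixes a b :: "'n::card2 plucker"
  assumes "\<And>x. x \<le> CARD('n) \<Longrightarrow> cnt a x = cnt b x"
  shows "a = b"
  using assms by (intro antisym) (auto simp: less_eq_iff_cnt)

text \<open>Characterises the restrictions of the functions \<open>cnt a\<close> to
  \<open>{0..n}\<close>; the bounds at \<open>n\<close> are those on the length of an index, and
  values beyond \<open>n\<close> are left free.\<close>

definition profile :: "nat \<Rightarrow> (nat \<Rightarrow> nat) \<Rightarrow> bool" where
  "profile n f \<longleftrightarrow> f 0 = 0 \<and> (\<forall>x<n. f x \<le> f (Suc x) \<and> f (Suc x) \<le> Suc (f x)) \<and>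
     1 \<le> f n \<and> f n \<le> n - 1"

lemma profile_cnt: "profile CARD('n) (cnt (a :: 'n::card2 plucker))"
  using cnt_card_bounds[of a] by (auto simp: profile_def cnt_step)

text \<open>The entries are the places where \<open>f\<close> rises; since each step is at most one,
  counting them recovers \<open>f\<close>.\<close>

lemma ex_plucker_of_profile:
  assumes "profile CARD('n::card2) f"
  obtains a :: "'n::card2 plucker" where "\<And>x. x \<le> CARD('n::card2) \<Longrightarrow> cnt a x = f x"
proof -
  define S where "S = {y \<in> {1..CARD('n)}. f y \<noteq> f (y - 1)}"
  have fin: "finite S" by (simp add: S_def)
  have card: "card {i \<in> S. i \<le> x} = f x" if "x \<le> CARD('n)" for x
    using that
  proof (induction x)
    case 0
    have "{i \<in> S. i \<le> 0} = {}" by (auto simp: S_def)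
    then show ?case using assms by (simp add: profile_def)
  next
    case (Suc x)
    have "Suc x \<in> S \<longleftrightarrow> f (Suc x) \<noteq> f x" using Suc.prems by (simp add: S_def)
    then have "{i \<in> S. i \<le> Suc x} = {i \<in> S. i \<le> x} \<union> (if f (Suc x) \<noteq> f x then {Suc x} else {})"
      by (auto simp: le_Suc_eq)
    moreover have "card ({i \<in> S. i \<le> x} \<union> (if f (Suc x) \<noteq> f x then {Suc x} else {})) =
        card {i \<in> S. i \<le> x} + card (if f (Suc x) \<noteq> f x then {Suc x} else {})"
      using fin by (intro card_Un_disjoint) auto
    ultimately have "card {i \<in> S. i \<le> Suc x} = f x + (if f (Suc x) \<noteq> f x then 1 else 0)"
      using Suc.IH Suc.prems by auto
    moreover have "f x \<le> f (Suc x) \<and> f (Suc x) \<le> Suc (f x)" using assms Suc.prems by (simp add: profile_def)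
    ultimately show ?case by auto
  qed
  have "{i \<in> S. i \<le> CARD('n)} = S" by (auto simp: S_def)
  then have cS: "card S = f CARD('n)" using card[of "CARD('n)"] by simp
  let ?xs = "sorted_list_of_set S"
  have "idx (plucker_of ?xs :: 'n plucker) = ?xs"
  proof (intro plucker_of_inverse CollectI conjI)
    show "set ?xs \<subseteq> {1..CARD('n)}" using fin by (auto simp: S_def)
    have "length ?xs = f CARD('n)" using cS by simp
    then show "1 \<le> length ?xs" "length ?xs \<le> CARD('n) - 1" using assms unfolding profile_def by linarith+
  qed simp
  then have "cnt (plucker_of ?xs :: 'n plucker) x = f x" if "x \<le> CARD('n)" for x
    using card[OF that] fin by (simp add: cnt_def)
  then show thesis by (rule that)
qed

lemma profile_max:
  assumes "profile n f" "profile n g"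
  shows "profile n (\<lambda>x. max (f x) (g x))"
proof -
  have st: "max (f x) (g x) \<le> max (f (Suc x)) (g (Suc x)) \<and>
      max (f (Suc x)) (g (Suc x)) \<le> Suc (max (f x) (g x))" if "x < n" for x
  proof -
    have "f x \<le> f (Suc x)" "f (Suc x) \<le> Suc (f x)" "g x \<le> g (Suc x)" "g (Suc x) \<le> Suc (g x)"
      using assms that by (simp_all add: profile_def)
    then show ?thesis by linarith
  qed
  moreover have "f 0 = 0" "g 0 = 0" "1 \<le> f n" "f n \<le> n - 1" "1 \<le> g n" "g n \<le> n - 1"
    using assms by (auto simp only: profile_def)
  ultimately show ?thesis using st unfolding profile_def by (intro conjI allI impI) simp_all
qed

lemma profile_min:
  assumes "profile n f" "profile n g"
  shows "profile n (\<lambda>x. min (f x) (g x))"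
proof -
  have st: "min (f x) (g x) \<le> min (f (Suc x)) (g (Suc x)) \<and>
      min (f (Suc x)) (g (Suc x)) \<le> Suc (min (f x) (g x))" if "x < n" for x
  proof -
    have "f x \<le> f (Suc x)" "f (Suc x) \<le> Suc (f x)" "g x \<le> g (Suc x)" "g (Suc x) \<le> Suc (g x)"
      using assms that by (simp_all add: profile_def)
    then show ?thesis by linarith
  qed
  moreover have "f 0 = 0" "g 0 = 0" "1 \<le> f n" "f n \<le> n - 1" "1 \<le> g n" "g n \<le> n - 1"
    using assms by (auto simp only: profile_def)
  ultimately show ?thesis using st unfolding profile_def by (intro conjI allI impI) simp_all
qed

text \<open>The pointwise maximum of two profiles is again a profile, and as the order is reversed
  its element is the greatest lower bound.\<close>

lemma cnt_inf:
  fixes a b :: "'n::card2 plucker"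
  assumes "x \<le> CARD('n)"
  shows "cnt (inf a b) x = max (cnt a x) (cnt b x)"
proof -
  obtain e :: "'n plucker" where e: "\<And>x. x \<le> CARD('n) \<Longrightarrow> cnt e x = max (cnt a x) (cnt b x)"
    using ex_plucker_of_profile[OF profile_max[OF profile_cnt[of a] profile_cnt[of b]]] by blast
  have "inf a b = e"
    using inf_le1[of a b] inf_le2[of a b]
    by (intro antisym inf_greatest) (auto simp: less_eq_iff_cnt e)
  then show ?thesis using e assms by simp
qed

lemma cnt_sup:
  fixes a b :: "'n::card2 plucker"
  assumes "x \<le> CARD('n)"
  shows "cnt (sup a b) x = min (cnt a x) (cnt b x)"
proof -
  obtain e :: "'n plucker" where e: "\<And>x. x \<le> CARD('n) \<Longrightarrow> cnt e x = min (cnt a x) (cnt b x)"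
    using ex_plucker_of_profile[OF profile_min[OF profile_cnt[of a] profile_cnt[of b]]] by blast
  have "sup a b = e"
    using sup_ge1[of a b, unfolded less_eq_iff_cnt] sup_ge2[of b a, unfolded less_eq_iff_cnt]
    by (intro antisym sup_least) (simp_all add: less_eq_iff_cnt e)
  then show ?thesis using e assms by simp
qed

section \<open>Intervals in which almost everything is comparable to two incomparable
  elements\<close>

text \<open>Raising the profile of \<open>a\<close> by one at \<open>x0\<close>, as economically as
  possible, gives an element \<open>e\<close> of \<open>[c, a]\<close>. It is not above
  \<open>b\<close>, hence it lies below \<open>b\<close>, so wherever \<open>b\<close> is higher
  than \<open>a\<close> the raise must already be felt. For \<open>x \<ge> x0\<close> the difference
  \<open>x0 - x\<close> is truncated to 0.\<close>

lemma rise_below_incomparable: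
  fixes a b c d :: "'n::card2 plucker"
  assumes inc: "\<not> a \<le> b" "\<not> b \<le> a"
    and ca: "c \<le> a" and ad: "a \<le> d"
    and S: "\<And>e. c \<le> e \<Longrightarrow> e \<le> d \<Longrightarrow> e \<noteq> a \<Longrightarrow> e \<noteq> b \<Longrightarrow> e \<le> b \<or> b \<le> e"
    and x0: "x0 \<le> CARD('n)" "cnt a x0 < cnt c x0"
    and x: "x \<le> CARD('n)" "cnt a x < cnt b x"
  shows "cnt a x + (x0 - x) \<le> cnt a x0"
proof -
  define v where "v = Suc (cnt a x0)"
  have v: "v \<le> cnt c x0" using x0 by (simp add: v_def)
  have cx0: "cnt c x0 \<le> x0" using cnt_lipschitz[of 0 x0 c] by simp
  obtain x2 where x2: "x2 \<le> CARD('n)" "cnt b x2 < cnt a x2"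
    using inc by (auto simp: less_eq_iff_cnt not_le)
  \<comment> \<open>The least profile above that of \<open>a\<close> with height at least
    \<open>v\<close> at \<open>x0\<close>: it must descend from there by at most one per
    step.\<close>
  have "profile CARD('n) (\<lambda>y. max (cnt a y) (v - (x0 - y)))"
    unfolding profile_def
  proof (intro conjI allI impI)
    show "max (cnt a 0) (v - (x0 - 0)) = 0" using v cx0 by simp
    fix y
    show "max (cnt a y) (v - (x0 - y)) \<le> max (cnt a (Suc y)) (v - (x0 - Suc y))"
      "max (cnt a (Suc y)) (v - (x0 - Suc y)) \<le> Suc (max (cnt a y) (v - (x0 - y)))"
      using cnt_step[of a y] by linarith+
  next
    show "1 \<le> max (cnt a CARD('n)) (v - (x0 - CARD('n)))"
      using cnt_card_bounds(1)[of a] by linarith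
    show "max (cnt a CARD('n)) (v - (x0 - CARD('n))) \<le> CARD('n) - 1"
      using cnt_card_bounds(2)[of a] cnt_card_bounds(2)[of c] cnt_mono[OF x0(1), of c] v by linarith
  qed
  then obtain e :: "'n plucker" where e: "\<And>y. y \<le> CARD('n) \<Longrightarrow> cnt e y = max (cnt a y) (v - (x0 - y))"
    by (rule ex_plucker_of_profile) blast
  have "e \<le> a" by (simp add: less_eq_iff_cnt e)
  have "c \<le> e"
    unfolding less_eq_iff_cnt
  proof (intro allI impI)
    fix y assume y: "y \<le> CARD('n)"
    have "cnt a y \<le> cnt c y" using ca y by (simp add: less_eq_iff_cnt)
    moreover have "v - (x0 - y) \<le> cnt c y"
      using cnt_lipschitz[of y x0 c] cnt_mono[of x0 y c] v by linarith
    ultimately show "cnt e y \<le> cnt c y" by (simp add: e y)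
  qed
  have "e \<noteq> a" using e[OF x0(1)] by (auto simp: v_def)
  have "\<not> b \<le> e" using x2 e[of x2] by (auto simp: less_eq_iff_cnt not_le intro!: exI[of _ x2])
  then have "e \<le> b" using S[of e] \<open>c \<le> e\<close> \<open>e \<le> a\<close> ad \<open>e \<noteq> a\<close> by auto
  then have "cnt b x \<le> max (cnt a x) (v - (x0 - x))" using e x(1) by (auto simp: less_eq_iff_cnt)
  then show ?thesis using x(2) by (simp add: v_def)
qed

text \<open>The dual argument: the profile of \<open>a\<close> is lowered by one at
  \<open>x0\<close>, which gives an element of \<open>[a, d]\<close> that must lie above
  \<open>b\<close>.\<close>

lemma rise_above_incomparable:
  fixes a b c d :: "'n::card2 plucker"
  assumes inc: "\<not> a \<le> b" "\<not> b \<le> a"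
    and ca: "c \<le> a" and ad: "a \<le> d"
    and S: "\<And>e. c \<le> e \<Longrightarrow> e \<le> d \<Longrightarrow> e \<noteq> a \<Longrightarrow> e \<noteq> b \<Longrightarrow> e \<le> b \<or> b \<le> e"
    and x0: "x0 \<le> CARD('n)" "cnt d x0 < cnt a x0"
    and x: "x \<le> CARD('n)" "cnt b x < cnt a x"
  shows "cnt a x0 + (x - x0) \<le> cnt a x"
proof -
  define v where "v = cnt a x0 - 1"
  have v: "cnt d x0 \<le> v" "cnt a x0 = Suc v" using x0 by (simp_all add: v_def)
  obtain x1 where x1: "x1 \<le> CARD('n)" "cnt a x1 < cnt b x1"
    using inc by (auto simp: less_eq_iff_cnt not_le)
  have "profile CARD('n) (\<lambda>y. min (cnt a y) (v + (y - x0)))"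
    unfolding profile_def
  proof (intro conjI allI impI)
    show "min (cnt a 0) (v + (0 - x0)) = 0" by simp
    fix y
    show "min (cnt a y) (v + (y - x0)) \<le> min (cnt a (Suc y)) (v + (Suc y - x0))"
      "min (cnt a (Suc y)) (v + (Suc y - x0)) \<le> Suc (min (cnt a y) (v + (y - x0)))"
      using cnt_step[of a y] by linarith+
  next
    \<comment> \<open>The lowered index keeps a positive length: for \<open>x0 = CARD('n)\<close>
      this holds because the profile of \<open>d\<close> is still at most \<open>v\<close>
      there.\<close>
    have "1 \<le> v + (CARD('n) - x0)"
      using x0(1) v(1) cnt_card_bounds(1)[of d] by (cases "x0 = CARD('n)") auto
    then show "1 \<le> min (cnt a CARD('n)) (v + (CARD('n) - x0))"
      using cnt_card_bounds(1)[of a] by simp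
    show "min (cnt a CARD('n)) (v + (CARD('n) - x0)) \<le> CARD('n) - 1"
      using cnt_card_bounds(2)[of a] by linarith
  qed
  then obtain e :: "'n plucker" where e: "\<And>y. y \<le> CARD('n) \<Longrightarrow> cnt e y = min (cnt a y) (v + (y - x0))"
    by (rule ex_plucker_of_profile) blast
  have "a \<le> e" by (simp add: less_eq_iff_cnt e)
  have "e \<le> d"
    unfolding less_eq_iff_cnt
  proof (intro allI impI)
    fix y assume y: "y \<le> CARD('n)"
    have "cnt d y \<le> cnt a y" using ad y by (simp add: less_eq_iff_cnt)
    moreover have "cnt d y \<le> v + (y - x0)"
      using cnt_lipschitz[of x0 y d] cnt_mono[of y x0 d] v by linarith
    ultimately show "cnt d y \<le> cnt e y" by (simp add: e y)
  qed
  have "e \<noteq> a" using e[OF x0(1)] v by auto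
  have "\<not> e \<le> b" using x1 e[of x1] by (auto simp: less_eq_iff_cnt not_le intro!: exI[of _ x1])
  then have "b \<le> e" using S[of e] \<open>a \<le> e\<close> \<open>e \<le> d\<close> ca \<open>e \<noteq> a\<close> by auto
  then have "min (cnt a x) (v + (x - x0)) \<le> cnt b x" using e x(1) by (auto simp: less_eq_iff_cnt)
  then show ?thesis using x(2) v by linarith
qed

text \<open>A place where \<open>c\<close> is higher than both \<open>a\<close> and \<open>b\<close>
  turns the inequalities of the two previous lemmas into equalities. The profiles then cross as
  closely as possible: one is higher only at \<open>z - 1\<close>, the other only at
  \<open>z + 1\<close>, and \<open>c\<close> exceeds both only at \<open>z\<close>.\<close>

lemma tight_interval:
  fixes a b c d :: "'n::card2 plucker"
  assumes inc: "\<not> a \<le> b" "\<not> b \<le> a"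
    and c: "c \<le> a" "c \<le> b" and d: "a \<le> d" "b \<le> d"
    and S: "\<And>e. c \<le> e \<Longrightarrow> e \<le> d \<Longrightarrow> e \<noteq> a \<Longrightarrow> e \<noteq> b \<Longrightarrow> (e \<le> a \<or> a \<le> e) \<and> (e \<le> b \<or> b \<le> e)"
    and sum: "\<And>x. x \<le> CARD('n) \<Longrightarrow> cnt a x + cnt b x = cnt c x + cnt d x"
    and top: "cnt c CARD('n) = max (cnt a CARD('n)) (cnt b CARD('n))"
    and ne: "c \<noteq> inf a b"
  obtains z where "1 \<le> z" "z \<le> CARD('n)" "cnt b z = cnt a z" "1 \<le> cnt a z" "cnt c z = Suc (cnt a z)"
    "\<And>x. x \<le> CARD('n) \<Longrightarrow> x \<noteq> z \<Longrightarrow> cnt c x = max (cnt a x) (cnt b x)"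
proof -
  \<comment> \<open>Here \<open>a\<close> and \<open>b\<close> are bound anew, so that the case
    where the crossing happens in the other direction follows by exchanging them.\<close>
  have main: "\<exists>z. z \<le> CARD('n) \<and> cnt b z = cnt a z \<and> 1 \<le> cnt a z \<and> cnt c z = Suc (cnt a z) \<and>
      (\<forall>x\<le>CARD('n). x \<noteq> z \<longrightarrow> cnt c x = max (cnt a x) (cnt b x))"
    if inc: "\<not> a \<le> b" "\<not> b \<le> a"
      and c: "c \<le> a" "c \<le> b" and d: "a \<le> d" "b \<le> d"
      and S: "\<And>e. c \<le> e \<Longrightarrow> e \<le> d \<Longrightarrow> e \<noteq> a \<Longrightarrow> e \<noteq> b \<Longrightarrow> (e \<le> a \<or> a \<le> e) \<and> (e \<le> b \<or> b \<le> e)"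
      and sum: "\<And>x. x \<le> CARD('n) \<Longrightarrow> cnt a x + cnt b x = cnt c x + cnt d x"
      and top: "cnt c CARD('n) = max (cnt a CARD('n)) (cnt b CARD('n))"
      and ne: "c \<noteq> inf a b"
      and x12: "x1 \<le> CARD('n)" "cnt a x1 < cnt b x1" "x2 \<le> CARD('n)" "cnt b x2 < cnt a x2" "x1 < x2"
    for a b x1 x2
  proof -
    let ?A = "cnt a" and ?B = "cnt b" and ?C = "cnt c" and ?D = "cnt d"
    have CA: "?A x \<le> ?C x" "?B x \<le> ?C x" if "x \<le> CARD('n)" for x
      using c that by (simp_all add: less_eq_iff_cnt)
    have upA: "?A x + (x0 - x) \<le> ?A x0"
      if "x0 \<le> CARD('n)" "?A x0 < ?C x0" "x \<le> CARD('n)" "?A x < ?B x" for x x0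
      by (rule rise_below_incomparable[OF inc c(1) d(1) _ that]) (use S in blast)
    have upB: "?B x + (x0 - x) \<le> ?B x0"
      if "x0 \<le> CARD('n)" "?B x0 < ?C x0" "x \<le> CARD('n)" "?B x < ?A x" for x x0
      by (rule rise_below_incomparable[OF inc(2,1) c(2) d(2) _ that]) (use S in blast)
    have downA: "?A x0 + (x - x0) \<le> ?A x"
      if "x0 \<le> CARD('n)" "?D x0 < ?A x0" "x \<le> CARD('n)" "?B x < ?A x" for x x0
      by (rule rise_above_incomparable[OF inc c(1) d(1) _ that]) (use S in blast)
    have downB: "?B x0 + (x - x0) \<le> ?B x"
      if "x0 \<le> CARD('n)" "?D x0 < ?B x0" "x \<le> CARD('n)" "?A x < ?B x" for x x0
      by (rule rise_above_incomparable[OF inc(2,1) c(2) d(2) _ that]) (use S in blast)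
    \<comment> \<open>Applying \<open>upA\<close> to \<open>x\<close> and \<open>x1\<close> in both
      orders gives \<open>(x1 - x) + (x - x1) \<le> 0\<close> in truncated subtraction.\<close>
    have uniq1: "x = x1" if "x \<le> CARD('n)" "?A x < ?B x" for x
      using upA[of x x1] upA[of x1 x] that x12 CA(2)[of x] CA(2)[of x1] by linarith
    have uniq2: "x = x2" if "x \<le> CARD('n)" "?B x < ?A x" for x
      using upB[of x x2] upB[of x2 x] that x12 CA(1)[of x] CA(1)[of x2] by linarith
    have eq: "?A x = ?B x" if "x \<le> CARD('n)" "x \<noteq> x1" "x \<noteq> x2" for x
      using uniq1[of x] uniq2[of x] that by linarith
    \<comment> \<open>Through \<open>z\<close> the profile of \<open>a\<close> must gain the full
      \<open>x2 - x1\<close> between \<open>x1\<close> and \<open>x2\<close>, while that of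
      \<open>b\<close> cannot gain anything. As \<open>b\<close> leads by one at \<open>x1\<close>
      and trails by one at \<open>x2\<close>, the distance is two.\<close>
    have bump: "x1 \<le> z \<and> z \<le> x2 \<and> x2 = x1 + 2"
      if z: "z \<le> CARD('n)" "?C z \<noteq> max (?A z) (?B z)" for z
    proof -
      have C: "?A z < ?C z" "?B z < ?C z" using z CA[of z] by linarith+
      then have D: "?D z < ?A z" "?D z < ?B z" using sum[of z] z CA[of z] by linarith+
      note f = upA[OF z(1) C(1) x12(1,2)] upB[OF z(1) C(2) x12(3,4)]
        downA[OF z(1) D(1) x12(3,4)] downB[OF z(1) D(2) x12(1,2)]
      have B2: "?A x2 = Suc (?B x2)" "?B x1 = Suc (?A x1)"
      proof -
        obtain y where y: "x2 = Suc y" using x12 by (cases x2) auto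
        have "?A y \<le> ?B y" using uniq2[of y] x12 y by fastforce
        then show "?A x2 = Suc (?B x2)"
          using cnt_step[of a y] cnt_step[of b y] x12 y by simp
        obtain y where y: "x1 = Suc y" using x12(2) by (cases x1) auto
        have "?A y = ?B y" using eq[of y] x12 y by simp
        then show "?B x1 = Suc (?A x1)"
          using cnt_step[of a y] cnt_step[of b y] x12 y by simp
      qed
      have lip: "?A x2 \<le> ?A x1 + (x2 - x1)" using cnt_lipschitz[of x1 x2 a] x12 by linarith
      have le: "x1 \<le> z" using f(1,3) lip x12 by linarith
      have ge: "z \<le> x2" using f(1,3) lip x12 by linarith
      have "?B x1 \<le> ?B x2" using x12 by (simp add: cnt_mono)
      then have "x2 = x1 + 2" using f lip le ge B2 x12(5) by simp
      then show ?thesis using le ge by simp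
    qed
    obtain z where z: "z \<le> CARD('n)" "?C z \<noteq> max (?A z) (?B z)"
      using ne plucker_eqI_cnt[of c "inf a b"] by (auto simp: cnt_inf)
    note zb = bump[OF z]
    have x1: "x1 \<noteq> 0" using x12(2) by (cases x1) auto
    have C1: "?C (x1 - 1) = max (?A (x1 - 1)) (?B (x1 - 1))"
      using bump[of "x1 - 1"] x1 x12 by fastforce
    have e1: "?A (x1 - 1) = ?B (x1 - 1)" using eq[of "x1 - 1"] x1 x12 by auto
    have s1: "?B (x1 - 1) \<le> ?A x1" "?B x1 \<le> Suc (?B (x1 - 1))" "?C x1 \<le> Suc (?C (x1 - 1))"
      using cnt_step[of a "x1 - 1"] cnt_step[of b "x1 - 1"] cnt_step[of c "x1 - 1"] x1 e1 by auto
    have Cx1: "?C x1 = max (?A x1) (?B x1)" and Bx1: "?B x1 = Suc (?A x1)"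
      using s1 C1 e1 x12 CA[of x1] by linarith+
    \<comment> \<open>To the right of \<open>x2\<close> the three profiles agree again, which bounds
      \<open>c\<close> at \<open>x2\<close>; if there is no place to the right, the assumption on
      the lengths replaces this.\<close>
    have Cx2: "?C x2 = max (?A x2) (?B x2)"
    proof (cases "x2 = CARD('n)")
      case False
      then have l: "Suc x2 \<le> CARD('n)" using x12 by simp
      have "?A (Suc x2) = ?B (Suc x2)" using eq[of "Suc x2"] x12 l by simp
      moreover have "?C (Suc x2) = max (?A (Suc x2)) (?B (Suc x2))" using bump[of "Suc x2"] l by fastforce
      ultimately show ?thesis
        using cnt_step[of a x2] cnt_step[of b x2] cnt_step[of c x2] x12 CA[of x2] by linarith
    qed (use top in simp)
    have zz: "z = Suc x1" using zb z Cx1 Cx2 by (cases "z = x1"; cases "z = x2") auto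
    have zc: "?A z = ?B z" using eq[of z] z zz zb by simp
    have "?B z \<le> Suc (?A x1)" "?B x1 \<le> ?B z" "?C z \<le> Suc (?C x1)"
      using cnt_step[of a x1] cnt_step[of b x1] cnt_step[of c x1] zc zz by auto
    then have fin: "?B z = ?A z" "1 \<le> ?A z" "?C z = Suc (?A z)"
      using zc Bx1 Cx1 z CA[of z] by linarith+
    have "?C x = max (?A x) (?B x)" if x: "x \<le> CARD('n)" "x \<noteq> z" for x
    proof (rule ccontr)
      assume "?C x \<noteq> max (?A x) (?B x)"
      then have "x1 \<le> x" "x \<le> x2" "x \<noteq> x1" "x \<noteq> x2" using bump[of x] x Cx1 Cx2 by auto
      then show False using zb zz x by linarith
    qed
    then show ?thesis using z fin by blast
  qed
  obtain x1 where x1: "x1 \<le> CARD('n)" "cnt a x1 < cnt b x1"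
    using inc(1) by (auto simp: less_eq_iff_cnt not_le)
  obtain x2 where x2: "x2 \<le> CARD('n)" "cnt b x2 < cnt a x2"
    using inc(2) by (auto simp: less_eq_iff_cnt not_le)
  have "\<exists>z\<le>CARD('n). cnt b z = cnt a z \<and> 1 \<le> cnt a z \<and> cnt c z = Suc (cnt a z) \<and>
      (\<forall>x\<le>CARD('n). x \<noteq> z \<longrightarrow> cnt c x = max (cnt a x) (cnt b x))"
  proof (cases x1 x2 rule: linorder_cases)
    case less
    show ?thesis
      using main[OF inc c d S sum top ne x1 x2 less] by blast
  next
    case greater
    have sum': "cnt b x + cnt a x = cnt c x + cnt d x" if "x \<le> CARD('n)" for x
      using sum[OF that] by simp
    have top': "cnt c CARD('n) = max (cnt b CARD('n)) (cnt a CARD('n))" using top by simp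
    have ne': "c \<noteq> inf b a" using ne by (simp add: inf.commute)
    have S': "(e \<le> b \<or> b \<le> e) \<and> (e \<le> a \<or> a \<le> e)" if "c \<le> e" "e \<le> d" "e \<noteq> b" "e \<noteq> a" for e
      using S[OF that(1,2,4,3)] by blast
    obtain z where z: "z \<le> CARD('n)" "cnt a z = cnt b z" "1 \<le> cnt b z" "cnt c z = Suc (cnt b z)"
      "\<forall>x\<le>CARD('n). x \<noteq> z \<longrightarrow> cnt c x = max (cnt b x) (cnt a x)"
      using main[OF inc(2,1) c(2,1) d(2,1) S' sum' top' ne' x2 x1 greater] by blast
    then show ?thesis by (intro exI[of _ z]) (simp add: max.commute)
  next
    case equal
    then show ?thesis using x1 x2 by simp
  qed
  then obtain z where z: "z \<le> CARD('n)" "cnt b z = cnt a z" "1 \<le> cnt a z" "cnt c z = Suc (cnt a z)"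
      "\<And>x. x \<le> CARD('n) \<Longrightarrow> x \<noteq> z \<Longrightarrow> cnt c x = max (cnt a x) (cnt b x)" by blast
  moreover have "1 \<le> z" using z(3) by (cases z) auto
  ultimately show thesis by (intro that)
qed

section \<open>Substitution in polynomials\<close>

text \<open>Cuts out homogeneous components, lowest-weight components and the standard part of a
  polynomial, according to the predicate.\<close>

lift_definition part :: "('a \<Rightarrow> bool) \<Rightarrow> ('a \<Rightarrow>\<^sub>0 'b::zero) \<Rightarrow> ('a \<Rightarrow>\<^sub>0 'b)" is
  "\<lambda>P f k. if P k then f k else 0"
  by (erule finite_subset[rotated]) auto

lemma lookup_part: "Poly_Mapping.lookup (part P p) k = (if P k then Poly_Mapping.lookup p k else 0)"
  by transfer simp

lemma keys_part: "Poly_Mapping.keys (part P p) = {k \<in> Poly_Mapping.keys p. P k}"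
  by (auto simp: in_keys_iff lookup_part split: if_splits)

lemma part_add: "part P (p + q) = part P p + part P q"
  for p q :: "'a \<Rightarrow>\<^sub>0 'b::monoid_add"
  by (rule poly_mapping_eqI) (simp add: lookup_part lookup_add)

lemma part_zero [simp]: "part P 0 = 0"
  by (rule poly_mapping_eqI) (simp add: lookup_part)

lemma part_sum: "part P (\<Sum>x\<in>A. p x) = (\<Sum>x\<in>A. part P (p x))"
  for p :: "'c \<Rightarrow> 'a \<Rightarrow>\<^sub>0 'b::comm_monoid_add"
  by (rule poly_mapping_eqI) (simp add: lookup_part lookup_sum)

lemma part_id: "(\<And>k. k \<in> Poly_Mapping.keys p \<Longrightarrow> P k) \<Longrightarrow> part P p = p"
  by (rule poly_mapping_eqI) (auto simp: lookup_part in_keys_iff)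

lemma part_none: "(\<And>k. k \<in> Poly_Mapping.keys p \<Longrightarrow> \<not> P k) \<Longrightarrow> part P p = 0"
  by (rule poly_mapping_eqI) (auto simp: lookup_part in_keys_iff)

lemma part_part [simp]: "part P (part P p) = part P p"
  by (rule poly_mapping_eqI) (simp add: lookup_part)

abbreviation Mon :: "('v \<Rightarrow>\<^sub>0 nat) \<Rightarrow> 'v cpoly" where
  "Mon m \<equiv> Poly_Mapping.single m 1"

lemma poly_sum_Mon: "p = (\<Sum>m\<in>Poly_Mapping.keys p. Const (Poly_Mapping.lookup p m) * Mon m)"
  for p :: "'v cpoly"
proof (rule poly_mapping_eqI)
  fix k
  have "Const c * Mon m = Poly_Mapping.single m c" for c and m :: "'v \<Rightarrow>\<^sub>0 nat"
    by (simp add: Const_def mult_single)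
  then show "Poly_Mapping.lookup p k =
      Poly_Mapping.lookup (\<Sum>m\<in>Poly_Mapping.keys p. Const (Poly_Mapping.lookup p m) * Mon m) k"
    by (simp add: lookup_sum lookup_single when_def in_keys_iff)
qed

lemma Const_mult: "Const (c * d) = Const c * Const d"
  by (simp add: Const_def mult_single)

lemma Const_add: "Const (c + d) = Const c + Const d"
  by (simp add: Const_def single_add)

lemma Const_1 [simp]: "Const 1 = 1" and Const_0 [simp]: "Const 0 = 0"
  by (simp_all add: Const_def)

lemma Const_uminus: "Const (- c) = - Const c"
  by (simp add: Const_def single_uminus)

lemma lookup_Const_mult:
  "Poly_Mapping.lookup (Const c * p) k = c * Poly_Mapping.lookup p k"
  by (simp add: Const_def mult_map_scale_conv_mult[symmetric] Poly_Mapping.map.rep_eq when_def)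

lemma keys_Const_mult: "Poly_Mapping.keys (Const c * p) \<subseteq> Poly_Mapping.keys p"
  by (auto simp: in_keys_iff lookup_Const_mult)

lemma part_Const_mult: "part P (Const c * p) = Const c * part P p"
  by (rule poly_mapping_eqI) (simp add: lookup_part lookup_Const_mult)

lemma Mon_add: "Mon (m + m') = Mon m * Mon m'"
  by (simp add: mult_single)

lemma lookup_Mon_mult: "Poly_Mapping.lookup (Mon m * p) (m + k) = Poly_Mapping.lookup p k"
proof -
  have "Poly_Mapping.lookup (Mon m * (\<Sum>m'\<in>Poly_Mapping.keys p. Const (Poly_Mapping.lookup p m') * Mon m')) (m + k)
     = (\<Sum>m'\<in>Poly_Mapping.keys p. Poly_Mapping.lookup (Const (Poly_Mapping.lookup p m') * Mon (m + m')) (m + k))"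
    by (simp add: sum_distrib_left lookup_sum Mon_add mult.left_commute)
  also have "\<dots> = Poly_Mapping.lookup p k"
    by (simp add: lookup_Const_mult lookup_single when_def in_keys_iff if_distrib[of "(*) c" for c] cong: if_cong)
  finally show ?thesis using poly_sum_Mon[of p] by simp
qed

lemma keys_Mon_mult: "Poly_Mapping.keys (Mon m * p) = (+) m ` Poly_Mapping.keys p"
proof
  show "Poly_Mapping.keys (Mon m * p) \<subseteq> (+) m ` Poly_Mapping.keys p"
    using keys_mult[of "Mon m" p] by auto
  show "(+) m ` Poly_Mapping.keys p \<subseteq> Poly_Mapping.keys (Mon m * p)"
    by (auto simp: in_keys_iff lookup_Mon_mult)
qed

definition mon_subst :: "('v \<Rightarrow> 'u cpoly) \<Rightarrow> ('v \<Rightarrow>\<^sub>0 nat) \<Rightarrow> 'u cpoly" where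
  "mon_subst f m = (\<Prod>v\<in>Poly_Mapping.keys m. f v ^ Poly_Mapping.lookup m v)"

lemma mon_subst_superset:
  assumes "finite V" "Poly_Mapping.keys m \<subseteq> V"
  shows "mon_subst f m = (\<Prod>v\<in>V. f v ^ Poly_Mapping.lookup m v)"
  unfolding mon_subst_def using assms by (intro prod.mono_neutral_left) (auto simp: in_keys_iff)

lemma mon_subst_0 [simp]: "mon_subst f 0 = 1"
  by (simp add: mon_subst_def)

lemma mon_subst_single [simp]: "mon_subst f (Poly_Mapping.single v 1) = f v"
  by (simp add: mon_subst_def)

lemma mon_subst_add: "mon_subst f (m + m') = mon_subst f m * mon_subst f m'"
proof -
  let ?V = "Poly_Mapping.keys m \<union> Poly_Mapping.keys m'"
  have "mon_subst f (m + m') = (\<Prod>v\<in>?V. f v ^ Poly_Mapping.lookup (m + m') v)"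
    using Poly_Mapping.keys_add[of m m'] by (intro mon_subst_superset) auto
  moreover have "mon_subst f m = (\<Prod>v\<in>?V. f v ^ Poly_Mapping.lookup m v)"
    "mon_subst f m' = (\<Prod>v\<in>?V. f v ^ Poly_Mapping.lookup m' v)"
    by (intro mon_subst_superset; simp)+
  ultimately show ?thesis by (simp add: lookup_add power_add prod.distrib)
qed

lemma subst_poly_superset:
  assumes "finite S" "Poly_Mapping.keys p \<subseteq> S"
  shows "subst_poly f p = (\<Sum>m\<in>S. Const (Poly_Mapping.lookup p m) * mon_subst f m)"
  unfolding subst_poly_def mon_subst_def[symmetric]
  using assms by (intro sum.mono_neutral_left) (auto simp: in_keys_iff)

lemma subst_poly_keys: "subst_poly f p = (\<Sum>m\<in>Poly_Mapping.keys p. Const (Poly_Mapping.lookup p m) * mon_subst f m)"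
  by (simp add: subst_poly_def mon_subst_def)

lemma subst_poly_0 [simp]: "subst_poly f 0 = 0"
  by (simp add: subst_poly_def)

lemma subst_poly_add: "subst_poly f (p + q) = subst_poly f p + subst_poly f q"
proof -
  let ?S = "Poly_Mapping.keys p \<union> Poly_Mapping.keys q"
  have "subst_poly f (p + q) = (\<Sum>m\<in>?S. Const (Poly_Mapping.lookup (p + q) m) * mon_subst f m)"
    using Poly_Mapping.keys_add[of p q] by (intro subst_poly_superset) auto
  moreover have "subst_poly f p = (\<Sum>m\<in>?S. Const (Poly_Mapping.lookup p m) * mon_subst f m)"
    "subst_poly f q = (\<Sum>m\<in>?S. Const (Poly_Mapping.lookup q m) * mon_subst f m)"
    by (intro subst_poly_superset; simp)+
  ultimately show ?thesis by (simp add: lookup_add Const_add distrib_right sum.distrib)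
qed

lemma subst_poly_Const_mult: "subst_poly f (Const c * p) = Const c * subst_poly f p"
proof -
  have "subst_poly f (Const c * p) = (\<Sum>m\<in>Poly_Mapping.keys p. Const (Poly_Mapping.lookup (Const c * p) m) * mon_subst f m)"
    using keys_Const_mult by (intro subst_poly_superset) auto
  then show ?thesis
    by (simp add: subst_poly_keys lookup_Const_mult Const_mult sum_distrib_left mult.assoc)
qed

lemma subst_poly_uminus: "subst_poly f (- p) = - subst_poly f p"
  using subst_poly_Const_mult[of f "-1" p] by (simp add: Const_uminus)

lemma subst_poly_diff: "subst_poly f (p - q) = subst_poly f p - subst_poly f q"
  using subst_poly_add[of f p "- q"] by (simp add: subst_poly_uminus)

lemma subst_poly_Mon_mult: "subst_poly f (Mon m * p) = mon_subst f m * subst_poly f p"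
proof -
  have "subst_poly f (Mon m * p) = (\<Sum>k\<in>(+) m ` Poly_Mapping.keys p. Const (Poly_Mapping.lookup (Mon m * p) k) * mon_subst f k)"
    by (simp add: subst_poly_keys keys_Mon_mult)
  also have "\<dots> = (\<Sum>k\<in>Poly_Mapping.keys p. Const (Poly_Mapping.lookup p k) * mon_subst f (m + k))"
    by (subst sum.reindex) (auto simp: inj_on_def lookup_Mon_mult)
  also have "\<dots> = mon_subst f m * subst_poly f p"
    by (simp add: subst_poly_keys mon_subst_add sum_distrib_left mult.left_commute)
  finally show ?thesis .
qed

lemma subst_poly_Mon [simp]: "subst_poly f (Mon m) = mon_subst f m"
  by (simp add: subst_poly_keys)

section \<open>Weights and initial forms\<close>

text \<open>Unlike \<open>weight\<close> it does not ask for a finite type of variables, so it also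
  applies to the matrix entries indexed by \<open>nat \<times> nat\<close>.\<close>

definition mwt :: "('v \<Rightarrow> real) \<Rightarrow> ('v \<Rightarrow>\<^sub>0 nat) \<Rightarrow> real" where
  "mwt B m = (\<Sum>v\<in>Poly_Mapping.keys m. B v * real (Poly_Mapping.lookup m v))"

lemma mwt_superset:
  "finite V \<Longrightarrow> Poly_Mapping.keys m \<subseteq> V \<Longrightarrow> mwt B m = (\<Sum>v\<in>V. B v * real (Poly_Mapping.lookup m v))"
  unfolding mwt_def by (intro sum.mono_neutral_left) (auto simp: in_keys_iff)

lemma mwt_0 [simp]: "mwt B 0 = 0"
  by (simp add: mwt_def)

lemma mwt_single [simp]: "mwt B (Poly_Mapping.single v (Suc 0)) = B v"
  by (simp add: mwt_def)

lemma mwt_add: "mwt B (m + m') = mwt B m + mwt B m'"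
proof -
  let ?V = "Poly_Mapping.keys m \<union> Poly_Mapping.keys m'"
  have "mwt B (m + m') = (\<Sum>v\<in>?V. B v * real (Poly_Mapping.lookup (m + m') v))"
    using Poly_Mapping.keys_add[of m m'] by (intro mwt_superset) auto
  moreover have "mwt B m = (\<Sum>v\<in>?V. B v * real (Poly_Mapping.lookup m v))"
    "mwt B m' = (\<Sum>v\<in>?V. B v * real (Poly_Mapping.lookup m' v))"
    by (intro mwt_superset; simp)+
  ultimately show ?thesis by (simp add: lookup_add distrib_left sum.distrib)
qed

lemma mwt_sum: "mwt B (\<Sum>x\<in>A. m x) = (\<Sum>x\<in>A. mwt B (m x))"
  by (induction A rule: infinite_finite_induct) (auto simp: mwt_add)

lemma weight_eq_mwt: "weight w = mwt (($) w)"
  by (rule ext) (simp add: weight_def mwt_superset[of UNIV])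

section \<open>Lowest-weight forms under substitution\<close>

text \<open>\<open>g\<close> is the component of \<open>f\<close> of lowest weight \<open>t\<close>;
  \<open>g = 0\<close> is allowed and then only says that all terms of \<open>f\<close> are heavier
  than \<open>t\<close>. In this form the notion is multiplicative.\<close>

definition leading :: "('v \<Rightarrow> real) \<Rightarrow> real \<Rightarrow> 'v cpoly \<Rightarrow> 'v cpoly \<Rightarrow> bool" where
  "leading B t f g \<longleftrightarrow> (\<forall>k\<in>Poly_Mapping.keys g. mwt B k = t) \<and> (\<forall>k\<in>Poly_Mapping.keys (f - g). t < mwt B k)"

lemma leading_one: "leading B 0 1 1"
  by (simp add: leading_def)

lemma leading_mult:
  assumes "leading B t f g" "leading B t' f' g'"
  shows "leading B (t + t') (f * f') (g * g')"
  unfolding leading_def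
proof (intro conjI ballI)
  fix k assume "k \<in> Poly_Mapping.keys (g * g')"
  then obtain a b where "k = a + b" "a \<in> Poly_Mapping.keys g" "b \<in> Poly_Mapping.keys g'"
    using keys_mult[of g g'] by auto
  then show "mwt B k = t + t'" using assms by (simp add: leading_def mwt_add)
next
  fix k assume k: "k \<in> Poly_Mapping.keys (f * f' - g * g')"
  \<comment> \<open>Each of the three products has at least one factor consisting of heavier terms
    only.\<close>
  have "f * f' - g * g' = (f - g) * (f' - g') + ((f - g) * g' + g * (f' - g'))"
    by (simp add: algebra_simps)
  then have "k \<in> Poly_Mapping.keys ((f - g) * (f' - g')) \<or> k \<in> Poly_Mapping.keys ((f - g) * g') \<or>
      k \<in> Poly_Mapping.keys (g * (f' - g'))"
    using k Poly_Mapping.keys_add by (metis (no_types, lifting) Un_iff subsetD)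
  then obtain a b where "k = a + b"
    "a \<in> Poly_Mapping.keys (f - g) \<and> b \<in> Poly_Mapping.keys (f' - g') \<or>
     a \<in> Poly_Mapping.keys (f - g) \<and> b \<in> Poly_Mapping.keys g' \<or>
     a \<in> Poly_Mapping.keys g \<and> b \<in> Poly_Mapping.keys (f' - g')"
    using keys_mult by blast
  then show "t + t' < mwt B k"
    using assms by (auto simp: leading_def mwt_add intro: add_strict_mono add_less_le_mono add_le_less_mono)
qed

lemma leading_power: "leading B t f g \<Longrightarrow> leading B (t * real n) (f ^ n) (g ^ n)"
proof (induction n)
  case (Suc n)
  then show ?case using leading_mult[of B t f g "t * real n" "f ^ n" "g ^ n"] by (simp add: distrib_left)
qed (simp add: leading_one)

lemma leading_prod:
  assumes "\<And>v. v \<in> V \<Longrightarrow> leading B (t v) (f v) (g v)"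
  shows "leading B (\<Sum>v\<in>V. t v) (\<Prod>v\<in>V. f v) (\<Prod>v\<in>V. g v)"
  using assms by (induction V rule: infinite_finite_induct) (auto simp: leading_one leading_mult)

lemma leading_mon_subst:
  assumes "\<And>v. leading B (w v) (f v) (g v)"
  shows "leading B (mwt w m) (mon_subst f m) (mon_subst g m)"
  unfolding mwt_def mon_subst_def by (intro leading_prod leading_power assms)

lemma keys_sum_Const_mult:
  assumes "k \<in> Poly_Mapping.keys (\<Sum>x\<in>A. Const (c x) * p x)"
  obtains x where "x \<in> A" "k \<in> Poly_Mapping.keys (p x)"
  using assms Poly_Mapping.keys_sum[of "\<lambda>x. Const (c x) * p x" A] keys_Const_mult by blast

text \<open>A relation among the \<open>f v\<close> degenerates to a relation among their leading
  forms: at weight \<open>t\<close> only the leading forms of the lightest monomials of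
  \<open>p\<close> contribute, so they have to cancel among themselves.\<close>

lemma subst_poly_lowest_part:
  assumes fg: "\<And>v. leading B (w v) (f v) (g v)"
    and zero: "subst_poly f p = 0"
    and low: "\<And>m. m \<in> Poly_Mapping.keys p \<Longrightarrow> t \<le> mwt w m"
  shows "subst_poly g (part (\<lambda>m. mwt w m = t) p) = 0"
proof -
  let ?c = "\<lambda>m. Const (Poly_Mapping.lookup p m)"
  define S where "S = {m \<in> Poly_Mapping.keys p. mwt w m = t}"
  define S' where "S' = {m \<in> Poly_Mapping.keys p. mwt w m \<noteq> t}"
  \<comment> \<open>\<open>G\<close> is the desired value, of weight \<open>t\<close>.
    \<open>H\<close> collects the tails of the substituted lightest monomials and \<open>H'\<close>
    the heavier monomials, so both consist of terms heavier than \<open>t\<close>.\<close>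
  define G where "G = (\<Sum>m\<in>S. ?c m * mon_subst g m)"
  define H where "H = (\<Sum>m\<in>S. ?c m * (mon_subst f m - mon_subst g m))"
  define H' where "H' = (\<Sum>m\<in>S'. ?c m * mon_subst f m)"
  have L: "(\<forall>k\<in>Poly_Mapping.keys (mon_subst g m). mwt B k = mwt w m) \<and>
      (\<forall>k\<in>Poly_Mapping.keys (mon_subst f m - mon_subst g m). mwt w m < mwt B k)" for m
    using leading_mon_subst[of B w f g m, OF fg] unfolding leading_def .
  have "Poly_Mapping.keys p = S \<union> S'" "S \<inter> S' = {}" by (auto simp: S_def S'_def)
  moreover have fin: "finite S" "finite S'" by (auto simp: S_def S'_def)
  ultimately have "subst_poly f p = (\<Sum>m\<in>S. ?c m * mon_subst f m) + H'"
    by (simp add: subst_poly_keys H'_def sum.union_disjoint)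
  also have "(\<Sum>m\<in>S. ?c m * mon_subst f m) = G + H"
    by (simp add: G_def H_def right_diff_distrib sum_subtractf)
  finally have "G + (H + H') = 0" using zero by (simp add: add.assoc)
  then have GH: "G = - (H + H')" by (simp only: eq_neg_iff_add_eq_0)
  have "G = 0"
  proof (rule ccontr)
    assume "G \<noteq> 0"
    then obtain k where k: "k \<in> Poly_Mapping.keys G" using keys_eq_empty by blast
    then have "mwt B k = t"
      unfolding G_def by (rule keys_sum_Const_mult) (use L in \<open>auto simp: S_def\<close>)
    have "k \<in> Poly_Mapping.keys (H + H')" using k unfolding GH keys_minus .
    then consider "k \<in> Poly_Mapping.keys H" | "k \<in> Poly_Mapping.keys H'"
      using Poly_Mapping.keys_add[of H H'] by blast
    then have "t < mwt B k"
    proof cases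
      case 1
      then show ?thesis
        unfolding H_def by (rule keys_sum_Const_mult) (use L in \<open>auto simp: S_def\<close>)
    next
      case 2
      then obtain m where m: "m \<in> S'" "k \<in> Poly_Mapping.keys (mon_subst f m)"
        unfolding H'_def by (rule keys_sum_Const_mult)
      have "Poly_Mapping.keys (mon_subst f m) \<subseteq>
          Poly_Mapping.keys (mon_subst f m - mon_subst g m) \<union> Poly_Mapping.keys (mon_subst g m)"
        by (auto simp: in_keys_iff lookup_minus)
      then have "mwt w m \<le> mwt B k" using m(2) L[of m, THEN conjunct1, rule_format, of k] L[of m, THEN conjunct2, rule_format, of k] by (auto intro: less_imp_le)
      moreover have "t < mwt w m" using m(1) low[of m] by (auto simp: S'_def)
      ultimately show ?thesis by simp
    qed
    then show False using \<open>mwt B k = t\<close> by simp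
  qed
  moreover have "subst_poly g (part (\<lambda>m. mwt w m = t) p) = G"
    unfolding G_def S_def subst_poly_keys keys_part
    by (intro sum.cong) (auto simp: lookup_part)
  ultimately show ?thesis by simp
qed

text \<open>A substitution by homogeneous polynomials respects the gradings, so it commutes with
  taking components and its kernel is graded.\<close>

lemma subst_poly_part:
  assumes hom: "\<And>v. leading B (w v) (f v) (f v)"
  shows "subst_poly f (part (\<lambda>m. mwt w m = t) p) = part (\<lambda>m. mwt B m = t) (subst_poly f p)"
proof -
  have "\<forall>k\<in>Poly_Mapping.keys (mon_subst f m). mwt B k = mwt w m" for m
    using leading_mon_subst[of B w f f m, OF hom] unfolding leading_def by blast
  then have "part (\<lambda>m. mwt B m = t) (mon_subst f m) = (if mwt w m = t then mon_subst f m else 0)" for m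
    using part_id[of "mon_subst f m"] part_none[of "mon_subst f m"] by simp
  then have "part (\<lambda>m. mwt B m = t) (subst_poly f p) =
      (\<Sum>m\<in>Poly_Mapping.keys p. Const (Poly_Mapping.lookup p m) * (if mwt w m = t then mon_subst f m else 0))"
    by (simp add: subst_poly_keys part_sum part_Const_mult)
  also have "\<dots> = (\<Sum>m\<in>Poly_Mapping.keys p. Const (Poly_Mapping.lookup (part (\<lambda>m. mwt w m = t) p) m) * mon_subst f m)"
    by (intro sum.cong) (auto simp: lookup_part)
  also have "\<dots> = subst_poly f (part (\<lambda>m. mwt w m = t) p)"
    by (intro subst_poly_superset[symmetric]) (auto simp: keys_part)
  finally show ?thesis by simp
qed

lemma lookup_initial_form:
  "Poly_Mapping.lookup (initial_form w p) k =
    (if k \<in> Poly_Mapping.keys p \<and> (\<forall>m'\<in>Poly_Mapping.keys p. weight w k \<le> weight w m')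
     then Poly_Mapping.lookup p k else 0)"
proof -
  have "finite {m. m \<in> Poly_Mapping.keys p \<and> (\<forall>m'\<in>Poly_Mapping.keys p. weight w m \<le> weight w m')}"
    by simp
  then show ?thesis
    by (auto simp: initial_form_def lookup_sum lookup_single when_def sum.delta)
qed

lemma in_keys_initial_form_iff:
  "k \<in> Poly_Mapping.keys (initial_form w p) \<longleftrightarrow>
    k \<in> Poly_Mapping.keys p \<and> (\<forall>m\<in>Poly_Mapping.keys p. weight w k \<le> weight w m)"
  by (simp add: in_keys_iff[of k "initial_form w p"] lookup_initial_form) (auto simp: in_keys_iff)

lemma initial_form_0 [simp]: "initial_form w 0 = 0"
  by (rule poly_mapping_eqI) (simp add: lookup_initial_form)

lemma initial_form_eq_part:
  assumes "p \<noteq> 0"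
  obtains t where "\<And>m. m \<in> Poly_Mapping.keys p \<Longrightarrow> t \<le> weight w m"
    "initial_form w p = part (\<lambda>m. weight w m = t) p" "initial_form w p \<noteq> 0"
proof -
  let ?t = "Min (weight w ` Poly_Mapping.keys p)"
  have ne: "Poly_Mapping.keys p \<noteq> {}" using assms by simp
  have low: "?t \<le> weight w m" if "m \<in> Poly_Mapping.keys p" for m using that by simp
  have "?t \<in> weight w ` Poly_Mapping.keys p" using ne by (intro Min_in) auto
  then obtain m where m: "m \<in> Poly_Mapping.keys p" "weight w m = ?t" by auto
  have eq: "initial_form w p = part (\<lambda>m. weight w m = ?t) p"
  proof (rule poly_mapping_eqI)
    fix k
    have "(\<forall>m'\<in>Poly_Mapping.keys p. weight w k \<le> weight w m') \<longleftrightarrow> weight w k = ?t"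
      if "k \<in> Poly_Mapping.keys p"
      using low m that by (metis order.antisym)
    then show "Poly_Mapping.lookup (initial_form w p) k = Poly_Mapping.lookup (part (\<lambda>m. weight w m = ?t) p) k"
      by (auto simp: lookup_initial_form lookup_part in_keys_iff)
  qed
  have "m \<in> Poly_Mapping.keys (initial_form w p)" using m by (simp add: eq keys_part)
  then have "initial_form w p \<noteq> 0" using keys_zero by (metis empty_iff)
  then show thesis using that[OF low eq] by simp
qed

text \<open>That the component is nonzero certifies that the lower bound \<open>t\<close> is
  attained, hence is the minimum.\<close>

lemma initial_form_eqI:
  assumes "\<And>m. m \<in> Poly_Mapping.keys p \<Longrightarrow> t \<le> weight w m"
    and "part (\<lambda>m. weight w m = t) p \<noteq> 0"
  shows "initial_form w p = part (\<lambda>m. weight w m = t) p"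
proof (rule poly_mapping_eqI)
  fix k
  obtain m where "m \<in> Poly_Mapping.keys (part (\<lambda>m. weight w m = t) p)" using assms(2) keys_eq_empty by blast
  then have m: "m \<in> Poly_Mapping.keys p" "weight w m = t" by (auto simp: keys_part)
  have "(\<forall>m'\<in>Poly_Mapping.keys p. weight w k \<le> weight w m') \<longleftrightarrow> weight w k = t"
    if "k \<in> Poly_Mapping.keys p"
    using assms(1) m that by (metis order.antisym)
  then show "Poly_Mapping.lookup (initial_form w p) k = Poly_Mapping.lookup (part (\<lambda>m. weight w m = t) p) k"
    by (auto simp: lookup_initial_form lookup_part in_keys_iff)
qed

lemma keys_initial_form: "Poly_Mapping.keys (initial_form w p) \<subseteq> Poly_Mapping.keys p"
  by (auto simp: in_keys_iff lookup_initial_form split: if_splits)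

text \<open>A monomial factor shifts all weights by the same amount. This is what makes the linear
  span \<open>initial_ideal\<close> an ideal.\<close>

lemma initial_form_Mon_mult: "initial_form w (Mon m * p) = Mon m * initial_form w p"
proof (cases "p = 0")
  case False
  then obtain t where t: "\<And>k. k \<in> Poly_Mapping.keys p \<Longrightarrow> t \<le> weight w k"
    "initial_form w p = part (\<lambda>m. weight w m = t) p" "initial_form w p \<noteq> 0"
    using initial_form_eq_part[OF False, where w = w] by blast
  have eq: "part (\<lambda>k. weight w k = weight w m + t) (Mon m * p) = Mon m * part (\<lambda>m. weight w m = t) p"
  proof (rule poly_mapping_eqI)
    fix k
    show "Poly_Mapping.lookup (part (\<lambda>k. weight w k = weight w m + t) (Mon m * p)) k =
        Poly_Mapping.lookup (Mon m * part (\<lambda>m. weight w m = t) p) k"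
    proof (cases "k \<in> range ((+) m)")
      case True
      then show ?thesis by (auto simp: lookup_part lookup_Mon_mult weight_eq_mwt mwt_add)
    next
      case False
      then have "k \<notin> Poly_Mapping.keys (Mon m * p)" "k \<notin> Poly_Mapping.keys (Mon m * part (\<lambda>m. weight w m = t) p)"
        by (auto simp: keys_Mon_mult)
      then show ?thesis by (simp add: lookup_part in_keys_iff)
    qed
  qed
  have "Mon m * initial_form w p \<noteq> 0"
    using t(3) by (simp flip: keys_eq_empty add: keys_Mon_mult)
  then have "initial_form w (Mon m * p) = part (\<lambda>k. weight w k = weight w m + t) (Mon m * p)"
    using t(1,2) by (intro initial_form_eqI) (auto simp: keys_Mon_mult eq[unfolded weight_eq_mwt] weight_eq_mwt mwt_add)
  then show ?thesis by (simp add: eq t(2))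
qed simp

section \<open>Ideals\<close>

text \<open>Closure is only asked for constant and monomial factors, which is easier to check;
  \<open>ideal_mult\<close> recovers arbitrary factors.\<close>

definition is_ideal :: "'v cpoly set \<Rightarrow> bool" where
  "is_ideal J \<longleftrightarrow> 0 \<in> J \<and> (\<forall>p\<in>J. \<forall>q\<in>J. p + q \<in> J) \<and>
     (\<forall>c. \<forall>p\<in>J. Const c * p \<in> J) \<and> (\<forall>m. \<forall>p\<in>J. Mon m * p \<in> J)"

lemma is_idealD:
  assumes "is_ideal J"
  shows ideal_0: "0 \<in> J"
    and ideal_add: "\<And>p q. p \<in> J \<Longrightarrow> q \<in> J \<Longrightarrow> p + q \<in> J"
    and ideal_Const: "\<And>c p. p \<in> J \<Longrightarrow> Const c * p \<in> J"
    and ideal_Mon: "\<And>m p. p \<in> J \<Longrightarrow> Mon m * p \<in> J"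
    and ideal_diff: "\<And>p q. p \<in> J \<Longrightarrow> q \<in> J \<Longrightarrow> p - q \<in> J"
proof -
  show z: "0 \<in> J" and add: "\<And>p q. p \<in> J \<Longrightarrow> q \<in> J \<Longrightarrow> p + q \<in> J"
    and C: "\<And>c p. p \<in> J \<Longrightarrow> Const c * p \<in> J" and M: "\<And>m p. p \<in> J \<Longrightarrow> Mon m * p \<in> J"
    using assms by (auto simp: is_ideal_def)
  have um: "- p \<in> J" if "p \<in> J" for p
    using C[OF that, of "-1"] by (simp add: Const_uminus)
  show "p - q \<in> J" if "p \<in> J" "q \<in> J" for p q
    using add[OF that(1) um[OF that(2)]] by simp
qed

lemma ideal_sum:
  assumes "is_ideal J" "\<And>x. x \<in> A \<Longrightarrow> p x \<in> J"
  shows "(\<Sum>x\<in>A. p x) \<in> J"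
  using assms(2) by (induction A rule: infinite_finite_induct) (auto intro: is_idealD[OF assms(1)])

lemma ideal_mult:
  assumes "is_ideal J" "p \<in> J"
  shows "q * p \<in> J"
proof -
  have "(\<Sum>m\<in>Poly_Mapping.keys q. Const (Poly_Mapping.lookup q m) * (Mon m * p)) \<in> J"
    using assms by (intro ideal_sum ideal_Const ideal_Mon)
  moreover have "q * p = (\<Sum>m\<in>Poly_Mapping.keys q. Const (Poly_Mapping.lookup q m) * Mon m) * p"
    using poly_sum_Mon[of q] by simp
  ultimately show ?thesis by (simp add: sum_distrib_right mult.assoc)
qed

lemma module_mult: "Modules.module ((*) :: 'v cpoly \<Rightarrow> _)"
  by unfold_locales (simp_all add: algebra_simps)

lemma module_Const: "Modules.module (\<lambda>c p :: 'v cpoly. Const c * p)"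
  by unfold_locales (simp_all add: algebra_simps Const_add Const_mult)

lemma is_ideal_ideal_generated: "is_ideal (ideal_generated S)"
  unfolding is_ideal_def ideal_generated_def
  using Modules.module.span_zero[OF module_mult] Modules.module.span_add[OF module_mult] Modules.module.span_scale[OF module_mult]
  by blast

lemma ideal_generated_base: "p \<in> S \<Longrightarrow> p \<in> ideal_generated S"
  unfolding ideal_generated_def by (rule Modules.module.span_base[OF module_mult])

lemma ideal_generated_minimal:
  assumes "is_ideal J" "S \<subseteq> J"
  shows "ideal_generated S \<subseteq> J"
  unfolding ideal_generated_def
proof (rule Modules.module.span_minimal[OF module_mult assms(2)])
  show "module.subspace (*) J"
    unfolding Modules.module.subspace_def[OF module_mult] using assms(1) ideal_mult
    by (auto intro: ideal_0 ideal_add)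
qed

lemma complex_span_induct [consumes 1, case_names zero base add scale]:
  assumes "p \<in> complex_span S" "P 0" "\<And>q. q \<in> S \<Longrightarrow> P q" "\<And>q r. P q \<Longrightarrow> P r \<Longrightarrow> P (q + r)"
    "\<And>c q. P q \<Longrightarrow> P (Const c * q)"
  shows "P p"
proof -
  have "module.span (\<lambda>c p. Const c * p) S \<subseteq> Collect P"
  proof (rule Modules.module.span_minimal[OF module_Const])
    show "module.subspace (\<lambda>c p. Const c * p) (Collect P)"
      unfolding Modules.module.subspace_def[OF module_Const] using assms(2,4,5) by auto
  qed (use assms(3) in auto)
  then show ?thesis using assms(1) by (auto simp: complex_span_def)
qed

lemma initial_ideal_base: "p \<in> I \<Longrightarrow> initial_form w p \<in> initial_ideal w I"
  unfolding initial_ideal_def complex_span_def by (intro Modules.module.span_base[OF module_Const] imageI)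

lemma is_ideal_initial_ideal:
  assumes "is_ideal I"
  shows "is_ideal (initial_ideal w I)"
proof -
  let ?J = "initial_ideal w I"
  have z: "0 \<in> ?J" and plus: "\<And>p q. p \<in> ?J \<Longrightarrow> q \<in> ?J \<Longrightarrow> p + q \<in> ?J"
    and C: "\<And>c p. p \<in> ?J \<Longrightarrow> Const c * p \<in> ?J"
    unfolding initial_ideal_def complex_span_def
    using Modules.module.span_zero[OF module_Const] Modules.module.span_add[OF module_Const] Modules.module.span_scale[OF module_Const]
    by blast+
  have "Mon m * p \<in> ?J" if "p \<in> ?J" for m p
    using that unfolding initial_ideal_def[of w I]
  proof (induction rule: complex_span_induct)
    case (base q)
    then obtain r where "r \<in> I" "q = initial_form w r" by auto
    then show ?case
      using initial_ideal_base[OF ideal_Mon[OF assms], of r w m]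
      by (simp add: initial_form_Mon_mult initial_ideal_def)
  next
    case (add q r)
    then show ?case using plus by (simp add: distrib_left initial_ideal_def)
  next
    case (scale c q)
    then show ?case using C by (simp add: mult.left_commute[of "Mon m"] initial_ideal_def)
  qed (use z in \<open>simp add: initial_ideal_def\<close>)
  then show ?thesis using z plus C by (auto simp: is_ideal_def)
qed

text \<open>For one initial form the component of weight \<open>t\<close> is either 0, lifted by
  \<open>p = 0\<close>, or the whole form, lifted by the polynomial it comes from. Such lifts may be
  added and scaled because heavier terms do no harm.\<close>

lemma initial_ideal_part:
  assumes "is_ideal I" "q \<in> initial_ideal w I"
  obtains p where "p \<in> I" "\<And>m. m \<in> Poly_Mapping.keys p \<Longrightarrow> t \<le> weight w m"
    "part (\<lambda>m. weight w m = t) p = part (\<lambda>m. weight w m = t) q"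
proof -
  let ?p = "part (\<lambda>m. weight w m = t)"
  have "\<exists>p\<in>I. (\<forall>m\<in>Poly_Mapping.keys p. t \<le> weight w m) \<and> ?p p = ?p q"
    using assms(2) unfolding initial_ideal_def
  proof (induction rule: complex_span_induct)
    case zero
    show ?case using ideal_0[OF assms(1)] by (intro bexI[of _ 0]) auto
  next
    case (base q)
    then obtain p where p: "p \<in> I" "q = initial_form w p" by auto
    show ?case
    proof (cases "?p q = 0")
      case True
      then show ?thesis using ideal_0[OF assms(1)] by (intro bexI[of _ 0]) auto
    next
      case False
      then have "p \<noteq> 0" using p by auto
      then obtain t' where t': "\<And>m. m \<in> Poly_Mapping.keys p \<Longrightarrow> t' \<le> weight w m"
        "initial_form w p = part (\<lambda>m. weight w m = t') p"
        using initial_form_eq_part[of p, where w = w] by blast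
      have "t' = t"
      proof (rule ccontr)
        assume "t' \<noteq> t"
        then have "?p q = 0" unfolding p(2) t'(2) by (intro part_none) (auto simp: keys_part)
        then show False using False by simp
      qed
      then have "?p q = ?p p" using p t' by simp
      then show ?thesis using p(1) t'(1) \<open>t' = t\<close> by auto
    qed
  next
    case (add q r)
    then obtain p p' where p: "p \<in> I" "\<forall>m\<in>Poly_Mapping.keys p. t \<le> weight w m" "?p p = ?p q"
      "p' \<in> I" "\<forall>m\<in>Poly_Mapping.keys p'. t \<le> weight w m" "?p p' = ?p r" by blast
    then have "p + p' \<in> I" "?p (p + p') = ?p (q + r)" by (simp_all add: ideal_add[OF assms(1)] part_add)
    moreover have "\<forall>m\<in>Poly_Mapping.keys (p + p'). t \<le> weight w m"
      using p Poly_Mapping.keys_add[of p p'] by blast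
    ultimately show ?case by blast
  next
    case (scale c q)
    then obtain p where p: "p \<in> I" "\<forall>m\<in>Poly_Mapping.keys p. t \<le> weight w m" "?p p = ?p q" by blast
    then have "Const c * p \<in> I" "?p (Const c * p) = ?p (Const c * q)"
      by (simp_all add: ideal_Const[OF assms(1)] part_Const_mult)
    moreover have "\<forall>m\<in>Poly_Mapping.keys (Const c * p). t \<le> weight w m"
      using p keys_Const_mult by blast
    ultimately show ?case by blast
  qed
  then show thesis using that by blast
qed

lemma is_ideal_kernel: "is_ideal {p. subst_poly f p = 0}"
  by (simp add: is_ideal_def subst_poly_add subst_poly_Const_mult subst_poly_Mon_mult)

lemma is_ideal_plucker: "is_ideal plucker_ideal"
  unfolding plucker_ideal_def by (rule is_ideal_kernel)

section \<open>Leading terms of minors\<close>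

text \<open>The exponent of the product of the entries in row \<open>r\<close> and column
  \<open>xs ! (r - 1)\<close>. For \<open>xs = idx a\<close> this is the diagonal term of the minor,
  for rearrangements of \<open>idx a\<close> the other terms of the Leibniz formula.\<close>

definition place_exp :: "nat list \<Rightarrow> (nat \<times> nat) \<Rightarrow>\<^sub>0 nat" where
  "place_exp xs = (\<Sum>r<length xs. Poly_Mapping.single (Suc r, xs ! r) 1)"

lemma mwt_place_exp: "mwt B (place_exp xs) = (\<Sum>r<length xs. B (Suc r, xs ! r))"
  by (simp add: place_exp_def mwt_sum)

lemma Mon_sum: "Mon (\<Sum>x\<in>A. m x) = (\<Prod>x\<in>A. Mon (m x))"
  by (induction A rule: infinite_finite_induct) (auto simp: Mon_add)

lemma plucker_minor_eq:
  "plucker_minor a = (\<Sum>\<sigma> | \<sigma> permutes {..<length (idx a)}.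
     Const (of_int (sign \<sigma>)) * Mon (place_exp (permute_list \<sigma> (idx a))))"
proof -
  let ?k = "length (idx a)"
  have "plucker_minor a = (\<Sum>\<sigma> | \<sigma> permutes {0..<?k}. signof \<sigma> * (\<Prod>i = 0..<?k. Var (i + 1, idx a ! \<sigma> i)))"
    unfolding plucker_minor_def det_def'[OF mat_carrier]
    by (intro sum.cong refl arg_cong2[where f = "(*)"] prod.cong) (auto simp: permutes_in_image)
  also have "\<dots> = (\<Sum>\<sigma> | \<sigma> permutes {..<?k}.
     Const (of_int (sign \<sigma>)) * Mon (place_exp (permute_list \<sigma> (idx a))))"
  proof (intro sum.cong)
    fix \<sigma> assume "\<sigma> \<in> {\<sigma>. \<sigma> permutes {..<?k}}"
    then have \<sigma>: "\<sigma> permutes {..<?k}" by simp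
    have "Mon (place_exp (permute_list \<sigma> (idx a))) = (\<Prod>i<?k. Var (Suc i, idx a ! \<sigma> i))"
      using \<sigma> by (auto simp: place_exp_def Mon_sum Var_def permute_list_nth intro!: prod.cong)
    then show "signof \<sigma> * (\<Prod>i = 0..<?k. Var (i + 1, idx a ! \<sigma> i)) =
        Const (of_int (sign \<sigma>)) * Mon (place_exp (permute_list \<sigma> (idx a)))"
      by (simp add: lessThan_atLeast0 sign_def Const_uminus)
  qed (simp add: lessThan_atLeast0)
  finally show ?thesis .
qed

lemma permute_idx_ne:
  assumes "\<sigma> permutes {..<length (idx a)}" "\<sigma> \<noteq> id"
  shows "permute_list \<sigma> (idx a) \<noteq> idx a"
proof
  assume eq: "permute_list \<sigma> (idx a) = idx a"
  have "\<sigma> r = r" for r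
  proof (cases "r < length (idx a)")
    case True
    then have "\<sigma> r < length (idx a)" using assms(1) permutes_in_image by fastforce
    moreover have "idx a ! \<sigma> r = idx a ! r"
      using permute_list_nth[OF assms(1) True] eq by simp
    ultimately show ?thesis using True distinct_idx[of a] by (simp add: nth_eq_iff_index_eq)
  next
    case False
    then show ?thesis using assms(1) by (simp add: permutes_not_in)
  qed
  then show False using assms(2) by auto
qed

text \<open>The columns are distinct, so every permutation other than \<open>id\<close> contributes
  a proper rearrangement of \<open>idx a\<close>, to which the strict inequality applies.\<close>

lemma leading_plucker_minor:
  assumes "mwt B (place_exp (idx a)) = t"
    and "\<And>xs. mset xs = mset (idx a) \<Longrightarrow> xs \<noteq> idx a \<Longrightarrow> t < mwt B (place_exp xs)"
  shows "leading B t (plucker_minor a) (Mon (place_exp (idx a)))"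
proof -
  let ?P = "{\<sigma>. \<sigma> permutes {..<length (idx a)}}"
  have fin: "finite ?P" by (rule finite_permutations) simp
  have "plucker_minor a = Mon (place_exp (idx a)) +
      (\<Sum>\<sigma>\<in>?P - {id}. Const (of_int (sign \<sigma>)) * Mon (place_exp (permute_list \<sigma> (idx a))))"
    unfolding plucker_minor_eq by (subst sum.remove[OF fin, of id]) (auto simp: permutes_id)
  then have d: "plucker_minor a - Mon (place_exp (idx a)) =
      (\<Sum>\<sigma>\<in>?P - {id}. Const (of_int (sign \<sigma>)) * Mon (place_exp (permute_list \<sigma> (idx a))))"
    by simp
  have "t < mwt B k" if k: "k \<in> Poly_Mapping.keys (plucker_minor a - Mon (place_exp (idx a)))" for k
  proof -
    obtain \<sigma> where "\<sigma> \<in> ?P - {id}" "k \<in> Poly_Mapping.keys (Mon (place_exp (permute_list \<sigma> (idx a))))"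
      using k unfolding d by (rule keys_sum_Const_mult)
    then show ?thesis
      using assms(2)[of "permute_list \<sigma> (idx a)"] permute_idx_ne[of \<sigma> a] by (auto simp: mset_permute_list)
  qed
  then show ?thesis using assms(1) by (auto simp: leading_def)
qed

lemma keys_plucker_minor:
  assumes "k \<in> Poly_Mapping.keys (plucker_minor a)"
  obtains xs where "mset xs = mset (idx a)" "k = place_exp xs"
proof -
  obtain \<sigma> where "\<sigma> permutes {..<length (idx a)}" "k \<in> Poly_Mapping.keys (Mon (place_exp (permute_list \<sigma> (idx a))))"
    using assms unfolding plucker_minor_eq by (rule keys_sum_Const_mult) auto
  then show thesis using that[of "permute_list \<sigma> (idx a)"] by (auto simp: mset_permute_list)
qed

text \<open>The total degree, kept real-valued so that the facts on \<open>mwt\<close> apply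
  directly.\<close>

definition mdeg :: "('v \<Rightarrow>\<^sub>0 nat) \<Rightarrow> real" where "mdeg = mwt (\<lambda>_. 1)"

lemma plucker_ideal_degree_part:
  assumes "p \<in> plucker_ideal"
  shows "part (\<lambda>m. mdeg m = t) p \<in> plucker_ideal"
proof -
  \<comment> \<open>Every term of every minor uses row 1 exactly once, whatever the size of the
    minor. Weighting only this row therefore makes all minors homogeneous of degree 1, and the
    kernel graded by total degree.\<close>
  define B :: "nat \<times> nat \<Rightarrow> real" where "B = (\<lambda>(r, i). if r = 1 then 1 else 0)"
  have "leading B 1 (plucker_minor a) (plucker_minor a)" for a :: "'a plucker"
    unfolding leading_def
  proof (intro conjI ballI)
    fix k assume "k \<in> Poly_Mapping.keys (plucker_minor a)"
    then obtain xs where xs: "mset xs = mset (idx a)" "k = place_exp xs" by (rule keys_plucker_minor)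
    have "length xs = length (idx a)" using xs(1) by (rule mset_eq_length)
    then have "0 < length xs" using idx_props(3)[of a] by linarith
    then show "mwt B k = 1" by (simp add: xs mwt_place_exp B_def sum.delta)
  qed simp
  then have "subst_poly plucker_minor (part (\<lambda>m. mwt (\<lambda>_. 1) m = t) p) =
      part (\<lambda>m. mwt B m = t) (subst_poly plucker_minor p)"
    by (rule subst_poly_part)
  then show ?thesis using assms by (simp add: plucker_ideal_def mdeg_def)
qed

text \<open>The elements of \<open>S\<close> outside \<open>{..<c}\<close> are as many as the
  elements of \<open>{..<c}\<close> missing from \<open>S\<close>; exchanging them along a bijection
  moves every summand to a smaller argument.\<close>

lemma sum_mono_subset:
  fixes f :: "nat \<Rightarrow> real"
  assumes S: "finite S" "card S = c" and f: "\<And>r s. r < s \<Longrightarrow> s \<in> S \<Longrightarrow> f r \<le> f s"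
  shows "(\<Sum>r<c. f r) \<le> (\<Sum>r\<in>S. f r)"
    "S \<noteq> {..<c} \<Longrightarrow> (\<And>r s. r < s \<Longrightarrow> s \<in> S \<Longrightarrow> f r < f s) \<Longrightarrow> (\<Sum>r<c. f r) < (\<Sum>r\<in>S. f r)"
proof -
  let ?A = "S - {..<c}" and ?B = "{..<c} - S"
  have cI: "card ?A = card ?B"
    using S card_Diff_subset_Int[of S "{..<c}"] card_Diff_subset_Int[of "{..<c}" S]
    by (simp add: Int_commute)
  have sA: "sum f S = sum f (S \<inter> {..<c}) + sum f ?A"
    using S by (simp add: sum.Int_Diff[of S f "{..<c}"])
  have sB: "sum f {..<c} = sum f (S \<inter> {..<c}) + sum f ?B"
    using sum.Int_Diff[of "{..<c}" f S] by (simp add: Int_commute)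
  obtain h where h: "bij_betw h ?B ?A"
    using cI S(1) finite_same_card_bij[of ?B ?A] by auto
  have sh: "sum f ?A = (\<Sum>r\<in>?B. f (h r))" using sum.reindex_bij_betw[OF h, of f] by simp
  have hr: "h r \<in> S \<and> r < h r" if "r \<in> ?B" for r
  proof -
    have "h r \<in> ?A" using that bij_betwE[OF h] by blast
    then show ?thesis using that by auto
  qed
  have le: "sum f ?B \<le> (\<Sum>r\<in>?B. f (h r))" using hr f by (intro sum_mono) blast
  then show "(\<Sum>r<c. f r) \<le> (\<Sum>r\<in>S. f r)" using sA sB sh by simp
  assume ne: "S \<noteq> {..<c}" and strict: "\<And>r s. r < s \<Longrightarrow> s \<in> S \<Longrightarrow> f r < f s"
  have "?B \<noteq> {}"
  proof
    assume e: "?B = {}"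
    have "card ?A = 0" unfolding cI e by simp
    then have "?A = {}" using S(1) by (simp only: card_0_eq finite_Diff)
    then show False using e ne by blast
  qed
  then have "sum f ?B < (\<Sum>r\<in>?B. f (h r))"
  proof (intro sum_strict_mono)
    show "f r < f (h r)" if "r \<in> ?B" for r using hr[OF that] strict[of r "h r"] by blast
  qed auto
  then show "(\<Sum>r<c. f r) < (\<Sum>r\<in>S. f r)" using sA sB sh by simp
qed

section \<open>Toric degenerations\<close>

text \<open>The entry in row \<open>r\<close> and column \<open>i\<close> is charged for the cells
  \<open>(y, r)\<close> with \<open>i \<le> y\<close>. Along the diagonal term of \<open>a\<close>
  these are just the cells below the profile of \<open>a\<close>, see
  \<open>profile_weight_eq_mwt\<close>.\<close>

definition place_weight :: "nat \<Rightarrow> (nat \<Rightarrow> nat \<Rightarrow> real) \<Rightarrow> nat \<times> nat \<Rightarrow> real" where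
  "place_weight n \<psi> = (\<lambda>(r, i). \<Sum>y=i..n. \<psi> y r)"

definition profile_weight :: "(nat \<Rightarrow> nat \<Rightarrow> real) \<Rightarrow> real ^ 'n::card2 plucker" where
  "profile_weight \<psi> = (\<chi> a. \<Sum>y=1..CARD('n). \<Sum>s=1..cnt a y. \<psi> y s)"

lemma mwt_place_weight:
  assumes "set xs \<subseteq> {1..n}"
  shows "mwt (place_weight n \<psi>) (place_exp xs) =
    (\<Sum>y=1..n. \<Sum>r | r < length xs \<and> xs ! r \<le> y. \<psi> y (Suc r))"
proof -
  have "mwt (place_weight n \<psi>) (place_exp xs) = (\<Sum>r<length xs. \<Sum>y=xs!r..n. \<psi> y (Suc r))"
    by (simp add: mwt_place_exp place_weight_def)
  also have "\<dots> = (\<Sum>r<length xs. \<Sum>y=1..n. if xs ! r \<le> y then \<psi> y (Suc r) else 0)"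
  proof (rule sum.cong[OF refl])
    fix r assume "r \<in> {..<length xs}"
    then have "xs ! r \<in> {1..n}" using assms nth_mem by blast
    then have "{xs!r..n} = {y \<in> {1..n}. xs ! r \<le> y}" by auto
    then show "(\<Sum>y=xs!r..n. \<psi> y (Suc r)) = (\<Sum>y=1..n. if xs ! r \<le> y then \<psi> y (Suc r) else 0)"
      by (simp only: sum.inter_filter[OF finite_atLeastAtMost])
  qed
  also have "\<dots> = (\<Sum>y=1..n. \<Sum>r<length xs. if xs ! r \<le> y then \<psi> y (Suc r) else 0)"
    by (rule sum.swap)
  also have "\<dots> = (\<Sum>y=1..n. \<Sum>r | r < length xs \<and> xs ! r \<le> y. \<psi> y (Suc r))"
      proof -
    have "{r. r < length xs \<and> xs ! r \<le> y} = {r \<in> {..<length xs}. xs ! r \<le> y}" for y by auto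
    then show ?thesis by (simp only: sum.inter_filter[OF finite_lessThan])
  qed
  finally show ?thesis .
qed

lemma sum_1_eq_lessThan: "(\<Sum>s=Suc 0..c. f s) = (\<Sum>r<c. f (Suc r))" for f :: "nat \<Rightarrow> real"
  by (induction c) auto

lemma profile_weight_eq_mwt:
  fixes a :: "'n::card2 plucker"
  shows "profile_weight \<psi> $ a = mwt (place_weight CARD('n) \<psi>) (place_exp (idx a))"
  by (simp add: mwt_place_weight[OF idx_props(2)] positions_le profile_weight_def sum_1_eq_lessThan)

text \<open>No condition is imposed at \<open>y = n\<close>: there all entries are at most
  \<open>y\<close>, so all terms of a minor cover the same cells.\<close>

definition strictly_rising :: "nat \<Rightarrow> (nat \<Rightarrow> nat \<Rightarrow> real) \<Rightarrow> bool" where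
  "strictly_rising n \<psi> \<longleftrightarrow> (\<forall>y<n. \<forall>r s. 1 \<le> r \<longrightarrow> r < s \<longrightarrow> \<psi> y r < \<psi> y s)"

text \<open>A term of the minor given by \<open>xs\<close> is charged at \<open>y\<close> for the
  rows with entry at most \<open>y\<close>. Their number is \<open>cnt a y\<close> for every
  rearrangement, but only the diagonal term always uses the first rows, which are the
  cheapest.\<close>

lemma leading_profile_weight:
  fixes a :: "'n::card2 plucker"
  assumes \<psi>: "strictly_rising CARD('n) \<psi>"
  shows "leading (place_weight CARD('n) \<psi>) (profile_weight \<psi> $ a) (plucker_minor a) (Mon (place_exp (idx a)))"
proof (rule leading_plucker_minor)
  let ?n = "CARD('n)"
  show "mwt (place_weight ?n \<psi>) (place_exp (idx a)) = profile_weight \<psi> $ a"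
    by (simp add: profile_weight_eq_mwt)
  fix xs assume xs: "mset xs = mset (idx a)" "xs \<noteq> idx a"
  have len: "length xs = length (idx a)" using xs(1) by (rule mset_eq_length)
  have set: "set xs = set (idx a)" using xs(1) by (rule mset_eq_setD)
  define S where "S = (\<lambda>y. {r. r < length xs \<and> xs ! r \<le> y})"
  have fin: "finite (S y)" for y by (simp add: S_def)
  have card: "card (S y) = cnt a y" for y
  proof -
    have "card (S y) = size (filter_mset (\<lambda>i. i \<le> y) (mset xs))"
      by (simp add: S_def length_filter_conv_card flip: mset_filter)
    also have "\<dots> = cnt a y"
      unfolding xs(1) by (simp add: cnt_positions length_filter_conv_card flip: mset_filter)
    finally show ?thesis .
  qed
  have top: "S ?n = {..<cnt a ?n}"
    using set idx_props(2)[of a] nth_mem[of _ xs] len by (force simp: S_def cnt_card)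
  have w: "profile_weight \<psi> $ a = (\<Sum>y=1..?n. \<Sum>r<cnt a y. \<psi> y (Suc r))"
    by (simp add: profile_weight_def sum_1_eq_lessThan)
  have w': "mwt (place_weight ?n \<psi>) (place_exp xs) = (\<Sum>y=1..?n. \<Sum>r\<in>S y. \<psi> y (Suc r))"
    using set idx_props(2)[of a] by (simp add: mwt_place_weight S_def)
  have st: "\<psi> y (Suc r) < \<psi> y (Suc s)" if "y < ?n" "r < s" for y r s
    using \<psi> that by (simp add: strictly_rising_def)
  have le: "(\<Sum>r<cnt a y. \<psi> y (Suc r)) \<le> (\<Sum>r\<in>S y. \<psi> y (Suc r))" if y: "y \<in> {1..?n}" for y
  proof (cases "y = ?n")
    case False
    then have "y < ?n" using y by simp
    then show ?thesis
      by (intro sum_mono_subset(1)[OF fin card] less_imp_le[OF st])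
  qed (simp add: top)
  \<comment> \<open>If all these sets were initial segments, they would determine every comparison
    \<open>xs ! r \<le> y\<close> as for \<open>idx a\<close>, and the lists would agree.\<close>
  obtain y where y: "S y \<noteq> {..<cnt a y}"
  proof -
    have "\<exists>y. S y \<noteq> {..<cnt a y}"
    proof (rule ccontr)
      assume "\<nexists>y. S y \<noteq> {..<cnt a y}"
      then have iff: "xs ! r \<le> y \<longleftrightarrow> idx a ! r \<le> y" if "r < length xs" for y r
        using that len positions_le[of a y] by (auto simp: S_def set_eq_iff)
      have "xs = idx a"
        using len iff by (intro nth_equalityI antisym) auto
      then show False using xs(2) by simp
    qed
    then show thesis using that by blast
  qed
  \<comment> \<open>Outside this range the sets are forced to be empty or full, so the strict
    difference occurs where \<open>\<psi>\<close> is known to rise.\<close>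
  have y1: "y \<in> {1..<?n}"
  proof (rule ccontr)
    assume n: "y \<notin> {1..<?n}"
    show False
    proof (cases "y = 0")
      case True
      have "card (S y) = 0" using card[of y] True by simp
      then show False using fin[of y] y True by simp
    next
      case False
      then have "?n \<le> y" using n by simp
      then have "S ?n \<subseteq> S y" by (auto simp: S_def)
      moreover have "S y \<subseteq> {..<cnt a ?n}" by (auto simp: S_def cnt_card len)
      ultimately have "S y = {..<cnt a ?n}" using top by blast
      then show False using card[of y] y by simp
    qed
  qed
  have "(\<Sum>r<cnt a y. \<psi> y (Suc r)) < (\<Sum>r\<in>S y. \<psi> y (Suc r))"
    using y1 by (intro sum_mono_subset(2)[OF fin card _ y] less_imp_le[OF st] st) auto
  then show "profile_weight \<psi> $ a < mwt (place_weight ?n \<psi>) (place_exp xs)"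
    unfolding w w' using y1 le by (intro sum_strict_mono_ex1) auto
qed

abbreviation toric :: "'n::card2 plucker cpoly \<Rightarrow> (nat \<times> nat) cpoly" where
  "toric \<equiv> subst_poly (\<lambda>a. Mon (place_exp (idx a)))"

lemma toric_initial_form:
  fixes p :: "'n::card2 plucker cpoly"
  assumes "strictly_rising CARD('n) \<psi>" "p \<in> plucker_ideal"
  shows "toric (initial_form (profile_weight \<psi>) p) = 0"
proof (cases "p = 0")
  case False
  obtain t where t: "\<And>m. m \<in> Poly_Mapping.keys p \<Longrightarrow> t \<le> weight (profile_weight \<psi>) m"
    "initial_form (profile_weight \<psi>) p = part (\<lambda>m. weight (profile_weight \<psi>) m = t) p"
    using initial_form_eq_part[OF False, where w = "profile_weight \<psi>"] by blast
  have z: "subst_poly plucker_minor p = 0" using assms(2) by (simp add: plucker_ideal_def)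
  show ?thesis
    unfolding t(2) unfolding weight_eq_mwt
    by (rule subst_poly_lowest_part[OF leading_profile_weight[OF assms(1)] z])
      (use t(1) in \<open>simp add: weight_eq_mwt\<close>)
qed simp

section \<open>Quadratic monomials\<close>

abbreviation pr :: "'v \<Rightarrow> 'v \<Rightarrow> 'v \<Rightarrow>\<^sub>0 nat" where
  "pr a b \<equiv> Poly_Mapping.single a (Suc 0) + Poly_Mapping.single b (Suc 0)"

lemma Var_mult_Var: "Var a * Var b = Mon (pr a b)"
  by (simp add: Var_def mult_single)

lemma pr_commute: "pr a b = pr b a"
  by (rule add.commute)

lemma keys_pr: "Poly_Mapping.keys (pr a b) = {a, b}"
  by (auto simp: in_keys_iff lookup_add lookup_single when_def split: if_splits)

lemma pr_eq_iff: "pr a b = pr c d \<longleftrightarrow> a = c \<and> b = d \<or> a = d \<and> b = c"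
proof
  assume eq: "pr a b = pr c d"
  then have "{a, b} = {c, d}" by (metis keys_pr)
  then show "a = c \<and> b = d \<or> a = d \<and> b = c" by (auto simp: doubleton_eq_iff)
qed (auto simp: pr_commute)

lemma mdeg_pr [simp]: "mdeg (pr a b) = 2"
  by (simp add: mdeg_def mwt_add)

lemma weight_pr: "weight w (pr a b) = w $ a + w $ b"
  by (simp add: weight_eq_mwt mwt_add)

definition standard :: "('a::order \<Rightarrow>\<^sub>0 nat) \<Rightarrow> bool" where
  "standard m \<longleftrightarrow> (\<forall>a\<in>Poly_Mapping.keys m. \<forall>b\<in>Poly_Mapping.keys m. a \<le> b \<or> b \<le> a)"

lemma standard_pr: "standard (pr a b) \<longleftrightarrow> a \<le> b \<or> b \<le> a"
  by (auto simp: standard_def keys_pr)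

lemma remove_key:
  assumes "a \<in> Poly_Mapping.keys m"
  obtains m' where "m = Poly_Mapping.single a (Suc 0) + m'"
proof
  show "m = Poly_Mapping.single a (Suc 0) + (m - Poly_Mapping.single a (Suc 0))"
    using assms by (intro poly_mapping_eqI) (auto simp: lookup_add lookup_minus lookup_single when_def in_keys_iff)
qed

lemma mdeg_eq_0: "mdeg m = 0 \<longleftrightarrow> m = 0"
proof
  assume "mdeg m = 0"
  then have "Poly_Mapping.keys m = {}"
    by (auto simp: mdeg_def mwt_def sum_nonneg_eq_0_iff in_keys_iff intro: poly_mapping_eqI)
  then show "m = 0" by simp
qed (simp add: mdeg_def)

lemma standard_degree_2:
  assumes "standard m" "mdeg m = 2"
  obtains c d where "c \<le> d" "m = pr c d"
proof -
  have "m \<noteq> 0" using assms(2) by (auto simp: mdeg_def)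
  then obtain c where "c \<in> Poly_Mapping.keys m" using keys_eq_empty by blast
  then obtain m' where m': "m = Poly_Mapping.single c (Suc 0) + m'" by (rule remove_key)
  then have d: "mdeg m' = 1" using assms(2) by (simp add: mdeg_def mwt_add)
  then have "m' \<noteq> 0" by (auto simp: mdeg_def)
  then obtain d where "d \<in> Poly_Mapping.keys m'" using keys_eq_empty by blast
  then obtain m'' where m'': "m' = Poly_Mapping.single d (Suc 0) + m''" by (rule remove_key)
  then have "mdeg m'' = 0" using d by (simp add: mdeg_def mwt_add)
  then have m: "m = pr c d" using m' m'' by (simp add: mdeg_eq_0)
  then have "c \<le> d \<or> d \<le> c" using assms(1) by (simp add: standard_pr)
  then show thesis using that[of c d] that[of d c] m by (auto simp: pr_commute)
qed

lemma not_standard: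
  assumes "\<not> standard m"
  obtains a b m' where "\<not> a \<le> b" "\<not> b \<le> a" "m = pr a b + m'"
proof -
  obtain a b where ab: "a \<in> Poly_Mapping.keys m" "b \<in> Poly_Mapping.keys m" "\<not> a \<le> b" "\<not> b \<le> a"
    using assms by (auto simp: standard_def)
  obtain m' where m': "m = Poly_Mapping.single a (Suc 0) + m'" using ab(1) by (rule remove_key)
  have "b \<in> Poly_Mapping.keys m'" using ab m' by (auto simp: in_keys_iff lookup_add lookup_single when_def split: if_splits)
  then obtain m'' where "m' = Poly_Mapping.single b (Suc 0) + m''" by (rule remove_key)
  then show thesis using that[of a b m''] ab m' by (simp add: add.assoc)
qed

section \<open>Images of quadratic monomials under the diagonal monomial map\<close>

lemma lookup_place_exp:
  "Poly_Mapping.lookup (place_exp xs) (r, i) = (if 1 \<le> r \<and> r \<le> length xs \<and> xs ! (r - 1) = i then Suc 0 else 0)"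
proof -
  have "Poly_Mapping.lookup (place_exp xs) (r, i) = (\<Sum>k<length xs. if Suc k = r \<and> xs ! k = i then Suc 0 else 0)"
    by (simp add: place_exp_def lookup_sum lookup_single when_def)
  also have "\<dots> = (if 1 \<le> r \<and> r \<le> length xs \<and> xs ! (r - 1) = i then Suc 0 else 0)"
  proof (cases r)
    case (Suc s)
    have "(\<Sum>k<length xs. if Suc k = r \<and> xs ! k = i then Suc 0 else 0) =
        (\<Sum>k<length xs. if k = s then (if xs ! s = i then Suc 0 else 0) else 0)"
      by (rule sum.cong[OF refl]) (simp add: Suc)
    then show ?thesis by (simp add: Suc less_eq_Suc_le)
  qed simp
  finally show ?thesis .
qed

definition texp :: "'n::card2 plucker \<Rightarrow> 'n plucker \<Rightarrow> (nat \<times> nat) \<Rightarrow>\<^sub>0 nat" where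
  "texp a b = place_exp (idx a) + place_exp (idx b)"

lemma toric_pr: "mon_subst (\<lambda>a. Mon (place_exp (idx a))) (pr a b) = Mon (texp a b)"
proof -
  have "mon_subst f (pr a b) = f a * f b" for f :: "'a plucker \<Rightarrow> (nat \<times> nat) cpoly"
    using mon_subst_single[of f a] mon_subst_single[of f b] by (simp add: mon_subst_add)
  then show ?thesis by (simp add: texp_def Mon_add)
qed

text \<open>In every row, the entries of \<open>inf a b\<close> and \<open>sup a b\<close> are the
  minimum and maximum of those of \<open>a\<close> and \<open>b\<close>, hence the same multiset; a
  row present in only one index goes to the meet.\<close>

lemma texp_inf_sup: "texp (inf a b) (sup a b) = texp a b"
proof (rule poly_mapping_eqI)
  fix k :: "nat \<times> nat"
  obtain r i where k: "k = (r, i)" by (cases k)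
  show "Poly_Mapping.lookup (texp (inf a b) (sup a b)) k = Poly_Mapping.lookup (texp a b) k"
  proof (cases "1 \<le> r")
    case True
    then obtain s where s: "r = Suc s" by (cases r) auto
    show ?thesis
      by (auto simp: k s texp_def lookup_add lookup_place_exp inf_plucker.rep_eq sup_plucker.rep_eq
        length_meet_list length_join_list nth_meet_list nth_join_list min_def max_def)
  qed (simp add: k texp_def lookup_add lookup_place_exp)
qed

text \<open>For each \<open>y\<close> the exponent determines how many of the two profiles exceed
  each height \<open>r\<close> at \<open>y\<close>. As the profile of the smaller element is the
  higher one, this separates the two.\<close>

lemma texp_inj:
  fixes c d c' d' :: "'n::card2 plucker"
  assumes "c \<le> d" "c' \<le> d'" and eq: "texp c d = texp c' d'"
  shows "c = c' \<and> d = d'"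
proof -
  have *: "(if r < cnt c y then 1 else 0) + (if r < cnt d y then 1 else 0) =
      (if r < cnt c' y then 1 else (0::real)) + (if r < cnt d' y then 1 else 0)" for r y
  proof -
    \<comment> \<open>Counts the entries at most \<open>y\<close> in row \<open>Suc r\<close>, that
      is, tests whether the profile exceeds \<open>r\<close> at \<open>y\<close>.\<close>
    define B :: "nat \<times> nat \<Rightarrow> real" where "B = (\<lambda>(r', i). if r' = Suc r \<and> i \<le> y then 1 else 0)"
    have "mwt B (place_exp (idx a)) = (if r < cnt a y then 1 else 0)" for a :: "'n plucker"
    proof -
      have "mwt B (place_exp (idx a)) = (\<Sum>k<length (idx a). if k = r then (if idx a ! r \<le> y then 1 else 0) else 0)"
        unfolding mwt_place_exp by (intro sum.cong) (auto simp: B_def)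
      then show ?thesis by (auto simp: sum.delta less_cnt_iff)
    qed
    then show ?thesis using arg_cong[OF eq, of "mwt B"] by (simp add: texp_def mwt_add)
  qed
  have "cnt c y = cnt c' y \<and> cnt d y = cnt d' y" if "y \<le> CARD('n)" for y
  proof -
    have "cnt d y \<le> cnt c y" "cnt d' y \<le> cnt c' y" using assms(1,2) that by (auto simp: less_eq_iff_cnt)
    then show ?thesis
      using *[of "cnt c y" y] *[of "cnt d y" y] *[of "cnt c' y" y] *[of "cnt d' y" y]
      by (auto split: if_splits)
  qed
  then show ?thesis by (auto intro: plucker_eqI_cnt)
qed

text \<open>Monomials go to monomials, so each key of \<open>q\<close> needs a partner with the same
  image. Standard quadratic monomials have distinct images, hence the only possible partners are
  \<open>pr a b\<close> and the monomial of meet and join.\<close>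

lemma toric_kernel_quadratic:
  fixes q :: "'n::card2 plucker cpoly"
  assumes ab: "\<not> a \<le> b" "\<not> b \<le> a"
    and keys: "\<And>k. k \<in> Poly_Mapping.keys q \<Longrightarrow> k = pr a b \<or> standard k \<and> mdeg k = 2"
    and zero: "toric q = 0" and "q \<noteq> 0"
  shows "Poly_Mapping.keys q = {pr a b, pr (inf a b) (sup a b)}"
    "Poly_Mapping.lookup q (pr a b) + Poly_Mapping.lookup q (pr (inf a b) (sup a b)) = 0"
proof -
  let ?m = "mon_subst (\<lambda>a :: 'n plucker. Mon (place_exp (idx a)))"
  \<comment> \<open>The exponent of the image of a monomial; \<open>Epr\<close> shows that it is
    well defined on quadratic ones.\<close>
  define E where "E = (\<lambda>k. THE e. ?m k = Mon e)"
  have Epr: "E (pr c d) = texp c d" for c d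
    unfolding E_def toric_pr by (rule the_equality) (auto dest!: arg_cong[of _ _ Poly_Mapping.keys])
  have key: "?m k = Mon (E k)" if kq: "k \<in> Poly_Mapping.keys q" for k
  proof -
    obtain c d where "k = pr c d" using keys[OF kq] standard_degree_2[of k] by blast
    then show ?thesis by (simp add: Epr toric_pr)
  qed
  have look: "(\<Sum>k\<in>Poly_Mapping.keys q. if E k = e then Poly_Mapping.lookup q k else 0) = 0" for e
  proof -
    have "0 = Poly_Mapping.lookup (toric q) e" using zero by simp
    also have "\<dots> = (\<Sum>k\<in>Poly_Mapping.keys q. Poly_Mapping.lookup (Const (Poly_Mapping.lookup q k) * Mon (E k)) e)"
      by (simp add: subst_poly_keys lookup_sum key)
    also have "\<dots> = (\<Sum>k\<in>Poly_Mapping.keys q. if E k = e then Poly_Mapping.lookup q k else 0)"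
      by (intro sum.cong) (auto simp: lookup_Const_mult lookup_single when_def)
    finally show ?thesis by simp
  qed
  let ?is = "pr (inf a b) (sup a b)"
  have std_is: "standard ?is" by (simp add: standard_pr le_supI1)
  have "\<not> standard (pr a b)" using ab by (simp add: standard_pr)
  then have ne: "pr a b \<noteq> ?is" using std_is by auto
  have inj: "k = k'" if kk: "standard k" "mdeg k = 2" "standard k'" "mdeg k' = 2" "E k = E k'" for k k'
  proof -
    obtain c d where c: "c \<le> d" "k = pr c d" using standard_degree_2[of k] kk(1,2) by blast
    obtain c' d' where c': "c' \<le> d'" "k' = pr c' d'" using standard_degree_2[of k'] kk(3,4) by blast
    have "texp c d = texp c' d'" using kk(5) c(2) c'(2) by (simp only: Epr)
    then show ?thesis using texp_inj[OF c(1) c'(1)] c(2) c'(2) by simp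
  qed
  have other: "\<exists>k'\<in>Poly_Mapping.keys q. k' \<noteq> k \<and> E k' = E k" if k: "k \<in> Poly_Mapping.keys q" for k
  proof (rule ccontr)
    assume "\<not> ?thesis"
    then have "(\<Sum>k'\<in>Poly_Mapping.keys q. if E k' = E k then Poly_Mapping.lookup q k' else 0) =
        (\<Sum>k'\<in>Poly_Mapping.keys q. if k' = k then Poly_Mapping.lookup q k else 0)"
      by (intro sum.cong) auto
    then have "Poly_Mapping.lookup q k = 0" using look[of "E k"] k by simp
    then show False using k by (simp add: in_keys_iff)
  qed
  have Eab: "E (pr a b) = E ?is" by (simp add: Epr texp_inf_sup)
  have A: "?is \<in> Poly_Mapping.keys q" if abq: "pr a b \<in> Poly_Mapping.keys q"
  proof -
    obtain k where k: "k \<in> Poly_Mapping.keys q" "k \<noteq> pr a b" "E k = E (pr a b)" using other[OF abq] by blast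
    have ks: "standard k" "mdeg k = 2" using keys[OF k(1)] k(2) by blast+
    have "k = ?is" by (rule inj[OF ks std_is mdeg_pr trans[OF k(3) Eab]])
    then show ?thesis using k by simp
  qed
  have B: "pr a b \<in> Poly_Mapping.keys q \<and> k = ?is" if k: "k \<in> Poly_Mapping.keys q" "k \<noteq> pr a b" for k
  proof -
    obtain k' where k': "k' \<in> Poly_Mapping.keys q" "k' \<noteq> k" "E k' = E k" using other[OF k(1)] by blast
    have ks: "standard k" "mdeg k = 2" using keys[OF k(1)] k(2) by blast+
    have k'2: "k' = pr a b" using inj[OF _ _ ks k'(3)] keys[OF k'(1)] k'(2) by blast
    have "E k = E ?is" using k'(3) Eab unfolding k'2 by (rule trans[OF sym])
    then have "k = ?is" by (rule inj[OF ks std_is mdeg_pr])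
    then show ?thesis using k'2 k'(1) by simp
  qed
  obtain k where "k \<in> Poly_Mapping.keys q" using \<open>q \<noteq> 0\<close> keys_eq_empty by blast
  then have "pr a b \<in> Poly_Mapping.keys q" using B by blast
  then show eq: "Poly_Mapping.keys q = {pr a b, ?is}" using A B by blast
  show "Poly_Mapping.lookup q (pr a b) + Poly_Mapping.lookup q ?is = 0"
    using look[of "E (pr a b)"] ne Eab by (simp add: eq)
qed

lemma finite_mdeg: "finite {k :: 'v::finite \<Rightarrow>\<^sub>0 nat. mdeg k = t}"
proof -
  define N where "N = nat \<lceil>t\<rceil>"
  have "Poly_Mapping.lookup k v \<le> N" if "mdeg k = t" for k :: "'v \<Rightarrow>\<^sub>0 nat" and v
  proof -
    have "real (Poly_Mapping.lookup k v) \<le> (\<Sum>v\<in>UNIV. real (Poly_Mapping.lookup k v))"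
      by (rule member_le_sum) auto
    also have "\<dots> = t" using that by (simp add: mdeg_def mwt_superset[of UNIV])
    finally show ?thesis unfolding N_def by linarith
  qed
  then have "Poly_Mapping.lookup ` {k :: 'v \<Rightarrow>\<^sub>0 nat. mdeg k = t} \<subseteq> PiE UNIV (\<lambda>_. {..N})" by auto
  moreover have "finite (PiE (UNIV :: 'v set) (\<lambda>_. {..N}))" by (rule finite_PiE) auto
  ultimately have "finite (Poly_Mapping.lookup ` {k :: 'v \<Rightarrow>\<^sub>0 nat. mdeg k = t})" by (rule finite_subset)
  then show ?thesis by (rule finite_imageD) (simp add: inj_on_def poly_mapping.lookup_inject)
qed

section \<open>Straightening\<close>

text \<open>Each rewriting step keeps the degree and strictly increases the weight under
  \<open>w0\<close>, and there are finitely many monomials of one degree: this gives termination.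
  The second weight \<open>w\<close> is merely carried along to record that it never drops.\<close>

lemma straighten_Mon:
  fixes w0 w :: "real ^ 'n::card2 plucker"
  assumes J: "is_ideal J"
    and rel: "\<And>a b. \<not> a \<le> b \<Longrightarrow> \<not> b \<le> a \<Longrightarrow> \<exists>q. Mon (pr a b) - q \<in> J \<and>
      (\<forall>k\<in>Poly_Mapping.keys q. mdeg k = 2 \<and> weight w0 (pr a b) < weight w0 k \<and> weight w (pr a b) \<le> weight w k)"
  shows "\<exists>q. Mon m - q \<in> J \<and> (\<forall>k\<in>Poly_Mapping.keys q. standard k \<and> mdeg k = mdeg m \<and>
    weight w0 m \<le> weight w0 k \<and> weight w m \<le> weight w k)"
proof (induction "card {k. mdeg k = mdeg m \<and> weight w0 m < weight w0 k}" arbitrary: m rule: less_induct)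
  case less
  show ?case
  proof (cases "standard m")
    case True
    then show ?thesis by (intro exI[of _ "Mon m"]) (simp add: ideal_0[OF J])
  next
    case False
    then obtain a b m' where ab: "\<not> a \<le> b" "\<not> b \<le> a" and m: "m = pr a b + m'" by (rule not_standard)
    obtain q where q: "Mon (pr a b) - q \<in> J" and qk: "\<And>k. k \<in> Poly_Mapping.keys q \<Longrightarrow>
        mdeg k = 2 \<and> weight w0 (pr a b) < weight w0 k \<and> weight w (pr a b) \<le> weight w k"
      using rel[OF ab] by blast
    have deg: "mdeg (m' + k) = mdeg m" "weight w0 m < weight w0 (m' + k)" "weight w m \<le> weight w (m' + k)"
      if "k \<in> Poly_Mapping.keys q" for k
      using qk[OF that] mdeg_pr[of a b] by (simp_all add: m mdeg_def weight_eq_mwt mwt_add)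
    have "\<exists>s. Mon (m' + k) - s \<in> J \<and> (\<forall>l\<in>Poly_Mapping.keys s. standard l \<and> mdeg l = mdeg m \<and>
        weight w0 m \<le> weight w0 l \<and> weight w m \<le> weight w l)" if k: "k \<in> Poly_Mapping.keys q" for k
    proof -
      have "{l. mdeg l = mdeg (m' + k) \<and> weight w0 (m' + k) < weight w0 l} \<subset>
          {l. mdeg l = mdeg m \<and> weight w0 m < weight w0 l}"
      proof
        show "{l. mdeg l = mdeg (m' + k) \<and> weight w0 (m' + k) < weight w0 l} \<subseteq>
            {l. mdeg l = mdeg m \<and> weight w0 m < weight w0 l}"
          using deg[OF k] by auto
        have "m' + k \<in> {l. mdeg l = mdeg m \<and> weight w0 m < weight w0 l}" using deg[OF k] by simp
        then show "{l. mdeg l = mdeg (m' + k) \<and> weight w0 (m' + k) < weight w0 l} \<noteq>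
            {l. mdeg l = mdeg m \<and> weight w0 m < weight w0 l}" by blast
      qed
      moreover have "finite {l. mdeg l = mdeg m \<and> weight w0 m < weight w0 l}"
        using finite_mdeg[of "mdeg m"] by (rule finite_subset[rotated]) auto
      ultimately have "card {l. mdeg l = mdeg (m' + k) \<and> weight w0 (m' + k) < weight w0 l} <
          card {l. mdeg l = mdeg m \<and> weight w0 m < weight w0 l}"
        by (intro psubset_card_mono)
      from less(1)[OF this] obtain s where "Mon (m' + k) - s \<in> J"
        "\<forall>l\<in>Poly_Mapping.keys s. standard l \<and> mdeg l = mdeg (m' + k) \<and>
          weight w0 (m' + k) \<le> weight w0 l \<and> weight w (m' + k) \<le> weight w l" by blast
      then show ?thesis using deg[OF k] by (intro exI[of _ s]) fastforce
    qed
    then obtain s where s: "\<And>k. k \<in> Poly_Mapping.keys q \<Longrightarrow> Mon (m' + k) - s k \<in> J"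
      and sk: "\<And>k l. k \<in> Poly_Mapping.keys q \<Longrightarrow> l \<in> Poly_Mapping.keys (s k) \<Longrightarrow> standard l \<and> mdeg l = mdeg m \<and>
        weight w0 m \<le> weight w0 l \<and> weight w m \<le> weight w l" by metis
    define q' where "q' = (\<Sum>k\<in>Poly_Mapping.keys q. Const (Poly_Mapping.lookup q k) * s k)"
    have "Mon m' * (Mon (pr a b) - q) + (\<Sum>k\<in>Poly_Mapping.keys q. Const (Poly_Mapping.lookup q k) * (Mon (m' + k) - s k)) \<in> J"
      by (intro ideal_add[OF J] ideal_Mon[OF J] ideal_sum[OF J] ideal_Const[OF J] q s)
    moreover have "Mon m' * q = (\<Sum>k\<in>Poly_Mapping.keys q. Const (Poly_Mapping.lookup q k) * Mon (m' + k))"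
      by (subst (1) poly_sum_Mon[of q]) (simp add: sum_distrib_left Mon_add mult.left_commute)
    moreover have "Mon m' * Mon (pr a b) = Mon m" by (simp add: m mult_single add_ac)
    ultimately have "Mon m - q' \<in> J"
      by (simp add: right_diff_distrib sum_subtractf q'_def)
    moreover have "standard l \<and> mdeg l = mdeg m \<and> weight w0 m \<le> weight w0 l \<and> weight w m \<le> weight w l"
      if l: "l \<in> Poly_Mapping.keys q'" for l
    proof -
      obtain k where "k \<in> Poly_Mapping.keys q" "l \<in> Poly_Mapping.keys (s k)"
        using l unfolding q'_def by (rule keys_sum_Const_mult)
      then show ?thesis by (rule sk)
    qed
    ultimately show ?thesis by blast
  qed
qed

lemma straighten_poly:
  fixes w0 w :: "real ^ 'n::card2 plucker"
  assumes J: "is_ideal J"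
    and rel: "\<And>a b. \<not> a \<le> b \<Longrightarrow> \<not> b \<le> a \<Longrightarrow> \<exists>q. Mon (pr a b) - q \<in> J \<and>
      (\<forall>k\<in>Poly_Mapping.keys q. mdeg k = 2 \<and> weight w0 (pr a b) < weight w0 k \<and> weight w (pr a b) \<le> weight w k)"
  obtains s where "p - s \<in> J" "\<And>k. k \<in> Poly_Mapping.keys s \<Longrightarrow> standard k \<and>
    (\<exists>m\<in>Poly_Mapping.keys p. mdeg k = mdeg m \<and> weight w0 m \<le> weight w0 k \<and> weight w m \<le> weight w k)"
proof -
  obtain s where s: "\<And>m. Mon m - s m \<in> J" and sk: "\<And>m k. k \<in> Poly_Mapping.keys (s m) \<Longrightarrow>
      standard k \<and> mdeg k = mdeg m \<and> weight w0 m \<le> weight w0 k \<and> weight w m \<le> weight w k"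
    using straighten_Mon[OF assms] by metis
  define s' where "s' = (\<Sum>m\<in>Poly_Mapping.keys p. Const (Poly_Mapping.lookup p m) * s m)"
  have "(\<Sum>m\<in>Poly_Mapping.keys p. Const (Poly_Mapping.lookup p m) * (Mon m - s m)) \<in> J"
    by (intro ideal_sum[OF J] ideal_Const[OF J] s)
  moreover have "(\<Sum>m\<in>Poly_Mapping.keys p. Const (Poly_Mapping.lookup p m) * (Mon m - s m)) = p - s'"
    using poly_sum_Mon[of p] by (simp add: right_diff_distrib sum_subtractf s'_def)
  ultimately have "p - s' \<in> J" by simp
  moreover have "standard k \<and> (\<exists>m\<in>Poly_Mapping.keys p. mdeg k = mdeg m \<and> weight w0 m \<le> weight w0 k \<and> weight w m \<le> weight w k)"
    if k: "k \<in> Poly_Mapping.keys s'" for k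
  proof -
    obtain m where "m \<in> Poly_Mapping.keys p" "k \<in> Poly_Mapping.keys (s m)"
      using k unfolding s'_def by (rule keys_sum_Const_mult)
    then show ?thesis using sk by blast
  qed
  ultimately show thesis by (rule that)
qed

text \<open>Multiples of nonstandard monomials are nonstandard, so the polynomials without standard
  terms form an ideal containing the generators.\<close>

lemma keys_monomial_ideal:
  assumes "p \<in> monomial_ideal" "k \<in> Poly_Mapping.keys p"
  shows "\<not> standard k"
proof -
  let ?J = "{p :: 'a plucker cpoly. \<forall>k\<in>Poly_Mapping.keys p. \<not> standard k}"
  have mono: "\<not> standard (m + k)" if "\<not> standard k" for m k :: "'a plucker \<Rightarrow>\<^sub>0 nat"
  proof -
    have "Poly_Mapping.keys k \<subseteq> Poly_Mapping.keys (m + k)" by (auto simp: in_keys_iff lookup_add)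
    then show ?thesis using that unfolding standard_def by blast
  qed
  have "is_ideal ?J"
    unfolding is_ideal_def
  proof (intro conjI ballI allI)
    fix p q assume "p \<in> ?J" "q \<in> ?J"
    then show "p + q \<in> ?J" using Poly_Mapping.keys_add[of p q] by blast
  next
    fix c p assume "p \<in> ?J"
    then show "Const c * p \<in> ?J" using keys_Const_mult[of c p] by blast
  next
    fix m p assume "p \<in> ?J"
    then show "Mon m * p \<in> ?J" using mono by (auto simp: keys_Mon_mult)
  qed simp
  moreover have "{Var a * Var b | a b :: 'a plucker. \<not> a \<le> b \<and> \<not> b \<le> a} \<subseteq> ?J"
    by (auto simp: Var_mult_Var standard_pr)
  ultimately show ?thesis using assms ideal_generated_minimal unfolding monomial_ideal_def by blast
qed

lemma Mon_in_monomial_ideal: "\<not> standard m \<Longrightarrow> Mon m \<in> monomial_ideal"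
proof -
  assume "\<not> standard m"
  then obtain a b m' where ab: "\<not> a \<le> b" "\<not> b \<le> a" "m = pr a b + m'" by (rule not_standard)
  have "Mon (pr a b) \<in> monomial_ideal"
    unfolding monomial_ideal_def using ab(1,2) Var_mult_Var[of a b]
    by (intro ideal_generated_base CollectI exI[of _ a] exI[of _ b]) simp
  then have "Mon m' * Mon (pr a b) \<in> monomial_ideal"
    unfolding monomial_ideal_def by (intro ideal_Mon[OF is_ideal_ideal_generated])
  then show ?thesis by (simp add: ab(3) mult_single add_ac)
qed

text \<open>The last assumption is the linear independence of the standard monomials modulo the
  ideal. It makes \<open>nf a b\<close> the normal form of the product of two incomparable
  variables.\<close>

locale plucker_straightening =
  fixes w0 :: "real ^ 'n::card2 plucker" and nf :: "'n plucker \<Rightarrow> 'n plucker \<Rightarrow> 'n plucker cpoly"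
  assumes nf_ideal: "\<And>a b. \<not> a \<le> b \<Longrightarrow> \<not> b \<le> a \<Longrightarrow> Mon (pr a b) - nf a b \<in> plucker_ideal"
    and nf_keys: "\<And>a b k. \<not> a \<le> b \<Longrightarrow> \<not> b \<le> a \<Longrightarrow> k \<in> Poly_Mapping.keys (nf a b) \<Longrightarrow>
      standard k \<and> mdeg k = 2 \<and> weight w0 (pr a b) < weight w0 k"
    and standard_in_ideal: "\<And>p :: 'n plucker cpoly. p \<in> plucker_ideal \<Longrightarrow> (\<And>k. k \<in> Poly_Mapping.keys p \<Longrightarrow> standard k) \<Longrightarrow> p = 0"

text \<open>A nonzero element of the ideal has its initial form in the monomial ideal, hence a
  nonstandard term. Conversely each incomparable product is an initial term, which lifts to a
  rewriting rule that strictly raises the weight.\<close>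

lemma ex_plucker_straightening:
  fixes w0 :: "real ^ 'n::card2 plucker"
  assumes w0: "initial_ideal w0 plucker_ideal = monomial_ideal"
  obtains nf where "plucker_straightening w0 nf"
proof -
  have zero: "p = 0" if p: "p \<in> plucker_ideal" "\<And>k. k \<in> Poly_Mapping.keys p \<Longrightarrow> standard k" for p :: "'n plucker cpoly"
  proof (rule ccontr)
    assume "p \<noteq> 0"
    then have "initial_form w0 p \<noteq> 0" using initial_form_eq_part[of p, where w = w0] by blast
    then obtain k where k: "k \<in> Poly_Mapping.keys (initial_form w0 p)" using keys_eq_empty by blast
    have "initial_form w0 p \<in> monomial_ideal" using initial_ideal_base[OF p(1)] w0 by blast
    then have "\<not> standard k" using k by (rule keys_monomial_ideal)
    moreover have "k \<in> Poly_Mapping.keys p" using k keys_initial_form by blast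
    ultimately show False using p(2) by blast
  qed
  have rel: "\<exists>q. Mon (pr a b) - q \<in> plucker_ideal \<and>
      (\<forall>k\<in>Poly_Mapping.keys q. mdeg k = 2 \<and> weight w0 (pr a b) < weight w0 k)"
    if ab: "\<not> a \<le> b" "\<not> b \<le> a" for a b :: "'n plucker"
  proof -
    have "Mon (pr a b) \<in> initial_ideal w0 plucker_ideal"
      unfolding w0 using ab by (intro Mon_in_monomial_ideal) (simp add: standard_pr)
    then obtain p where p: "p \<in> plucker_ideal" "\<And>m. m \<in> Poly_Mapping.keys p \<Longrightarrow> weight w0 (pr a b) \<le> weight w0 m"
      "part (\<lambda>m. weight w0 m = weight w0 (pr a b)) p = part (\<lambda>m. weight w0 m = weight w0 (pr a b)) (Mon (pr a b))"
      using initial_ideal_part[OF is_ideal_plucker] by blast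
    \<comment> \<open>The lift need not be homogeneous; as the ideal is graded, its quadratic part
      is still in the ideal and still contains \<open>pr a b\<close> with coefficient 1.\<close>
    define p' where "p' = part (\<lambda>m. mdeg m = 2) p"
    have p'I: "p' \<in> plucker_ideal" unfolding p'_def by (rule plucker_ideal_degree_part[OF p(1)])
    define q where "q = Mon (pr a b) - p'"
    have "mdeg k = 2 \<and> weight w0 (pr a b) < weight w0 k" if k: "k \<in> Poly_Mapping.keys q" for k
    proof -
      have "k \<noteq> pr a b"
      proof
        assume "k = pr a b"
        moreover have "Poly_Mapping.lookup p (pr a b) = 1"
          using arg_cong[OF p(3), of "\<lambda>f. Poly_Mapping.lookup f (pr a b)"] by (simp add: lookup_part)
        ultimately show False using k by (simp add: q_def p'_def in_keys_iff lookup_minus lookup_part)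
      qed
      then have kp: "k \<in> Poly_Mapping.keys p'" using k
        by (auto simp: q_def in_keys_iff lookup_minus lookup_single when_def)
      then have k2: "k \<in> Poly_Mapping.keys p" "mdeg k = 2" by (auto simp: p'_def keys_part)
      have "weight w0 k \<noteq> weight w0 (pr a b)"
      proof
        assume "weight w0 k = weight w0 (pr a b)"
        then have "Poly_Mapping.lookup p k = 0"
          using arg_cong[OF p(3), of "\<lambda>f. Poly_Mapping.lookup f k"] \<open>k \<noteq> pr a b\<close>
          by (simp add: lookup_part lookup_single when_def)
        then show False using k2(1) by (simp add: in_keys_iff)
      qed
      then show ?thesis using p(2)[OF k2(1)] k2(2) by simp
    qed
    moreover have "Mon (pr a b) - q \<in> plucker_ideal" using p'I by (simp add: q_def)
    ultimately show ?thesis by blast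
  qed
  have "\<exists>s. Mon (pr a b) - s \<in> plucker_ideal \<and> (\<forall>k\<in>Poly_Mapping.keys s. standard k \<and> mdeg k = 2 \<and> weight w0 (pr a b) < weight w0 k)"
    if ab: "\<not> a \<le> b" "\<not> b \<le> a" for a b :: "'n plucker"
  proof -
    obtain q where q: "Mon (pr a b) - q \<in> plucker_ideal"
      "\<And>k. k \<in> Poly_Mapping.keys q \<Longrightarrow> mdeg k = 2 \<and> weight w0 (pr a b) < weight w0 k"
      using rel[OF ab] by blast
    have rel': "\<exists>q. Mon (pr a b) - q \<in> plucker_ideal \<and> (\<forall>k\<in>Poly_Mapping.keys q.
        mdeg k = 2 \<and> weight w0 (pr a b) < weight w0 k \<and> weight w0 (pr a b) \<le> weight w0 k)"
      if "\<not> a \<le> b" "\<not> b \<le> a" for a b :: "'n plucker"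
      using rel[OF that] less_imp_le by blast
    \<comment> \<open>The first rule may produce nonstandard monomials; straightening its right-hand
      side removes them and keeps the strict gain in weight.\<close>
    obtain s where s: "q - s \<in> plucker_ideal" "\<And>k. k \<in> Poly_Mapping.keys s \<Longrightarrow> standard k \<and>
        (\<exists>m\<in>Poly_Mapping.keys q. mdeg k = mdeg m \<and> weight w0 m \<le> weight w0 k \<and> weight w0 m \<le> weight w0 k)"
      using straighten_poly[OF is_ideal_plucker rel', of q] by blast
    have "Mon (pr a b) - s \<in> plucker_ideal"
      using ideal_add[OF is_ideal_plucker q(1) s(1)] by simp
    moreover have "standard k \<and> mdeg k = 2 \<and> weight w0 (pr a b) < weight w0 k" if "k \<in> Poly_Mapping.keys s" for k
      using s(2)[OF that] q(2) by fastforce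
    ultimately show ?thesis by blast
  qed
  then obtain nf where nf: "\<And>a b. \<not> a \<le> b \<Longrightarrow> \<not> b \<le> a \<Longrightarrow> Mon (pr a b) - nf a b \<in> plucker_ideal \<and>
      (\<forall>k\<in>Poly_Mapping.keys (nf a b). standard k \<and> mdeg k = 2 \<and> weight w0 (pr a b) < weight w0 k)"
    by metis
  have "plucker_straightening w0 nf"
    by unfold_locales (use nf zero in blast)+
  then show thesis by (rule that)
qed

section \<open>The two Groebner cones\<close>

context plucker_straightening
begin

text \<open>The inequality description of the closure of the first Groebner cone, as shown by
  \<open>groebner_cone_monomial\<close> and \<open>closure_strict_cone\<close>.\<close>

definition straightening_cone :: "(real ^ 'n plucker) set" where
  "straightening_cone = {w. \<forall>a b. \<not> a \<le> b \<longrightarrow> \<not> b \<le> a \<longrightarrow>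
     (\<forall>k\<in>Poly_Mapping.keys (nf a b). weight w (pr a b) \<le> weight w k)}"

lemma straightening_coneD:
  "w \<in> straightening_cone \<Longrightarrow> \<not> a \<le> b \<Longrightarrow> \<not> b \<le> a \<Longrightarrow> k \<in> Poly_Mapping.keys (nf a b) \<Longrightarrow>
    weight w (pr a b) \<le> weight w k"
  by (simp add: straightening_cone_def)

text \<open>Straightening terminates because of \<open>w0\<close>; membership of \<open>w\<close> in
  the cone ensures that no rewriting step produces a monomial of smaller
  \<open>w\<close>-weight.\<close>

lemma reduce:
  assumes "w \<in> straightening_cone"
  obtains s where "p - s \<in> plucker_ideal" "\<And>k. k \<in> Poly_Mapping.keys s \<Longrightarrow> standard k \<and>
    (\<exists>m\<in>Poly_Mapping.keys p. weight w m \<le> weight w k)"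
proof -
  have rel: "\<exists>q. Mon (pr a b) - q \<in> plucker_ideal \<and> (\<forall>k\<in>Poly_Mapping.keys q.
      mdeg k = 2 \<and> weight w0 (pr a b) < weight w0 k \<and> weight w (pr a b) \<le> weight w k)"
    if "\<not> a \<le> b" "\<not> b \<le> a" for a b :: "'n plucker"
    using nf_ideal[OF that] nf_keys[OF that] straightening_coneD[OF assms that] by (intro exI[of _ "nf a b"]) blast
  obtain s where "p - s \<in> plucker_ideal" "\<And>k. k \<in> Poly_Mapping.keys s \<Longrightarrow> standard k \<and>
      (\<exists>m\<in>Poly_Mapping.keys p. mdeg k = mdeg m \<and> weight w0 m \<le> weight w0 k \<and> weight w m \<le> weight w k)"
    using straighten_poly[OF is_ideal_plucker rel, of p] by blast
  then show thesis by (intro that[of s]) blast+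
qed

text \<open>A standard polynomial in the initial ideal would lift to a standard element of the ideal,
  because reducing the higher terms does not lower their weights.\<close>

lemma standard_in_initial_ideal:
  assumes w: "w \<in> straightening_cone" and q: "q \<in> initial_ideal w plucker_ideal"
    and std: "\<And>k. k \<in> Poly_Mapping.keys q \<Longrightarrow> standard k"
  shows "q = 0"
proof (rule ccontr)
  assume "q \<noteq> 0"
  then obtain k where k: "k \<in> Poly_Mapping.keys q" using keys_eq_empty by blast
  define t where "t = weight w k"
  let ?P = "part (\<lambda>m. weight w m = t)"
  obtain p where p: "p \<in> plucker_ideal" "\<And>m. m \<in> Poly_Mapping.keys p \<Longrightarrow> t \<le> weight w m" "?P p = ?P q"
    using initial_ideal_part[OF is_ideal_plucker q] by blast
  have h: "t < weight w m" if "m \<in> Poly_Mapping.keys (p - ?P q)" for m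
  proof -
    have "m \<in> Poly_Mapping.keys p \<and> weight w m \<noteq> t"
      using that unfolding p(3)[symmetric] by (auto simp: in_keys_iff lookup_minus lookup_part split: if_splits)
    then show ?thesis using p(2)[of m] by simp
  qed
  obtain s where s: "p - ?P q - s \<in> plucker_ideal" and sk: "\<And>k. k \<in> Poly_Mapping.keys s \<Longrightarrow> standard k \<and>
      (\<exists>m\<in>Poly_Mapping.keys (p - ?P q). weight w m \<le> weight w k)"
    using reduce[OF w, of "p - ?P q"] by blast
  have "p - (p - ?P q - s) \<in> plucker_ideal" by (rule ideal_diff[OF is_ideal_plucker p(1) s])
  then have "?P q + s \<in> plucker_ideal" by (simp add: algebra_simps)
  moreover have "standard m" if "m \<in> Poly_Mapping.keys (?P q + s)" for m
  proof -
    have "m \<in> Poly_Mapping.keys (?P q) \<or> m \<in> Poly_Mapping.keys s"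
      using that Poly_Mapping.keys_add[of "?P q" s] by blast
    then show ?thesis using std[of m] sk[of m] by (auto simp: keys_part)
  qed
  ultimately have "?P q + s = 0" by (rule standard_in_ideal)
  then have "Poly_Mapping.lookup (?P q + s) k = 0" by simp
  then have "Poly_Mapping.lookup q k + Poly_Mapping.lookup s k = 0"
    by (simp add: lookup_add lookup_part t_def)
  moreover have "k \<notin> Poly_Mapping.keys s" using sk[of k] h by (fastforce simp: t_def)
  ultimately show False using k by (simp add: in_keys_iff)
qed

text \<open>Standard monomials are independent modulo the initial ideal by
  \<open>standard_in_initial_ideal\<close>. If they already span modulo the smaller ideal
  \<open>J\<close>, nothing is left between the two.\<close>

lemma initial_ideal_eqI:
  assumes w: "w \<in> straightening_cone" and J: "J \<subseteq> initial_ideal w plucker_ideal"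
    and red: "\<And>p. \<exists>s. p - s \<in> J \<and> (\<forall>k\<in>Poly_Mapping.keys s. standard k)"
  shows "initial_ideal w plucker_ideal = J"
proof (intro equalityI J subsetI)
  note ideal = is_ideal_initial_ideal[OF is_ideal_plucker]
  fix p assume p: "p \<in> initial_ideal w plucker_ideal"
  obtain s where s: "p - s \<in> J" "\<forall>k\<in>Poly_Mapping.keys s. standard k" using red by blast
  have "p - (p - s) \<in> initial_ideal w plucker_ideal"
    by (rule ideal_diff[OF ideal p subsetD[OF J s(1)]])
  then have s': "s \<in> initial_ideal w plucker_ideal" by simp
  have "s = 0" by (rule standard_in_initial_ideal[OF w s']) (use s(2) in blast)
  then show "p \<in> J" using s(1) by simp
qed

definition relation :: "'n plucker \<Rightarrow> 'n plucker \<Rightarrow> 'n plucker cpoly" where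
  "relation a b = Mon (pr a b) - nf a b"

context
  fixes a b :: "'n plucker"
  assumes ab: "\<not> a \<le> b" "\<not> b \<le> a"
begin

lemma not_standard_pr: "\<not> standard (pr a b)"
  using ab by (simp add: standard_pr)

lemma lookup_nf_pr: "Poly_Mapping.lookup (nf a b) (pr a b) = 0"
  using nf_keys[OF ab, of "pr a b"] not_standard_pr by (auto simp: in_keys_iff)

lemma lookup_relation_pr: "Poly_Mapping.lookup (relation a b) (pr a b) = 1"
  by (simp add: relation_def lookup_minus lookup_nf_pr)

lemma lookup_relation: "k \<noteq> pr a b \<Longrightarrow> Poly_Mapping.lookup (relation a b) k = - Poly_Mapping.lookup (nf a b) k"
  by (auto simp: relation_def lookup_minus lookup_single when_def)

lemma keys_relation: "Poly_Mapping.keys (relation a b) = insert (pr a b) (Poly_Mapping.keys (nf a b))"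
proof -
  have "k \<in> Poly_Mapping.keys (relation a b) \<longleftrightarrow> k \<in> insert (pr a b) (Poly_Mapping.keys (nf a b))" for k
    by (cases "k = pr a b") (simp_all add: in_keys_iff lookup_relation_pr lookup_relation)
  then show ?thesis by blast
qed

lemma relation_in_ideal: "relation a b \<in> plucker_ideal"
  using nf_ideal[OF ab] by (simp add: relation_def)

lemma initial_relation_nonzero: "initial_form w (relation a b) \<noteq> 0"
proof -
  have "relation a b \<noteq> 0" using keys_relation by auto
  then show ?thesis using initial_form_eq_part[of "relation a b", where w = w] by blast
qed

lemma keys_initial_relation:
  assumes "k \<in> Poly_Mapping.keys (initial_form w (relation a b))"
  shows "k = pr a b \<or> standard k \<and> mdeg k = 2"
  using assms keys_initial_form[of w "relation a b"] nf_keys[OF ab, of k] by (auto simp: keys_relation)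

text \<open>The initial form is nonzero and has only \<open>pr a b\<close> and standard quadratic
  keys, so \<open>toric_kernel_quadratic\<close> leaves exactly the Hibi binomial; all other terms
  of the relation must be heavier.\<close>

lemma toric_initial_relation:
  assumes "toric (initial_form w (relation a b)) = 0"
  shows "Poly_Mapping.lookup (nf a b) (pr (inf a b) (sup a b)) = 1"
    "weight w (pr a b) = weight w (pr (inf a b) (sup a b))"
    "\<And>k. k \<in> Poly_Mapping.keys (nf a b) \<Longrightarrow> k \<noteq> pr (inf a b) (sup a b) \<Longrightarrow> weight w (pr a b) < weight w k"
proof -
  let ?q = "initial_form w (relation a b)" and ?is = "pr (inf a b) (sup a b)"
  note q = toric_kernel_quadratic[OF ab keys_initial_relation[of _ w] assms initial_relation_nonzero]
  have min: "weight w m \<le> weight w k" if mk: "m \<in> Poly_Mapping.keys ?q" "k \<in> Poly_Mapping.keys (relation a b)" for m k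
    using mk by (simp add: in_keys_initial_form_iff)
  have is_std: "standard ?is" by (simp add: standard_pr le_supI1)
  then have ne: "?is \<noteq> pr a b" using not_standard_pr by auto
  have abq: "pr a b \<in> Poly_Mapping.keys ?q" and isq: "?is \<in> Poly_Mapping.keys ?q" using q(1) by auto
  have look: "Poly_Mapping.lookup ?q k = Poly_Mapping.lookup (relation a b) k" if "k \<in> Poly_Mapping.keys ?q" for k
    using that by (auto simp: in_keys_iff[of k ?q] lookup_initial_form split: if_splits)
  show "Poly_Mapping.lookup (nf a b) ?is = 1"
    using q(2) look[OF abq] look[OF isq] lookup_relation[OF ne] lookup_relation_pr by simp
  have keyq: "k \<in> Poly_Mapping.keys (relation a b)" if "k \<in> Poly_Mapping.keys ?q" for k
    using that keys_initial_form by blast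
  show eq: "weight w (pr a b) = weight w ?is"
    using min[OF abq keyq[OF isq]] min[OF isq keyq[OF abq]] by simp
  fix k assume k: "k \<in> Poly_Mapping.keys (nf a b)" "k \<noteq> ?is"
  have kr: "k \<in> Poly_Mapping.keys (relation a b)" using k(1) by (simp add: keys_relation)
  have "k \<noteq> pr a b" using nf_keys[OF ab k(1)] not_standard_pr by auto
  then have "k \<notin> Poly_Mapping.keys ?q" using q(1) k(2) by simp
  then have "\<not> (\<forall>m'\<in>Poly_Mapping.keys (relation a b). weight w k \<le> weight w m')"
    using kr by (simp add: in_keys_initial_form_iff)
  then obtain m' where "m' \<in> Poly_Mapping.keys (relation a b)" "weight w m' < weight w k" by (auto simp: not_le)
  then show "weight w (pr a b) < weight w k" using min[OF abq, of m'] by simp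
qed

end

lemma toric_initial_relation_profile:
  assumes "\<not> a \<le> b" "\<not> b \<le> a" "strictly_rising CARD('n) \<psi>"
  shows "toric (initial_form (profile_weight \<psi>) (relation a b)) = 0"
  by (rule toric_initial_form[OF assms(3) relation_in_ideal[OF assms(1,2)]])

lemma lookup_nf_inf_sup:
  assumes ab: "\<not> a \<le> b" "\<not> b \<le> a"
  shows "Poly_Mapping.lookup (nf a b) (pr (inf a b) (sup a b)) = 1"
proof -
  \<comment> \<open>Any strictly rising \<open>\<psi>\<close> would do: the coefficient does not
    depend on the weight used to compute it.\<close>
  have "strictly_rising CARD('n) (\<lambda>y s. real s)" by (simp add: strictly_rising_def)
  then show ?thesis by (rule toric_initial_relation(1)[OF ab toric_initial_relation_profile[OF ab]])
qed

lemma inf_sup_in_keys_nf: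
  "\<not> a \<le> b \<Longrightarrow> \<not> b \<le> a \<Longrightarrow> pr (inf a b) (sup a b) \<in> Poly_Mapping.keys (nf a b)"
  by (simp add: in_keys_iff lookup_nf_inf_sup)

definition toric_cone :: "(real ^ 'n plucker) set" where
  "toric_cone = {w. \<forall>a b. \<not> a \<le> b \<longrightarrow> \<not> b \<le> a \<longrightarrow> weight w (pr a b) = weight w (pr (inf a b) (sup a b)) \<and>
     (\<forall>k\<in>Poly_Mapping.keys (nf a b). k \<noteq> pr (inf a b) (sup a b) \<longrightarrow> weight w (pr a b) < weight w k)}"

lemma toric_coneD:
  assumes "w \<in> toric_cone" "\<not> a \<le> b" "\<not> b \<le> a"
  shows "weight w (pr a b) = weight w (pr (inf a b) (sup a b))"
    "\<And>k. k \<in> Poly_Mapping.keys (nf a b) \<Longrightarrow> k \<noteq> pr (inf a b) (sup a b) \<Longrightarrow> weight w (pr a b) < weight w k"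
  using assms unfolding toric_cone_def by blast+

lemma toric_coneI:
  assumes "\<And>a b. \<not> a \<le> b \<Longrightarrow> \<not> b \<le> a \<Longrightarrow> toric (initial_form w (relation a b)) = 0"
  shows "w \<in> toric_cone"
  unfolding toric_cone_def using toric_initial_relation(2,3) assms by blast

lemma profile_weight_in_toric_cone: "strictly_rising CARD('n) \<psi> \<Longrightarrow> profile_weight \<psi> \<in> toric_cone"
  by (intro toric_coneI toric_initial_relation_profile)

lemma toric_cone_subset: "toric_cone \<subseteq> straightening_cone"
proof
  fix w assume w: "w \<in> toric_cone"
  have "weight w (pr a b) \<le> weight w k" if "\<not> a \<le> b" "\<not> b \<le> a" "k \<in> Poly_Mapping.keys (nf a b)" for a b k
  proof (cases "k = pr (inf a b) (sup a b)")
    case True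
    show ?thesis using toric_coneD(1)[OF w that(1,2)] True by simp
  next
    case False
    show ?thesis using toric_coneD(2)[OF w that False] by simp
  qed
  then show "w \<in> straightening_cone" by (simp add: straightening_cone_def)
qed

definition strict_cone :: "(real ^ 'n plucker) set" where
  "strict_cone = {w. \<forall>a b. \<not> a \<le> b \<longrightarrow> \<not> b \<le> a \<longrightarrow>
     (\<forall>k\<in>Poly_Mapping.keys (nf a b). weight w (pr a b) < weight w k)}"

text \<open>If the initial ideal is monomial, the initial form of each relation has no standard
  term, so \<open>pr a b\<close> alone attains the minimum. Conversely strict inequalities put all
  generators into the initial ideal, and \<open>initial_ideal_eqI\<close> applies.\<close>

lemma groebner_cone_monomial: "groebner_cone plucker_ideal monomial_ideal = strict_cone"
proof (intro equalityI subsetI)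
  fix w :: "real ^ 'n plucker" assume "w \<in> groebner_cone plucker_ideal monomial_ideal"
  then have w: "initial_ideal w plucker_ideal = monomial_ideal" by (simp add: groebner_cone_def)
  have "weight w (pr a b) < weight w k"
    if ab: "\<not> a \<le> b" "\<not> b \<le> a" and k: "k \<in> Poly_Mapping.keys (nf a b)" for a b k
  proof -
    let ?q = "initial_form w (relation a b)"
    have qm: "?q \<in> monomial_ideal"
      using initial_ideal_base[OF relation_in_ideal[OF ab], of w] w by simp
    have keys: "l = pr a b" if "l \<in> Poly_Mapping.keys ?q" for l
      using keys_monomial_ideal[OF qm that] keys_initial_relation[OF ab that] by blast
    have "pr a b \<in> Poly_Mapping.keys ?q"
      using initial_relation_nonzero[OF ab, of w] keys keys_eq_empty by blast
    then have le: "weight w (pr a b) \<le> weight w l" if "l \<in> Poly_Mapping.keys (relation a b)" for l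
      using that by (simp add: in_keys_initial_form_iff)
    have kr: "k \<in> Poly_Mapping.keys (relation a b)" using k by (simp add: keys_relation[OF ab])
    have "k \<noteq> pr a b" using nf_keys[OF ab k] not_standard_pr[OF ab] by auto
    then have "k \<notin> Poly_Mapping.keys ?q" using keys by blast
    then have "\<not> (\<forall>m'\<in>Poly_Mapping.keys (relation a b). weight w k \<le> weight w m')"
      using kr by (simp add: in_keys_initial_form_iff)
    then show ?thesis using le by fastforce
  qed
  then show "w \<in> strict_cone" by (simp add: strict_cone_def)
next
  fix w assume w: "w \<in> strict_cone"
  then have wK: "w \<in> straightening_cone" by (auto simp: strict_cone_def straightening_cone_def intro: less_imp_le)
  have "initial_ideal w plucker_ideal = monomial_ideal"
  proof (rule initial_ideal_eqI[OF wK])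
    have "Mon (pr a b) \<in> initial_ideal w plucker_ideal" if ab: "\<not> a \<le> b" "\<not> b \<le> a" for a b
    proof -
      have "part (\<lambda>m. weight w m = weight w (pr a b)) (relation a b) = Mon (pr a b)"
      proof (rule poly_mapping_eqI)
        fix k
        have "weight w k \<noteq> weight w (pr a b)" if "k \<in> Poly_Mapping.keys (nf a b)"
          using w ab that by (fastforce simp: strict_cone_def)
        then show "Poly_Mapping.lookup (part (\<lambda>m. weight w m = weight w (pr a b)) (relation a b)) k =
            Poly_Mapping.lookup (Mon (pr a b)) k"
          by (cases "k = pr a b")
            (auto simp: lookup_part lookup_relation_pr[OF ab] lookup_relation[OF ab] lookup_single when_def in_keys_iff)
      qed
      moreover have "weight w (pr a b) \<le> weight w m" if "m \<in> Poly_Mapping.keys (relation a b)" for m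
        using that straightening_coneD[OF wK ab] by (auto simp: keys_relation[OF ab])
      ultimately have "initial_form w (relation a b) = Mon (pr a b)"
        by (subst initial_form_eqI[of _ "weight w (pr a b)"]) (auto dest: arg_cong[of _ _ Poly_Mapping.keys])
      then show ?thesis using initial_ideal_base[OF relation_in_ideal[OF ab], of w] by simp
    qed
    then show "monomial_ideal \<subseteq> initial_ideal w plucker_ideal"
      unfolding monomial_ideal_def
      by (intro ideal_generated_minimal is_ideal_initial_ideal is_ideal_plucker) (auto simp: Var_mult_Var)
    fix p :: "'n plucker cpoly"
    let ?s = "part standard p"
    have "p - ?s = (\<Sum>m\<in>Poly_Mapping.keys (p - ?s). Const (Poly_Mapping.lookup (p - ?s) m) * Mon m)"
      by (rule poly_sum_Mon)
    also have "\<dots> \<in> monomial_ideal"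
    proof -
      have I: "is_ideal (monomial_ideal :: 'n plucker cpoly set)"
        unfolding monomial_ideal_def by (rule is_ideal_ideal_generated)
      have "\<not> standard m" if "m \<in> Poly_Mapping.keys (p - ?s)" for m
        using that by (auto simp: in_keys_iff lookup_minus lookup_part)
      then show ?thesis by (intro ideal_sum[OF I] ideal_Const[OF I] Mon_in_monomial_ideal)
    qed
    finally have "p - ?s \<in> monomial_ideal" .
    then show "\<exists>s. p - s \<in> monomial_ideal \<and> (\<forall>k\<in>Poly_Mapping.keys s. standard k)"
      by (intro exI[of _ ?s]) (simp add: keys_part)
  qed
  then show "w \<in> groebner_cone plucker_ideal monomial_ideal" by (simp add: groebner_cone_def)
qed

lemma hibi_ideal_subset_toric: "hibi_ideal \<subseteq> {p :: 'n plucker cpoly. toric p = 0}"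
  unfolding hibi_ideal_def
proof (rule ideal_generated_minimal[OF is_ideal_kernel], clarify)
  fix a b :: "'n plucker"
  have "texp (sup a b) (inf a b) = texp a b"
    using texp_inf_sup[of a b] by (simp add: texp_def add.commute)
  then show "toric (Var a * Var b - Var (sup a b) * Var (inf a b)) = 0"
    by (simp add: Var_mult_Var subst_poly_diff toric_pr)
qed

lemma hibi_relation: "Mon (pr a b) - Mon (pr (inf a b) (sup a b)) \<in> hibi_ideal"
  unfolding hibi_ideal_def
  by (intro ideal_generated_base CollectI exI[of _ a] exI[of _ b]) (simp add: Var_mult_Var pr_commute)

text \<open>One inclusion holds because Hibi relations vanish under \<open>toric\<close>. For the
  other, the conditions of \<open>toric_cone\<close> make the initial form of each relation a Hibi
  binomial, and these suffice to straighten.\<close>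

lemma groebner_cone_hibi: "groebner_cone plucker_ideal hibi_ideal = toric_cone"
proof (intro equalityI subsetI)
  fix w :: "real ^ 'n plucker" assume "w \<in> groebner_cone plucker_ideal hibi_ideal"
  then have w: "initial_ideal w plucker_ideal = hibi_ideal" by (simp add: groebner_cone_def)
  show "w \<in> toric_cone"
  proof (rule toric_coneI)
    fix a b :: "'n plucker" assume ab: "\<not> a \<le> b" "\<not> b \<le> a"
    show "toric (initial_form w (relation a b)) = 0"
      using initial_ideal_base[OF relation_in_ideal[OF ab], of w] w hibi_ideal_subset_toric by blast
  qed
next
  fix w assume w: "w \<in> toric_cone"
  then have wK: "w \<in> straightening_cone" using toric_cone_subset by blast
  have "initial_ideal w plucker_ideal = hibi_ideal"
  proof (rule initial_ideal_eqI[OF wK])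
    note in_ideal = is_ideal_initial_ideal[OF is_ideal_plucker, of w]
    have gen: "Mon (pr a b) - Mon (pr (sup a b) (inf a b)) \<in> initial_ideal w plucker_ideal" for a b :: "'n plucker"
    proof (cases "a \<le> b \<or> b \<le> a")
      case True
      then have "pr (sup a b) (inf a b) = pr a b"
        by (auto simp: sup_absorb1 sup_absorb2 inf_absorb1 inf_absorb2 pr_commute)
      then show ?thesis using ideal_0[OF in_ideal] by simp
    next
      case False
      then have ab: "\<not> a \<le> b" "\<not> b \<le> a" by auto
      let ?is = "pr (inf a b) (sup a b)"
      have ne: "?is \<noteq> pr a b"
        using not_standard_pr[OF ab] nf_keys[OF ab inf_sup_in_keys_nf[OF ab]] by auto
      have eq: "weight w ?is = weight w (pr a b)" by (rule toric_coneD(1)[OF w ab, symmetric])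
      have P: "part (\<lambda>m. weight w m = weight w (pr a b)) (relation a b) = Mon (pr a b) - Mon ?is"
      proof (rule poly_mapping_eqI)
        fix k
        have "weight w k \<noteq> weight w (pr a b)" if "k \<in> Poly_Mapping.keys (nf a b)" "k \<noteq> ?is"
          using toric_coneD(2)[OF w ab that] by simp
        then show "Poly_Mapping.lookup (part (\<lambda>m. weight w m = weight w (pr a b)) (relation a b)) k =
            Poly_Mapping.lookup (Mon (pr a b) - Mon ?is) k"
          using ne eq lookup_nf_inf_sup[OF ab]
          by (cases "k = pr a b"; cases "k = ?is")
            (auto simp: lookup_part lookup_relation_pr[OF ab] lookup_relation[OF ab] lookup_single lookup_minus
              when_def in_keys_iff)
      qed
      have "Poly_Mapping.lookup (Mon (pr a b) - Mon ?is) (pr a b) = 1"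
        using ne by (simp add: lookup_minus lookup_single when_def)
      then have "Mon (pr a b) - Mon ?is \<noteq> 0" by (metis lookup_zero zero_neq_one)
      moreover have "weight w (pr a b) \<le> weight w m" if "m \<in> Poly_Mapping.keys (relation a b)" for m
        using that straightening_coneD[OF wK ab] by (auto simp: keys_relation[OF ab])
      ultimately have "initial_form w (relation a b) = Mon (pr a b) - Mon ?is"
        unfolding P[symmetric] by (intro initial_form_eqI)
      then show ?thesis
        using initial_ideal_base[OF relation_in_ideal[OF ab], of w] by (simp add: pr_commute)
    qed
    then show "hibi_ideal \<subseteq> initial_ideal w plucker_ideal"
      unfolding hibi_ideal_def by (intro ideal_generated_minimal in_ideal) (auto simp: Var_mult_Var)
    fix p :: "'n plucker cpoly"
    \<comment> \<open>Straightening by Hibi relations also terminates under \<open>w0\<close>,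
      because the monomial of meet and join occurs in \<open>nf a b\<close> and so has larger
      weight.\<close>
    have rel: "\<exists>q. Mon (pr a b) - q \<in> hibi_ideal \<and> (\<forall>k\<in>Poly_Mapping.keys q.
        mdeg k = 2 \<and> weight w0 (pr a b) < weight w0 k \<and> weight w0 (pr a b) \<le> weight w0 k)"
      if ab: "\<not> a \<le> b" "\<not> b \<le> a" for a b :: "'n plucker"
      using hibi_relation[of a b] nf_keys[OF ab inf_sup_in_keys_nf[OF ab]]
      by (intro exI[of _ "Mon (pr (inf a b) (sup a b))"]) simp
    have "is_ideal (hibi_ideal :: 'n plucker cpoly set)"
      unfolding hibi_ideal_def by (rule is_ideal_ideal_generated)
    then obtain s where "p - s \<in> hibi_ideal" "\<And>k. k \<in> Poly_Mapping.keys s \<Longrightarrow> standard k \<and>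
        (\<exists>m\<in>Poly_Mapping.keys p. mdeg k = mdeg m \<and> weight w0 m \<le> weight w0 k \<and> weight w0 m \<le> weight w0 k)"
      using straighten_poly[OF _ rel, of p] by blast
    then show "\<exists>s. p - s \<in> hibi_ideal \<and> (\<forall>k\<in>Poly_Mapping.keys s. standard k)" by blast
  qed
  then show "w \<in> groebner_cone plucker_ideal hibi_ideal" by (simp add: groebner_cone_def)
qed

end

section \<open>Modular weights\<close>

lemma profile_weight_nth:
  "profile_weight \<psi> $ (a :: 'n::card2 plucker) = (\<Sum>y=1..CARD('n). \<Sum>s=1..cnt a y. \<psi> y s)"
  by (simp add: profile_weight_def)

lemma profile_weight_add:
  "profile_weight (\<lambda>y s. \<psi> y s + e * \<phi> y s) = profile_weight \<psi> + e *\<^sub>R profile_weight \<phi>"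
  by (simp add: vec_eq_iff profile_weight_def sum.distrib sum_distrib_left)

lemma profile_weight_single_row:
  fixes a :: "'n::card2 plucker"
  assumes "x \<in> {1..CARD('n)}"
  shows "profile_weight (\<lambda>y s. if y = x then g s else 0) $ a = (\<Sum>s=1..cnt a x. g s)"
proof -
  have "(\<Sum>s=1..cnt a y. if y = x then g s else 0) = (if y = x then \<Sum>s=1..cnt a x. g s else 0)" for y
    by simp
  then show ?thesis using assms by (simp only: profile_weight_nth sum.delta finite_atLeastAtMost if_True)
qed

definition profile_step :: "nat \<Rightarrow> nat \<Rightarrow> nat \<Rightarrow> nat \<Rightarrow> real" where
  "profile_step x t = (\<lambda>y s. if y = x then (if t < s then 1 else 0) else 0)"

text \<open>The truncated subtraction is intended: the step counts the cells of column
  \<open>x\<close> above height \<open>t\<close>.\<close>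

lemma profile_weight_step:
  fixes a :: "'n::card2 plucker"
  assumes "x \<in> {1..CARD('n)}"
  shows "profile_weight (profile_step x t) $ a = real (cnt a x - t)"
proof -
  have "(\<Sum>s=Suc 0..m. if t < s then 1 else 0) = real (m - t)" for m
    by (induction m) (auto simp: Suc_diff_le)
  then show ?thesis unfolding profile_step_def profile_weight_single_row[OF assms] by simp
qed

lemma profile_weight_eq_sum_steps:
  fixes \<psi> :: "nat \<Rightarrow> nat \<Rightarrow> real"
  obtains \<alpha> where "(profile_weight \<psi> :: real ^ 'n::card2 plucker) =
    (\<Sum>x=1..CARD('n). \<Sum>t<CARD('n). \<alpha> x t *\<^sub>R profile_weight (profile_step x t))"
proof -
  \<comment> \<open>The value 0 at \<open>s = 0\<close> makes the first increment equal to
    \<open>\<psi> y 1\<close>, so that the increments telescope to \<open>\<psi>\<close>.\<close>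
  define \<psi>' where "\<psi>' = (\<lambda>y s. if s = 0 then 0 else \<psi> y s)"
  define \<alpha> where "\<alpha> = (\<lambda>y t. \<psi>' y (Suc t) - \<psi>' y t)"
  have tel: "(\<Sum>t<N. \<alpha> y t * (if t < s then 1 else 0)) = \<psi> y s" if "1 \<le> s" "s \<le> N" for y s N
  proof -
    have "(\<Sum>t<N. \<alpha> y t * (if t < s then 1 else 0)) = (\<Sum>t<s. \<alpha> y t)"
      using that by (intro sum.mono_neutral_cong_right) auto
    also have "\<dots> = \<psi>' y s - \<psi>' y 0" unfolding \<alpha>_def by (rule sum_lessThan_telescope)
    finally show ?thesis using that by (simp add: \<psi>'_def)
  qed
  have "profile_weight \<psi> $ a =
      (\<Sum>x=1..CARD('n). \<Sum>t<CARD('n). \<alpha> x t *\<^sub>R profile_weight (profile_step x t)) $ a" for a :: "'n plucker"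
  proof -
    have le: "cnt a x \<le> CARD('n)" if "x \<in> {1..CARD('n)}" for x
      using cnt_mono[of x "CARD('n)" a] cnt_card_bounds(2)[of a] that by (meson atLeastAtMost_iff diff_le_self le_trans)
    have "profile_weight \<psi> $ a = (\<Sum>x=1..CARD('n). \<Sum>s=1..cnt a x. \<Sum>t<CARD('n). \<alpha> x t * (if t < s then 1 else 0))"
      unfolding profile_weight_nth
    proof (intro sum.cong[OF refl])
      fix x s assume x: "x \<in> {1..CARD('n)}" and s: "s \<in> {1..cnt a x}"
      have "1 \<le> s" "s \<le> CARD('n)" using s le[OF x] by auto
      then show "\<psi> x s = (\<Sum>t<CARD('n). \<alpha> x t * (if t < s then 1 else 0))" by (rule tel[symmetric])
    qed
    also have "\<dots> = (\<Sum>x=1..CARD('n). \<Sum>t<CARD('n). \<Sum>s=1..cnt a x. \<alpha> x t * (if t < s then 1 else 0))"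
      by (rule sum.cong[OF refl], rule sum.swap)
    also have "\<dots> = (\<Sum>x=1..CARD('n). \<Sum>t<CARD('n). \<alpha> x t * profile_weight (profile_step x t) $ a)"
    proof (rule sum.cong[OF refl], rule sum.cong[OF refl])
      fix x t assume x: "x \<in> {1..CARD('n)}"
      show "(\<Sum>s=1..cnt a x. \<alpha> x t * (if t < s then 1 else 0)) = \<alpha> x t * profile_weight (profile_step x t) $ a"
        unfolding profile_step_def profile_weight_single_row[OF x] by (rule sum_distrib_left[symmetric])
    qed
    finally show ?thesis by simp
  qed
  then show thesis by (intro that[of \<alpha>]) (simp add: vec_eq_iff)
qed

lemma profile_triangle:
  assumes "1 \<le> s" "s \<le> y" "y \<le> n" "s \<le> n - 1"
  shows "profile n (\<lambda>x. s - (y - x))"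
  using assms by (auto simp: profile_def)

lemma profile_remove:
  assumes f: "profile n f" and y: "1 \<le> y" "y \<le> n" "f y = Suc (f (y - 1))" "y < n \<Longrightarrow> f (Suc y) = f y"
    and ne: "y = n \<Longrightarrow> 2 \<le> f n"
  shows "profile n (f(y := f y - 1))"
  unfolding profile_def
proof (intro conjI allI impI)
  show "(f(y := f y - 1)) 0 = 0" using f y by (simp add: profile_def)
  fix x assume x: "x < n"
  have st: "f x \<le> f (Suc x)" "f (Suc x) \<le> Suc (f x)" using f x by (simp_all add: profile_def)
  have "(f(y := f y - 1)) x \<le> (f(y := f y - 1)) (Suc x) \<and>
      (f(y := f y - 1)) (Suc x) \<le> Suc ((f(y := f y - 1)) x)"
  proof (cases "x = y")
    case True
    then have "f (Suc x) = f y" using y(4) x by simp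
    then show ?thesis using True by simp
  next
    case False
    show ?thesis
    proof (cases "Suc x = y")
      case True
      then have "f y = Suc (f x)" using y(3) by auto
      then show ?thesis using True False by simp
    qed (use False st in simp)
  qed
  then show "(f(y := f y - 1)) x \<le> (f(y := f y - 1)) (Suc x)"
    "(f(y := f y - 1)) (Suc x) \<le> Suc ((f(y := f y - 1)) x)" by blast+
next
  have n: "1 \<le> f n" "f n \<le> n - 1" using f by (simp_all add: profile_def)
  show "1 \<le> (f(y := f y - 1)) n" using n ne by auto
  show "(f(y := f y - 1)) n \<le> n - 1" using n by auto
qed

text \<open>Every element other than the top \<open>[n]\<close> is the meet of the element obtained by lowering its
  profile at one place \<open>y\<close> with an element depending only on \<open>y\<close> and the height there; this
  expresses a modular weight as a sum over the cells below the profile.\<close>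

lemma modular_eq_profile_weight:
  fixes w :: "real ^ 'n::card2 plucker"
  assumes modular: "\<And>a b. w $ a + w $ b = w $ inf a b + w $ sup a b"
  obtains \<psi> where "w = profile_weight \<psi>"
proof -
  let ?n = "CARD('n)"
  define el :: "(nat \<Rightarrow> nat) \<Rightarrow> 'n plucker" where "el = (\<lambda>f. SOME a. \<forall>x\<le>?n. cnt a x = f x)"
  have el: "cnt (el f) x = f x" if f: "profile ?n f" and x: "x \<le> ?n" for f x
  proof -
    have "\<exists>a :: 'n plucker. \<forall>x\<le>?n. cnt a x = f x"
      using ex_plucker_of_profile[OF f] by blast
    then have "\<forall>x\<le>?n. cnt (el f) x = f x" unfolding el_def by (rule someI_ex)
    then show ?thesis using x by blast
  qed
  \<comment> \<open>The least profile of height \<open>s\<close> at \<open>y\<close>; it lies below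
    every profile with that height at \<open>y\<close>.\<close>
  define tri where "tri = (\<lambda>y s x. s - (y - x) :: nat)"
  \<comment> \<open>The change of \<open>w\<close> when the cell at \<open>(y, s)\<close> is removed
    from the least profile containing it. For \<open>(?n, 1)\<close> the removal would leave an
    empty index, so this cell carries the whole weight of \<open>[n]\<close>.\<close>
  define \<psi> where "\<psi> = (\<lambda>y s. if y = ?n \<and> s = 1 then w $ el (tri ?n 1)
    else w $ el (tri y s) - w $ el ((tri y s)(y := s - 1)))"
  have n2: "2 \<le> ?n" using one_less_card[where 'a = 'n] by simp
  have "w $ a = profile_weight \<psi> $ a" for a
  proof (induction "\<Sum>y=1..?n. cnt a y" arbitrary: a rule: less_induct)
    case less
    define s where "s = cnt a ?n"
    \<comment> \<open>The largest entry of \<open>a\<close>. Lowering the profile there replaces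
      this entry by its successor, or deletes it if it is \<open>?n\<close>.\<close>
    define y where "y = (LEAST y. cnt a y = s)"
    have s1: "1 \<le> s" "s \<le> ?n - 1" using cnt_card_bounds[of a] by (simp_all add: s_def)
    have ys: "cnt a y = s" unfolding y_def by (rule LeastI[of _ ?n]) (simp add: s_def)
    have yn: "y \<le> ?n" unfolding y_def by (rule Least_le) (simp add: s_def)
    have y1: "1 \<le> y" using ys s1 by (cases y) auto
    have sy: "s \<le> y" using cnt_lipschitz[of 0 y a] ys by simp
    have above: "cnt a x = s" if "y \<le> x" "x \<le> ?n" for x
      using cnt_mono[of y x a] cnt_mono[of x ?n a] that ys by (simp add: s_def)
    have below: "cnt a x < s" if "x < y" for x
      using not_less_Least[of x "\<lambda>y. cnt a y = s"] cnt_mono[of x y a] that ys by (simp add: y_def[symmetric])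
    have pred: "cnt a y = Suc (cnt a (y - 1))"
      using below[of "y - 1"] cnt_step(2)[of a "y - 1"] y1 ys by simp
    have tri_le: "tri y s x \<le> cnt a x" if "x \<le> ?n" for x
      using cnt_lipschitz[of x y a] above[of x] ys that unfolding tri_def by (cases "x \<le> y") auto
    have tri: "profile ?n (tri y s)"
      unfolding tri_def by (rule profile_triangle[OF s1(1) sy yn s1(2)])
    show ?case
    proof (cases "y = ?n \<and> s = 1")
      case True
      have c: "cnt a x = (if x = ?n then 1 else 0)" if "x \<le> ?n" for x
        using below[of x] that True ys by (cases "x = ?n") auto
      have a: "a = el (tri ?n 1)"
      proof (rule plucker_eqI_cnt)
        fix x assume x: "x \<le> ?n"
        have "cnt (el (tri ?n 1)) x = tri ?n 1 x" using tri True x by (intro el) auto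
        then show "cnt a x = cnt (el (tri ?n 1)) x" using x by (auto simp: c tri_def)
      qed
      have "(\<Sum>s=1..cnt a x. \<psi> x s) = (if x = ?n then \<psi> ?n 1 else 0)" if "x \<in> {1..?n}" for x
        using that by (simp add: c)
      then have "profile_weight \<psi> $ a = (\<Sum>x=1..?n. if x = ?n then \<psi> ?n 1 else 0)"
        unfolding profile_weight_nth by (rule sum.cong[OF refl])
      also have "\<dots> = \<psi> ?n 1" using n2 by (simp add: sum.delta)
      finally show ?thesis using a by (simp add: \<psi>_def)
    next
      case False
      have "profile ?n ((cnt a)(y := cnt a y - 1))"
        using above[of "Suc y"] ys False s1
        by (intro profile_remove[OF profile_cnt y1 yn pred]) (auto simp: s_def[symmetric])
      from el[OF this] obtain a' :: "'n plucker" where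
        a': "\<And>x. x \<le> ?n \<Longrightarrow> cnt a' x = ((cnt a)(y := s - 1)) x" using ys by metis
      have "tri y s y = Suc (tri y s (y - 1))" "tri y s (Suc y) = tri y s y"
        using s1 y1 by (auto simp: tri_def)
      moreover have "y = ?n \<Longrightarrow> 2 \<le> tri y s ?n" using False s1 by (auto simp: tri_def)
      ultimately have "profile ?n ((tri y s)(y := tri y s y - 1))"
        by (intro profile_remove[OF tri y1 yn]) auto
      then have tri': "profile ?n ((tri y s)(y := s - 1))" by (simp add: tri_def)
      have inf: "inf a' (el (tri y s)) = a"
      proof (rule plucker_eqI_cnt)
        fix x assume x: "x \<le> ?n"
        show "cnt (inf a' (el (tri y s))) x = cnt a x"
          unfolding cnt_inf[OF x] a'[OF x] el[OF tri x] using tri_le[OF x] ys by (auto simp: tri_def)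
      qed
      have sup: "sup a' (el (tri y s)) = el ((tri y s)(y := s - 1))"
      proof (rule plucker_eqI_cnt)
        fix x assume x: "x \<le> ?n"
        show "cnt (sup a' (el (tri y s))) x = cnt (el ((tri y s)(y := s - 1))) x"
          unfolding cnt_sup[OF x] a'[OF x] el[OF tri x] el[OF tri' x] using tri_le[OF x] ys by (auto simp: tri_def)
      qed
      have \<psi>y: "\<psi> y s = w $ el (tri y s) - w $ el ((tri y s)(y := s - 1))" using False by (auto simp: \<psi>_def)
      have w: "w $ a = w $ a' + \<psi> y s"
        using modular[of a' "el (tri y s)"] unfolding inf sup \<psi>y by simp
      have yI: "y \<in> {1..?n}" using y1 yn by simp
      have ca': "cnt a' x = cnt a x" if "x \<in> {1..?n} - {y}" for x using a'[of x] that by auto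
      have cy: "cnt a' y = s - 1" using a'[OF yn] by simp
      have "(\<Sum>x=1..?n. cnt a' x) < (\<Sum>x=1..?n. cnt a x)"
      proof (rule sum_strict_mono_ex1)
        show "\<forall>x\<in>{1..?n}. cnt a' x \<le> cnt a x" using ca' cy ys by (metis DiffI diff_le_self order_refl singletonD)
        show "\<exists>x\<in>{1..?n}. cnt a' x < cnt a x" using yI cy ys s1 by (intro bexI[of _ y]) auto
      qed simp
      then have IH: "w $ a' = profile_weight \<psi> $ a'" by (rule less)
      have rest: "(\<Sum>x\<in>{1..?n}-{y}. \<Sum>s=1..cnt a' x. \<psi> x s) = (\<Sum>x\<in>{1..?n}-{y}. \<Sum>s=1..cnt a x. \<psi> x s)"
        by (rule sum.cong[OF refl]) (simp only: ca')
      obtain s' where s': "s = Suc s'" using s1 by (cases s) auto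
      have "profile_weight \<psi> $ a = profile_weight \<psi> $ a' + \<psi> y s"
        unfolding profile_weight_nth sum.remove[OF finite_atLeastAtMost yI] rest cy ys
        by (simp add: s')
      then show ?thesis using w IH by simp
    qed
  qed
  then show thesis by (intro that[of \<psi>]) (simp add: vec_eq_iff)
qed

section \<open>Polyhedral cones\<close>

lemma closure_ray:
  fixes x u :: "'a::real_normed_vector"
  assumes "\<And>e. 0 < e \<Longrightarrow> x + e *\<^sub>R u \<in> S"
  shows "x \<in> closure S"
  unfolding closure_sequential
proof (intro exI conjI allI)
  show "x + inverse (real (Suc n)) *\<^sub>R u \<in> S" for n
    by (rule assms) simp
  have "(\<lambda>n. x + inverse (real (Suc n)) *\<^sub>R u) \<longlonglongrightarrow> x + 0 *\<^sub>R u"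
    by (intro tendsto_intros LIMSEQ_inverse_real_of_nat)
  then show "(\<lambda>n. x + inverse (real (Suc n)) *\<^sub>R u) \<longlonglongrightarrow> x" by simp
qed

text \<open>At a relative interior point \<open>w\<close> of the facet some constraint
  \<open>v\<close> is active. It vanishes on all of \<open>F\<close> and so cuts out its affine
  hull, and any other constraint active at \<open>w\<close> vanishes on the same hyperplane;
  positivity at \<open>w0\<close> fixes the sign of the factor.\<close>

lemma facet_of_polyhedral_cone:
  fixes T :: "'a::euclidean_space set"
  assumes T: "finite T" "\<And>v. v \<in> T \<Longrightarrow> 0 < v \<bullet> w0"
    and K: "K = {w. \<forall>v\<in>T. 0 \<le> v \<bullet> w}"
    and F: "F facet_of K"
  obtains v w where "v \<in> T" "F = K \<inter> {x. v \<bullet> x = 0}" "w \<in> F"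
    "\<And>v'. v' \<in> T \<Longrightarrow> v' \<bullet> w = 0 \<Longrightarrow> \<exists>\<mu>>0. v' = \<mu> *\<^sub>R v"
proof -
  define U where "U = (\<Inter>v\<in>T. {w. 0 < v \<bullet> w})"
  have "open U" unfolding U_def using T(1) by (intro open_INT ballI open_halfspace_gt) auto
  moreover have "U \<subseteq> K" by (auto simp: U_def K intro: less_imp_le)
  ultimately have int: "U \<subseteq> interior K" by (rule interior_maximal[rotated])
  have "w0 \<in> U" using T(2) by (simp add: U_def)
  then have dimK: "aff_dim K = DIM('a)" using int by (intro aff_dim_nonempty_interior) blast
  have face: "F face_of K" and ne: "F \<noteq> {}" and dimF: "aff_dim F = int DIM('a) - 1"
    using F dimK by (auto simp: facet_of_def)
  have FK: "F \<subseteq> K" and cF: "convex F"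
    using face face_of_imp_subset face_of_imp_convex by blast+
  obtain w where w: "w \<in> rel_interior F"
    using rel_interior_eq_empty[OF cF] ne by blast
  have wF: "w \<in> F" using w rel_interior_subset by blast
  have "F \<noteq> K" using dimF dimK by auto
  then have "w \<notin> interior K" using face_of_disjoint_interior[OF face] wF by blast
  then have "w \<notin> U" using int by blast
  then obtain v where v: "v \<in> T" "v \<bullet> w = 0"
    using FK wF by (fastforce simp: U_def K)
  have "v \<noteq> 0" using T(2)[OF v(1)] by auto
  \<comment> \<open>The segment from \<open>x\<close> through \<open>w\<close> can be prolonged
    inside \<open>F\<close>, so a constraint that is 0 at \<open>w\<close> and positive at
    \<open>x\<close> would become negative beyond \<open>w\<close>.\<close>
  have zero: "v' \<bullet> x = 0" if vv: "v' \<in> T" "v' \<bullet> w = 0" "x \<in> F" for v' x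
  proof -
    obtain e where e: "e > 1" "(1 - e) *\<^sub>R x + e *\<^sub>R w \<in> F"
      using convex_rel_interior_iff[OF cF ne, of w] w vv(3) by blast
    then have "0 \<le> v' \<bullet> ((1 - e) *\<^sub>R x + e *\<^sub>R w)" "0 \<le> v' \<bullet> x"
      using FK vv K by auto
    then have "0 \<le> (1 - e) * (v' \<bullet> x)" using vv by (simp add: inner_right_distrib)
    then show ?thesis using e(1) \<open>0 \<le> v' \<bullet> x\<close> by (simp add: zero_le_mult_iff)
  qed
  have hullF: "affine hull F = {x. v \<bullet> x = 0}"
  proof (rule affine_dim_equal)
    show "affine hull F \<subseteq> {x. v \<bullet> x = 0}"
      using zero[OF v] by (intro hull_minimal affine_hyperplane) auto
    show "aff_dim (affine hull F) = aff_dim {x. v \<bullet> x = 0}"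
      using \<open>v \<noteq> 0\<close> dimF by (simp add: aff_dim_hyperplane)
  qed (use ne affine_hyperplane in auto)
  show ?thesis
  proof
    show "v \<in> T" by fact
    show "w \<in> F" by fact
    show "F = K \<inter> {x. v \<bullet> x = 0}"
    proof (intro equalityI subsetI)
      fix x assume x: "x \<in> K \<inter> {x. v \<bullet> x = 0}"
      show "x \<in> F"
      proof (cases "x = w")
        case False
        obtain e where e: "e > 0" "cball w e \<inter> affine hull F \<subseteq> F"
          using w by (auto simp: mem_rel_interior_cball)
        define d where "d = e / norm (x - w)"
        \<comment> \<open>The point opposite to \<open>x\<close>: \<open>w\<close> lies strictly
          between \<open>x\<close> and \<open>y\<close>, so the face property brings
          \<open>x\<close> into \<open>F\<close>.\<close>
        define y where "y = w - d *\<^sub>R (x - w)"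
        have d: "d > 0" using e False by (simp add: d_def)
        have "dist w y = e" using False e by (simp add: y_def d_def dist_norm)
        moreover have "v \<bullet> y = 0" using x v by (simp add: y_def inner_diff_right)
        ultimately have "y \<in> F" using e hullF by auto
        define t where "t = 1 / (1 + d)"
        have t: "0 < t" "t < 1" "t + t * d = 1" using d by (auto simp: t_def field_simps)
        have "(1 - t) *\<^sub>R x + t *\<^sub>R y = (1 - (t + t * d)) *\<^sub>R x + (t + t * d) *\<^sub>R w"
          by (simp add: y_def algebra_simps)
        then have "w = (1 - t) *\<^sub>R x + t *\<^sub>R y" using t by simp
        moreover have "x \<noteq> y"
        proof
          assume "x = y"
          then have "(1 + d) *\<^sub>R (x - w) = 0" by (simp add: y_def algebra_simps)
          then show False using d False by simp
        qed
        ultimately have "w \<in> open_segment x y"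
          using t unfolding in_segment by blast
        then show ?thesis
          using face_ofD[OF face, of w x y] wF x \<open>y \<in> F\<close> FK by blast
      qed (use wF in simp)
    qed (use FK zero[OF v] in auto)
    fix v' assume v': "v' \<in> T" "v' \<bullet> w = 0"
    have "affine hull F \<subseteq> {x. v' \<bullet> x = 0}"
      using zero[OF v'] by (intro hull_minimal affine_hyperplane) auto
    then have zero': "v' \<bullet> x = 0" if "v \<bullet> x = 0" for x using hullF that by auto
    \<comment> \<open>The projection coefficient: the remainder
      \<open>v' - \<mu> *\<^sub>R v\<close> lies in the hyperplane of \<open>v\<close>, where
      \<open>v'\<close> vanishes as well, so it is orthogonal to itself.\<close>
    define \<mu> where "\<mu> = (v \<bullet> v') / (v \<bullet> v)"
    have "v \<bullet> (v' - \<mu> *\<^sub>R v) = 0"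
      using \<open>v \<noteq> 0\<close> by (simp add: inner_diff_right \<mu>_def)
    then have "(v' - \<mu> *\<^sub>R v) \<bullet> (v' - \<mu> *\<^sub>R v) = 0"
      using zero' by (simp add: inner_diff_left)
    then have eq: "v' = \<mu> *\<^sub>R v" by simp
    then have "0 < \<mu> * (v \<bullet> w0)" using T(2)[OF v'(1)] by (metis inner_scaleR_left)
    then have "\<mu> > 0" using T(2)[OF v(1)] by (simp add: zero_less_mult_iff)
    then show "\<exists>\<mu>>0. v' = \<mu> *\<^sub>R v" using eq by blast
  qed
qed

section \<open>Facets\<close>

lemma weight_scaleR_add: "weight (x *\<^sub>R v + y *\<^sub>R w) m = x * weight v m + y * weight w m"
  by (simp add: weight_def sum.distrib sum_distrib_left distrib_right mult.assoc)

definition facet_normal :: "('v::finite \<Rightarrow>\<^sub>0 nat) \<Rightarrow> ('v \<Rightarrow>\<^sub>0 nat) \<Rightarrow> real ^ 'v" where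
  "facet_normal m k = (\<chi> x. real (Poly_Mapping.lookup k x) - real (Poly_Mapping.lookup m x))"

lemma inner_facet_normal: "facet_normal m k \<bullet> w = weight w k - weight w m"
  by (simp add: facet_normal_def weight_def inner_vec_def algebra_simps sum_subtractf)

definition weakly_rising :: "nat \<Rightarrow> (nat \<Rightarrow> nat \<Rightarrow> real) \<Rightarrow> bool" where
  "weakly_rising n \<psi> \<longleftrightarrow> (\<forall>y<n. \<forall>r s. 1 \<le> r \<longrightarrow> r < s \<longrightarrow> \<psi> y r \<le> \<psi> y s)"

context plucker_straightening
begin

definition normals :: "(real ^ 'n plucker) set" where
  "normals = (\<Union>(a, b)\<in>{(a, b). \<not> a \<le> b \<and> \<not> b \<le> a}. facet_normal (pr a b) ` Poly_Mapping.keys (nf a b))"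

lemma finite_normals: "finite normals"
  unfolding normals_def by (intro finite_UN_I) (auto intro: finite_subset[of _ UNIV])

lemma normals_iff:
  "v \<in> normals \<longleftrightarrow> (\<exists>a b k. \<not> a \<le> b \<and> \<not> b \<le> a \<and> k \<in> Poly_Mapping.keys (nf a b) \<and> v = facet_normal (pr a b) k)"
  by (auto simp: normals_def)

lemma straightening_cone_eq: "straightening_cone = {w. \<forall>v\<in>normals. 0 \<le> v \<bullet> w}"
proof (intro equalityI subsetI CollectI ballI)
  fix w v assume w: "w \<in> straightening_cone" and "v \<in> normals"
  then obtain a b k where "\<not> a \<le> b" "\<not> b \<le> a" "k \<in> Poly_Mapping.keys (nf a b)" "v = facet_normal (pr a b) k"
    unfolding normals_iff by blast
  then show "0 \<le> v \<bullet> w" using straightening_coneD[OF w] by (simp add: inner_facet_normal)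
next
  fix w assume w: "w \<in> {w. \<forall>v\<in>normals. 0 \<le> v \<bullet> w}"
  have "weight w (pr a b) \<le> weight w k" if "\<not> a \<le> b" "\<not> b \<le> a" "k \<in> Poly_Mapping.keys (nf a b)" for a b k
  proof -
    have "facet_normal (pr a b) k \<in> normals" using that unfolding normals_iff by blast
    then have "0 \<le> facet_normal (pr a b) k \<bullet> w" using w by blast
    then show ?thesis by (simp add: inner_facet_normal)
  qed
  then show "w \<in> straightening_cone" by (simp add: straightening_cone_def)
qed

lemma normals_w0: "v \<in> normals \<Longrightarrow> 0 < v \<bullet> w0"
  unfolding normals_iff using nf_keys by (auto simp: inner_facet_normal)

lemma closed_straightening_cone: "closed straightening_cone"
proof -
  have "straightening_cone = (\<Inter>v\<in>normals. {w. 0 \<le> v \<bullet> w})" by (auto simp: straightening_cone_eq)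
  then show ?thesis by (simp add: closed_INT closed_halfspace_ge)
qed

text \<open>Adding a small positive multiple of \<open>w0\<close> makes all the inequalities
  strict.\<close>

lemma closure_strict_cone: "closure strict_cone = straightening_cone"
proof
  have "strict_cone \<subseteq> straightening_cone"
    by (auto simp: strict_cone_def straightening_cone_def intro: less_imp_le)
  then show "closure strict_cone \<subseteq> straightening_cone"
    by (rule closure_minimal[OF _ closed_straightening_cone])
  show "straightening_cone \<subseteq> closure strict_cone"
  proof
    fix w assume w: "w \<in> straightening_cone"
    show "w \<in> closure strict_cone"
    proof (rule closure_ray[of _ w0])
      fix e :: real assume e: "0 < e"
      have "weight (w + e *\<^sub>R w0) (pr a b) < weight (w + e *\<^sub>R w0) k"
        if k: "\<not> a \<le> b" "\<not> b \<le> a" "k \<in> Poly_Mapping.keys (nf a b)" for a b k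
      proof -
        have "weight w (pr a b) \<le> weight w k" by (rule straightening_coneD[OF w k])
        moreover have "e * weight w0 (pr a b) < e * weight w0 k" using nf_keys[OF k] e by simp
        ultimately show ?thesis using weight_scaleR_add[of 1 w e w0] by simp
      qed
      then show "w + e *\<^sub>R w0 \<in> strict_cone" by (simp add: strict_cone_def)
    qed
  qed
qed

lemma closure_toric_cone_subset: "closure toric_cone \<subseteq> straightening_cone"
  by (rule closure_minimal[OF toric_cone_subset closed_straightening_cone])

lemma convex_closure_toric_cone: "convex (closure toric_cone)"
proof (rule convex_closure, rule convexI)
  fix v w :: "real ^ 'n plucker" and x y :: real
  assume v: "v \<in> toric_cone" and w: "w \<in> toric_cone" and xy: "0 \<le> x" "0 \<le> y" "x + y = 1"
  have "weight (x *\<^sub>R v + y *\<^sub>R w) (pr a b) = weight (x *\<^sub>R v + y *\<^sub>R w) (pr (inf a b) (sup a b)) \<and>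
      (\<forall>k\<in>Poly_Mapping.keys (nf a b). k \<noteq> pr (inf a b) (sup a b) \<longrightarrow>
        weight (x *\<^sub>R v + y *\<^sub>R w) (pr a b) < weight (x *\<^sub>R v + y *\<^sub>R w) k)"
    if ab: "\<not> a \<le> b" "\<not> b \<le> a" for a b
  proof (intro conjI ballI impI)
    show "weight (x *\<^sub>R v + y *\<^sub>R w) (pr a b) = weight (x *\<^sub>R v + y *\<^sub>R w) (pr (inf a b) (sup a b))"
      unfolding weight_scaleR_add toric_coneD(1)[OF v ab] toric_coneD(1)[OF w ab] ..
    fix k assume k: "k \<in> Poly_Mapping.keys (nf a b)" "k \<noteq> pr (inf a b) (sup a b)"
    have lt: "weight v (pr a b) < weight v k" "weight w (pr a b) < weight w k"
      by (rule toric_coneD(2)[OF v ab k], rule toric_coneD(2)[OF w ab k])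
    consider "x > 0" | "y > 0" using xy by linarith
    then show "weight (x *\<^sub>R v + y *\<^sub>R w) (pr a b) < weight (x *\<^sub>R v + y *\<^sub>R w) k"
      unfolding weight_scaleR_add
      by cases (use lt xy in \<open>simp_all add: add_less_le_mono add_le_less_mono mult_left_mono\<close>)
  qed
  then show "x *\<^sub>R v + y *\<^sub>R w \<in> toric_cone" unfolding toric_cone_def by blast
qed

text \<open>Adding a small multiple of the strictly rising function \<open>s\<close> makes
  \<open>\<psi>\<close> strictly rising.\<close>

lemma profile_weight_in_closure:
  assumes "weakly_rising CARD('n) \<psi>"
  shows "profile_weight \<psi> \<in> closure toric_cone"
proof (rule closure_ray[of _ "profile_weight (\<lambda>y s. real s)"])
  fix e :: real assume "0 < e"
  then have "strictly_rising CARD('n) (\<lambda>y s. \<psi> y s + e * real s)"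
    using assms by (auto simp: weakly_rising_def strictly_rising_def intro!: add_le_less_mono)
  then show "profile_weight \<psi> + e *\<^sub>R profile_weight (\<lambda>y s. real s) \<in> toric_cone"
    unfolding profile_weight_add[symmetric] by (rule profile_weight_in_toric_cone)
qed

lemma toric_cone_nonempty: "toric_cone \<noteq> {}"
proof -
  have "strictly_rising CARD('n) (\<lambda>y s. real s)" by (simp add: strictly_rising_def)
  then show ?thesis using profile_weight_in_toric_cone by blast
qed

lemma closure_toric_cone_modular:
  assumes "w \<in> closure toric_cone"
  shows "w $ a + w $ b = w $ inf a b + w $ sup a b"
proof -
  have "closed {w :: real ^ 'n plucker. w $ a + w $ b = w $ inf a b + w $ sup a b}"
    by (intro closed_Collect_eq continuous_intros)
  moreover have "toric_cone \<subseteq> {w. w $ a + w $ b = w $ inf a b + w $ sup a b}"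
  proof
    fix w assume w: "w \<in> toric_cone"
    show "w \<in> {w. w $ a + w $ b = w $ inf a b + w $ sup a b}"
    proof (cases "a \<le> b \<or> b \<le> a")
      case True
      then show ?thesis by (auto simp: inf_absorb1 inf_absorb2 sup_absorb1 sup_absorb2)
    next
      case False
      then show ?thesis using toric_coneD(1)[OF w, of a b] by (simp add: weight_pr)
    qed
  qed
  ultimately show ?thesis using closure_minimal[of toric_cone] assms by blast
qed

section \<open>Monomials of a normal form tested against profile weights\<close>

context
  fixes a b c d :: "'n plucker"
  assumes ab: "\<not> a \<le> b" "\<not> b \<le> a" and cd: "c \<le> d" and key: "pr c d \<in> Poly_Mapping.keys (nf a b)"
begin

lemma profile_weight_ineq:
  assumes "weakly_rising CARD('n) \<psi>"
  shows "profile_weight \<psi> $ a + profile_weight \<psi> $ b \<le> profile_weight \<psi> $ c + profile_weight \<psi> $ d"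
proof -
  have "profile_weight \<psi> \<in> straightening_cone"
    using profile_weight_in_closure[OF assms] closure_toric_cone_subset by blast
  from straightening_coneD[OF this ab key] show ?thesis by (simp add: weight_pr)
qed

text \<open>A function that is constant in \<open>s\<close> is weakly rising with either sign, so
  the inequality becomes an equation.\<close>

lemma cnt_key_sum:
  assumes "x \<le> CARD('n)"
  shows "cnt a x + cnt b x = cnt c x + cnt d x"
proof (cases "x = 0")
  case False
  then have x: "x \<in> {1..CARD('n)}" using assms by simp
  have w: "weakly_rising CARD('n) (\<lambda>y s. if y = x then g else 0)" for g by (simp add: weakly_rising_def)
  have "real (cnt a x + cnt b x) * g \<le> real (cnt c x + cnt d x) * g" for g
    using profile_weight_ineq[OF w, of g] unfolding profile_weight_single_row[OF x] by (simp add: distrib_right)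
  from this[of 1] this[of "-1"] show ?thesis by simp
qed simp

lemma sum_neg_le: "(\<Sum>s=1..m. if s \<le> r then - 1 else 0) = - real (min r m)"
  by (induction m) (auto simp: min_def)

text \<open>Tested with minus the indicator of the cells of height at most \<open>r\<close> at
  \<open>x\<close>, which is rising.\<close>

lemma cnt_key_min:
  assumes "x \<in> {1..CARD('n)}"
  shows "min r (cnt c x) + min r (cnt d x) \<le> min r (cnt a x) + min r (cnt b x)"
proof -
  have "weakly_rising CARD('n) (\<lambda>y s. if y = x then (if s \<le> r then - 1 else 0) else 0)"
    by (simp add: weakly_rising_def)
  from profile_weight_ineq[OF this]
  have "- real (min r (cnt a x)) + - real (min r (cnt b x)) \<le> - real (min r (cnt c x)) + - real (min r (cnt d x))"
    unfolding profile_weight_single_row[OF assms] sum_neg_le .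
  then show ?thesis by linarith
qed

text \<open>At \<open>CARD('n)\<close> no monotonicity is demanded, so the indicator may be used
  with the opposite sign as well.\<close>

lemma cnt_key_min_length:
  "min r (cnt a CARD('n)) + min r (cnt b CARD('n)) \<le> min r (cnt c CARD('n)) + min r (cnt d CARD('n))"
proof -
  have n: "CARD('n) \<in> {1..CARD('n)}" by simp
  have eq: "(\<Sum>s=1..m. if s \<le> r then 1 else (0::real)) = real (min r m)" for m
    by (induction m) (auto simp: min_def)
  have "weakly_rising CARD('n) (\<lambda>y s. if y = CARD('n) then (if s \<le> r then 1 else 0) else 0)"
    by (simp add: weakly_rising_def)
  from profile_weight_ineq[OF this]
  have "real (min r (cnt a CARD('n))) + real (min r (cnt b CARD('n))) \<le>
      real (min r (cnt c CARD('n))) + real (min r (cnt d CARD('n)))"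
    unfolding profile_weight_single_row[OF n] eq .
  then show ?thesis by linarith
qed

text \<open>With cut-off \<open>cnt c x\<close> nothing is cut from \<open>c\<close> and
  \<open>d\<close>, so by equality of the sums nothing may be cut from \<open>a\<close> and
  \<open>b\<close> either. The length comes from the reverse inequality with cut-off the larger of
  the two lengths.\<close>

lemma key_order: "c \<le> a" "c \<le> b" "a \<le> d" "b \<le> d"
  and key_length: "cnt c CARD('n) = max (cnt a CARD('n)) (cnt b CARD('n))"
proof -
  have le: "cnt d x \<le> cnt c x" if "x \<le> CARD('n)" for x using cd that by (simp add: less_eq_iff_cnt)
  have C: "max (cnt a x) (cnt b x) \<le> cnt c x" if x: "x \<le> CARD('n)" for x
  proof (cases "x = 0")
    case False
    then have x': "x \<in> {1..CARD('n)}" using x by simp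
    show ?thesis
      using cnt_key_min[OF x', of "cnt c x"] cnt_key_sum[OF x] le[OF x] by linarith
  qed simp
  then show "c \<le> a" "c \<le> b" by (auto simp: less_eq_iff_cnt)
  have D: "cnt d x \<le> cnt a x \<and> cnt d x \<le> cnt b x" if "x \<le> CARD('n)" for x
    using C[OF that] cnt_key_sum[OF that] by linarith
  show "a \<le> d" "b \<le> d"
    unfolding less_eq_iff_cnt using D by blast+
  show "cnt c CARD('n) = max (cnt a CARD('n)) (cnt b CARD('n))"
    using C[of "CARD('n)"] cnt_key_min_length[of "max (cnt a CARD('n)) (cnt b CARD('n))"]
      cnt_key_sum[of "CARD('n)"] by linarith
qed

lemma key_disjoint: "{a, b} \<inter> {c, d} = {}"
proof -
  have no: False if "x \<in> {a, b}" "x \<in> {c, d}" for x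
  proof -
    from that consider "a = c" | "a = d" | "b = c" | "b = d" by blast
    then show False using key_order ab cd by cases auto
  qed
  then show ?thesis by blast
qed

text \<open>There is no cancellation in the normal vector because the pairs are disjoint. Its signs
  therefore reveal the pair \<open>{a, b}\<close>, even after positive scaling.\<close>

lemma facet_normal_key_neg: "facet_normal (pr a b) (pr c d) $ x < 0 \<longleftrightarrow> x \<in> {a, b}"
  using key_disjoint ab by (auto simp: facet_normal_def lookup_add lookup_single when_def)

end

lemma lowest_relation_in_initial_ideal:
  assumes w: "w \<in> straightening_cone" and ab: "\<not> a \<le> b" "\<not> b \<le> a"
  shows "part (\<lambda>m. weight w m = weight w (pr a b)) (relation a b) \<in> initial_ideal w plucker_ideal"
proof -
  let ?P = "part (\<lambda>m. weight w m = weight w (pr a b)) (relation a b)"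
  have "Poly_Mapping.lookup ?P (pr a b) = 1" by (simp add: lookup_part lookup_relation_pr[OF ab])
  then have "?P \<noteq> 0" by (metis lookup_zero zero_neq_one)
  moreover have "weight w (pr a b) \<le> weight w m" if "m \<in> Poly_Mapping.keys (relation a b)" for m
    using that straightening_coneD[OF w ab] by (auto simp: keys_relation[OF ab])
  ultimately have "initial_form w (relation a b) = ?P" by (intro initial_form_eqI)
  then show ?thesis using initial_ideal_base[OF relation_in_ideal[OF ab], of w] by simp
qed

text \<open>If \<open>e\<close> were not comparable to \<open>x\<close>, then \<open>X\<^sub>x X\<^sub>e\<close> and hence \<open>X\<^sub>a X\<^sub>b X\<^sub>e\<close> would lie in the initial
  ideal, and with it the standard monomial \<open>X\<^sub>c X\<^sub>d X\<^sub>e\<close>.\<close>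

lemma comparable_if_unique_active:
  assumes w: "w \<in> straightening_cone"
    and ab: "\<not> a \<le> b" "\<not> b \<le> a" and cd: "c \<le> d" and key: "pr c d \<in> Poly_Mapping.keys (nf a b)"
    and active: "weight w (pr c d) = weight w (pr a b)"
    and unique: "\<And>a' b' k. \<not> a' \<le> b' \<Longrightarrow> \<not> b' \<le> a' \<Longrightarrow> k \<in> Poly_Mapping.keys (nf a' b') \<Longrightarrow>
      weight w k = weight w (pr a' b') \<Longrightarrow> {a', b'} = {a, b} \<and> k = pr c d"
    and e: "c \<le> e" "e \<le> d" "e \<noteq> a" "e \<noteq> b"
    and xy: "pr x y = pr a b"
  shows "e \<le> x \<or> x \<le> e"
proof (rule ccontr)
  assume "\<not> (e \<le> x \<or> x \<le> e)"
  then have xe: "\<not> x \<le> e" "\<not> e \<le> x" by auto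
  let ?J = "initial_ideal w plucker_ideal"
  let ?s = "\<lambda>z :: 'n plucker. Poly_Mapping.single z (Suc 0)"
  note J = is_ideal_initial_ideal[OF is_ideal_plucker, of w]
  have "part (\<lambda>m. weight w m = weight w (pr x e)) (relation x e) = Mon (pr x e)"
  proof (rule poly_mapping_eqI)
    fix k
    have "{x, e} \<noteq> {a, b}" using e(3,4) by auto
    then have "weight w k \<noteq> weight w (pr x e)" if "k \<in> Poly_Mapping.keys (nf x e)"
      using unique[OF xe that] by blast
    then show "Poly_Mapping.lookup (part (\<lambda>m. weight w m = weight w (pr x e)) (relation x e)) k =
        Poly_Mapping.lookup (Mon (pr x e)) k"
      by (cases "k = pr x e")
        (auto simp: lookup_part lookup_relation_pr[OF xe] lookup_relation[OF xe] lookup_single when_def in_keys_iff)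
  qed
  then have "Mon (pr x e) \<in> ?J" using lowest_relation_in_initial_ideal[OF w xe] by simp
  then have "Mon (?s y) * Mon (pr x e) \<in> ?J" by (rule ideal_Mon[OF J])
  \<comment> \<open>As \<open>x\<close> and \<open>y\<close> are \<open>a\<close> and
    \<open>b\<close> in some order, both sides are the exponent of the product of the three
    variables of \<open>a\<close>, \<open>b\<close> and \<open>e\<close>.\<close>
  moreover have "?s y + pr x e = ?s e + pr a b" unfolding xy[symmetric] by (simp add: add_ac)
  ultimately have M: "Mon (?s e) * Mon (pr a b) \<in> ?J" by (simp add: Mon_add[symmetric])
  define l where "l = Poly_Mapping.lookup (nf a b) (pr c d)"
  have l: "l \<noteq> 0" using key by (simp add: l_def in_keys_iff)
  have "pr c d \<noteq> pr a b" using nf_keys[OF ab key] not_standard_pr[OF ab] by auto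
  have "part (\<lambda>m. weight w m = weight w (pr a b)) (relation a b) = Mon (pr a b) - Const l * Mon (pr c d)"
  proof (rule poly_mapping_eqI)
    fix k
    have H: "k = pr c d" if "k \<in> Poly_Mapping.keys (nf a b)" "weight w k = weight w (pr a b)"
      using unique[OF ab that] by blast
    show "Poly_Mapping.lookup (part (\<lambda>m. weight w m = weight w (pr a b)) (relation a b)) k =
        Poly_Mapping.lookup (Mon (pr a b) - Const l * Mon (pr c d)) k"
    proof -
      consider (ab) "k = pr a b" | (cd) "k = pr c d" "k \<noteq> pr a b" | (other) "k \<noteq> pr a b" "k \<noteq> pr c d" by blast
      then show ?thesis
      proof cases
        case ab
        then show ?thesis using \<open>pr c d \<noteq> pr a b\<close>
          by (simp add: lookup_part lookup_relation_pr[OF \<open>\<not> a \<le> b\<close> \<open>\<not> b \<le> a\<close>] lookup_minus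
            lookup_Const_mult lookup_single_not_eq)
      next
        case cd
        then show ?thesis
          by (simp add: lookup_part lookup_relation[OF ab] lookup_minus lookup_Const_mult lookup_single_not_eq
            active l_def)
      next
        case other
        then have "weight w k = weight w (pr a b) \<Longrightarrow> Poly_Mapping.lookup (nf a b) k = 0"
          using H by (auto simp: in_keys_iff)
        then show ?thesis using other
          by (simp add: lookup_part lookup_relation[OF ab] lookup_minus lookup_Const_mult lookup_single_not_eq)
      qed
    qed
  qed
  then have "Mon (pr a b) - Const l * Mon (pr c d) \<in> ?J" using lowest_relation_in_initial_ideal[OF w ab] by simp
  then have "Mon (?s e) * (Mon (pr a b) - Const l * Mon (pr c d)) \<in> ?J" by (rule ideal_Mon[OF J])
  then have "Mon (?s e) * Mon (pr a b) - Mon (?s e) * (Mon (pr a b) - Const l * Mon (pr c d)) \<in> ?J"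
    by (rule ideal_diff[OF J M])
  moreover have "Mon (?s e) * Mon (pr a b) - Mon (?s e) * (Mon (pr a b) - Const l * Mon (pr c d)) =
      Const l * Mon (?s e + pr c d)"
    by (simp add: right_diff_distrib Mon_add mult.left_commute)
  ultimately have D: "Const l * Mon (?s e + pr c d) \<in> ?J" by simp
  have std: "standard (?s e + pr c d)"
  proof -
    have "Poly_Mapping.keys (?s e + pr c d) \<subseteq> {e, c, d}"
      using Poly_Mapping.keys_add[of "?s e" "pr c d"] unfolding keys_pr by auto
    moreover have "u \<le> v \<or> v \<le> u" if "u \<in> {e, c, d}" "v \<in> {e, c, d}" for u v
      using that e(1,2) cd by auto
    ultimately show ?thesis unfolding standard_def by (meson subsetD)
  qed
  have "Const l * Mon (?s e + pr c d) = 0"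
  proof (rule standard_in_initial_ideal[OF w D])
    fix k assume "k \<in> Poly_Mapping.keys (Const l * Mon (?s e + pr c d))"
    then have "k \<in> Poly_Mapping.keys (Mon (?s e + pr c d))" using keys_Const_mult by blast
    then show "standard k" using std by simp
  qed
  then have "Poly_Mapping.lookup (Const l * Mon (?s e + pr c d)) (?s e + pr c d) = 0" by simp
  then show False using l by (simp add: lookup_Const_mult)
qed

text \<open>The constraint is the only active one at \<open>w\<close>, which makes the interval
  \<open>[c, d]\<close> tight. Then all step weights except one satisfy the constraint with
  equality, so the face it cuts out has codimension at most one; strictness on
  \<open>toric_cone\<close> shows that it is proper.\<close>

lemma toric_cone_facet:
  assumes ab: "\<not> a \<le> b" "\<not> b \<le> a" and key: "k \<in> Poly_Mapping.keys (nf a b)"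
    and w: "w \<in> straightening_cone" "weight w k = weight w (pr a b)"
    and multiple: "\<And>v. v \<in> normals \<Longrightarrow> v \<bullet> w = 0 \<Longrightarrow> \<exists>\<mu>>0. v = \<mu> *\<^sub>R facet_normal (pr a b) k"
    and ne: "k \<noteq> pr (inf a b) (sup a b)"
  shows "closure toric_cone \<inter> {x. facet_normal (pr a b) k \<bullet> x = 0} facet_of closure toric_cone"
proof -
  let ?E = "closure toric_cone" and ?v = "facet_normal (pr a b) k"
  let ?F = "?E \<inter> {x. ?v \<bullet> x = 0}"
  obtain c d where cd: "c \<le> d" and k: "k = pr c d"
    using standard_degree_2[of k] nf_keys[OF ab key] by blast
  note key' = key[unfolded k]
  note order = key_order[OF ab cd key']
  have unique: "{a', b'} = {a, b} \<and> k' = pr c d"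
    if ab': "\<not> a' \<le> b'" "\<not> b' \<le> a'" and k': "k' \<in> Poly_Mapping.keys (nf a' b')" "weight w k' = weight w (pr a' b')"
    for a' b' k'
  proof -
    have "facet_normal (pr a' b') k' \<in> normals" unfolding normals_iff using ab' k'(1) by blast
    then obtain \<mu> where \<mu>: "\<mu> > 0" "facet_normal (pr a' b') k' = \<mu> *\<^sub>R ?v"
      using multiple k'(2) inner_facet_normal by (metis diff_self)
    obtain c' d' where cd': "c' \<le> d'" and k'': "k' = pr c' d'"
      using standard_degree_2[of k'] nf_keys[OF ab' k'(1)] by blast
    have "x \<in> {a', b'} \<longleftrightarrow> x \<in> {a, b}" for x
    proof -
      have "x \<in> {a', b'} \<longleftrightarrow> facet_normal (pr a' b') k' $ x < 0"
        using facet_normal_key_neg[OF ab' cd'] k'(1) unfolding k'' by blast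
      also have "\<dots> \<longleftrightarrow> ?v $ x < 0" unfolding \<mu>(2) using \<mu>(1) by (simp add: mult_less_0_iff)
      also have "\<dots> \<longleftrightarrow> x \<in> {a, b}"
        unfolding k by (rule facet_normal_key_neg[OF ab cd key'])
      finally show ?thesis .
    qed
    then have set: "{a', b'} = {a, b}" by blast
    then have pr: "pr a' b' = pr a b" by (auto simp: pr_eq_iff doubleton_eq_iff)
    \<comment> \<open>The variable of \<open>a\<close> occurs once in \<open>pr a b\<close> and in
      neither \<open>k\<close> nor \<open>k'\<close>, so both normals have entry -1 at
      \<open>a\<close> and the factor is 1.\<close>
    have "Poly_Mapping.lookup k' a = 0" "Poly_Mapping.lookup k a = 0"
      using key_disjoint[OF ab' cd' k'(1)[unfolded k'']] key_disjoint[OF ab cd key'] set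
      unfolding k k'' by (auto simp: lookup_add lookup_single when_def)
    moreover have "Poly_Mapping.lookup (pr a b) a = 1"
      using ab by (auto simp: lookup_add lookup_single when_def)
    moreover have "facet_normal (pr a' b') k' $ a = \<mu> * ?v $ a" unfolding \<mu>(2) by simp
    ultimately have "\<mu> = 1" by (simp add: facet_normal_def pr)
    then have "facet_normal (pr a b) k' = ?v" using \<mu>(2) pr by simp
    then have "Poly_Mapping.lookup k' x = Poly_Mapping.lookup k x" for x
      by (simp add: facet_normal_def vec_eq_iff)
    then have "k' = k" by (rule poly_mapping_eqI)
    then show ?thesis using set k by simp
  qed
  have cmp: "(e \<le> a \<or> a \<le> e) \<and> (e \<le> b \<or> b \<le> e)" if "c \<le> e" "e \<le> d" "e \<noteq> a" "e \<noteq> b" for e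
    using comparable_if_unique_active[OF w(1) ab cd key' w(2)[unfolded k] unique that refl]
      comparable_if_unique_active[OF w(1) ab cd key' w(2)[unfolded k] unique that pr_commute] by blast
  have sum: "cnt a x + cnt b x = cnt c x + cnt d x" if "x \<le> CARD('n)" for x
    by (rule cnt_key_sum[OF ab cd key' that])
  have "c \<noteq> inf a b"
  proof
    assume c: "c = inf a b"
    have "d = sup a b"
    proof (rule plucker_eqI_cnt)
      fix x assume x: "x \<le> CARD('n)"
      show "cnt d x = cnt (sup a b) x"
        using sum[OF x] unfolding c cnt_inf[OF x] cnt_sup[OF x] by linarith
    qed
    then show False using ne k c by simp
  qed
  then obtain z where z: "1 \<le> z" "z \<le> CARD('n)" "cnt b z = cnt a z" "1 \<le> cnt a z" "cnt c z = Suc (cnt a z)"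
    "\<And>x. x \<le> CARD('n) \<Longrightarrow> x \<noteq> z \<Longrightarrow> cnt c x = max (cnt a x) (cnt b x)"
    using tight_interval[OF ab order cmp sum key_length[OF ab cd key']] by blast
  \<comment> \<open>At \<open>z\<close> the heights of \<open>c\<close> and \<open>d\<close> are
    \<open>r + 1\<close> and \<open>r - 1\<close>, those of \<open>a\<close> and \<open>b\<close>
    both \<open>r\<close>; only the cut-off \<open>t = r\<close> distinguishes these pairs. At every
    other place the two pairs of heights coincide.\<close>
  define r where "r = cnt a z"
  have step: "?v \<bullet> profile_weight (profile_step x t) = 0"
    if xt: "x \<in> {1..CARD('n)}" "(x, t) \<noteq> (z, r)" for x t
  proof -
    have x: "x \<le> CARD('n)" using xt by simp
    have "real (cnt c x - t) + real (cnt d x - t) = real (cnt a x - t) + real (cnt b x - t)"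
    proof (cases "x = z")
      case True
      then have "cnt d x = cnt a x - 1" "t \<noteq> cnt a x" using sum[OF x] z xt r_def by auto
      then show ?thesis using z True by auto
    next
      case False
      then show ?thesis using z(6)[OF x False] sum[OF x] by (cases "cnt a x \<le> cnt b x") auto
    qed
    then show ?thesis
      unfolding k inner_facet_normal weight_pr profile_weight_step[OF xt(1)] by simp
  qed
  have stepE: "profile_weight (profile_step x t) \<in> ?E" for x t
    by (rule profile_weight_in_closure) (simp add: weakly_rising_def profile_step_def)
  define u where "u = (profile_weight (profile_step z r) :: real ^ 'n plucker)"
  \<comment> \<open>Weights in the closure are modular, hence combinations of steps, with
    coefficients of any sign. All steps but \<open>u\<close> lie in the face.\<close>
  have Espan: "?E \<subseteq> span (insert u ?F)"
  proof
    fix w' assume "w' \<in> ?E"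
    then obtain \<psi> where "w' = profile_weight \<psi>"
      using modular_eq_profile_weight[of w'] closure_toric_cone_modular by blast
    then obtain \<alpha> where w': "w' = (\<Sum>x=1..CARD('n). \<Sum>t<CARD('n). \<alpha> x t *\<^sub>R profile_weight (profile_step x t))"
      using profile_weight_eq_sum_steps[of \<psi>, where 'n = 'n] by blast
    have "profile_weight (profile_step x t) \<in> insert u ?F" if "x \<in> {1..CARD('n)}" for x t
      using step[OF that, of t] stepE[of x t] by (cases "(x, t) = (z, r)") (auto simp: u_def)
    then show "w' \<in> span (insert u ?F)"
      unfolding w' by (intro span_sum span_scale span_base) auto
  qed
  have conv: "convex ?E" by (rule convex_closure_toric_cone)
  have ge: "0 \<le> ?v \<bullet> x" if "x \<in> ?E" for x
    using that closure_toric_cone_subset straightening_coneD[OF _ ab key] by (auto simp: inner_facet_normal)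
  have face: "?F face_of ?E"
    by (rule face_of_Int_supporting_hyperplane_ge[OF conv ge])
  \<comment> \<open>Both sets contain the origin, so their affine dimensions can be computed as
    linear dimensions.\<close>
  have "profile_weight (\<lambda>_ _. 0) = (0 :: real ^ 'n plucker)" by (simp add: profile_weight_def vec_eq_iff)
  then have "0 \<in> ?E" using profile_weight_in_closure[of "\<lambda>_ _. 0"] by (simp add: weakly_rising_def)
  then have zero: "0 \<in> ?F" by simp
  obtain w' where w': "w' \<in> toric_cone" using toric_cone_nonempty by blast
  then have "0 < ?v \<bullet> w'" using toric_coneD(2)[OF w' ab key ne] by (simp add: inner_facet_normal)
  moreover have "w' \<in> ?E" using w' closure_subset by blast
  ultimately have "w' \<in> ?E" "w' \<notin> ?F" by simp_all
  then have "?F \<noteq> ?E" by blast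
  then have "aff_dim ?F < aff_dim ?E" by (rule face_of_aff_dim_lt[OF conv face])
  moreover have "aff_dim ?E \<le> aff_dim ?F + 1"
  proof -
    have "aff_dim ?E = int (dim ?E)" "aff_dim ?F = int (dim ?F)"
      by (rule aff_dim_zero[OF hull_inc[OF \<open>0 \<in> ?E\<close>]], rule aff_dim_zero[OF hull_inc[OF zero]])
    moreover have "dim ?E \<le> dim (insert u ?F)" using dim_subset[OF Espan] by (simp only: dim_span)
    moreover have "dim (insert u ?F) \<le> dim ?F + 1" by (simp add: dim_insert)
    ultimately show ?thesis by linarith
  qed
  ultimately have "aff_dim ?F = aff_dim ?E - 1" by linarith
  then show ?thesis using face zero unfolding facet_of_def by blast
qed

text \<open>The facet is cut out by a single pair and a single monomial of its normal form. If that
  is the monomial of meet and join, the constraint is an equation on \<open>toric_cone\<close>;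
  otherwise \<open>toric_cone_facet\<close> applies.\<close>

lemma straightening_cone_facet:
  assumes F: "F facet_of straightening_cone"
  shows "closure toric_cone \<subseteq> F \<or> F \<inter> closure toric_cone facet_of closure toric_cone"
proof -
  obtain v w where v: "v \<in> normals" "F = straightening_cone \<inter> {x. v \<bullet> x = 0}" "w \<in> F"
    and multiple: "\<And>v'. v' \<in> normals \<Longrightarrow> v' \<bullet> w = 0 \<Longrightarrow> \<exists>\<mu>>0. v' = \<mu> *\<^sub>R v"
    using facet_of_polyhedral_cone[OF finite_normals normals_w0 straightening_cone_eq F] by blast
  obtain a b k where ab: "\<not> a \<le> b" "\<not> b \<le> a" and key: "k \<in> Poly_Mapping.keys (nf a b)"
    and vk: "v = facet_normal (pr a b) k"
    using v(1) unfolding normals_iff by blast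
  show ?thesis
  proof (cases "k = pr (inf a b) (sup a b)")
    case True
    have "toric_cone \<subseteq> {x. v \<bullet> x = 0}"
      using toric_coneD(1)[OF _ ab] by (auto simp: vk True inner_facet_normal)
    then have "closure toric_cone \<subseteq> {x. v \<bullet> x = 0}" by (rule closure_minimal[OF _ closed_hyperplane])
    then show ?thesis using closure_toric_cone_subset v(2) by blast
  next
    case False
    have w: "w \<in> straightening_cone" "weight w k = weight w (pr a b)"
      using v(2,3) by (auto simp: vk inner_facet_normal)
    have "F \<inter> closure toric_cone = closure toric_cone \<inter> {x. v \<bullet> x = 0}"
      using v(2) closure_toric_cone_subset by blast
    then show ?thesis
      using toric_cone_facet[OF ab key w multiple[unfolded vk] False] by (simp add: vk)
  qed
qed

end

theorem theorem9p3:
  fixes F :: "(real ^ 'n::card2 plucker) set"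
  assumes "F facet_of closure (groebner_cone plucker_ideal monomial_ideal)"
  shows "closure (groebner_cone plucker_ideal hibi_ideal) \<subseteq> F \<or>
         F \<inter> closure (groebner_cone plucker_ideal hibi_ideal)
           facet_of closure (groebner_cone plucker_ideal hibi_ideal)"
proof -
  let ?K = "groebner_cone plucker_ideal monomial_ideal :: (real ^ 'n plucker) set"
  \<comment> \<open>A facet is nonempty and lies in the closure, so the cone has a point; it serves
    as the weight \<open>w0\<close> that fixes the normal forms.\<close>
  have "F \<noteq> {}" "F \<subseteq> closure ?K"
    using assms facet_of_imp_subset[OF assms] unfolding facet_of_def by blast+
  then have "?K \<noteq> {}" by auto
  then obtain w0 :: "real ^ 'n plucker" where "initial_ideal w0 plucker_ideal = monomial_ideal"
    by (auto simp: groebner_cone_def)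
  then obtain nf where "plucker_straightening w0 nf" by (rule ex_plucker_straightening)
  then interpret plucker_straightening w0 nf .
  show ?thesis
    using straightening_cone_facet assms
    unfolding groebner_cone_monomial groebner_cone_hibi closure_strict_cone by blast
qed

end
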